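(* Let $R$ be a commutative ring, let $\mathbb G$ be a functor of monoids and let $\mathbb M,\mathbb M'$ be functors of $\mathbb G$-modules. Assume that $\mathbb A_{\mathbb G},\mathbb M,\mathbb M'\in\mathfrak F$. Let $f:\mathbb M\to\mathbb M'$ be a morphism of $\mathcal R$-modules. Then $f$ is a morphism of $\mathbb G$-modules if and only if $f_R$ is a morphism of $\mathbb A_{\mathbb G}^*(R)$-modules. Moreover, let $M$ be an $R$-module such that $\mathcal M$ is a $\mathbb G$-module. Then the set of quasi-coherent $\mathbb G$-submodules of $\mathcal M$ is equal to the set of $\mathbb A_{\mathbb G}^*(R)$-submodules of $M$ (via $\mathcal M'\leftrightarrow M'$).
   Context: $R$ is a commutative ring with unit. All functors are covariant functors from the category of commutative $R$-algebras to sets. $\mathcal R$ is the functor of rings $\mathcal R(S)=S$. A functor of $\mathcal R$-modules is a functor $\mathbb M$ with morphisms of functors $\mathbb M\times\mathbb M\to\mathbb M$, $\mathcal R\times\mathbb M\to\mathbb M$ making each $\mathbb M(S)$ an $S$-module; morphisms $f$ have each $f_S$ $S$-linear. $\underline{\mathrm{Hom}}_{\mathcal R}(\mathbb M,\mathbb M')(S)=\mathrm{Hom}_{\mathcal S}(\mathbb M_{|S},\mathbb M'_{|S})$, where $_{|S}$ is restriction to commutative $S$-algebras; $\mathbb M^*=\underline{\mathrm{Hom}}_{\mathcal R}(\mathbb M,\mathcal R)$. For an $R$-module $M$, $\mathcal M(S)=M\otimes_RS$ is the quasi-coherent module associated with $M$. For a set $\alpha$: $\mathcal R^{(\alpha)}=\oplus_\alpha\mathcal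 R$; for $\alpha_1\subseteq\alpha_2$ there is the projection $\mathcal R^{(\alpha_2)}\to\mathcal R^{(\alpha_1)}$. $\mathbb M$ is essentially free if there exist a set $I$, a set $P$ of subsets of $I$ with $\alpha\cup\alpha'\in P$ for all $\alpha,\alpha'\in P$, and an isomorphism $\mathbb M\simeq\varprojlim_{\alpha\in P}\mathcal R^{(\alpha)}$ (pointwise limit). $\mathfrak F$ is the category of essentially free $\mathcal R$-modules (all reflexive, i.e. $\mathbb M=\mathbb M^{**}$; quasi-coherent modules are also reflexive). A functor of $\mathcal R$-algebras is a functor of (associative, unital) rings $\mathbb A$ with a morphism of functors of rings $\mathcal R\to\mathbb A$ with central image. For a functor of monoids $\mathbb G$, $\mathbb A_{\mathbb G}=\underline{\mathrm{Hom}}(\mathbb G,\mathcal R)$ is its functor of functions, $\mathbb A_{\mathbb G}(S)=\mathrm{Hom}(\mathbb G_{|S},\mathcal S)$ (morphisms of functors of sets). When $\mathbb A_{\mathbb G}$ is reflexive, $\mathbb A_{\mathbb G}^*$ carries the unique structure of functor of $\mathcal R$-algebras for which the evaluation morphism $\mathbb G\to\mathbb A_{\mathbb G}^*$ is a morphism of functors of monoids. A functor of $\mathbb G$-modules is a functor of $\mathcal R$-modules $\mathbb M$ with a morphism of functors of monoids $\mathbb G\to\underline{\mathrm{End}}_{\mathcal R}(\mathbb M)$; if $\mathbb M$ is a dual functor of $\mathcal R$-modules (of the form $\mathbb N^*$), this extends uniquely to a morphism of functors of algebras $\mathbb A_{\mathbb G}^*\to\underline{\mathrm{End}}_{\mathcal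 R}(\mathbb M)$, i.e. to an $\mathbb A_{\mathbb G}^*$-module structure. Convention: for an $R$-submodule $M'\subseteq M$, $\mathcal M'$ is by abuse of language called a quasi-coherent submodule of $\mathcal M$ (even if $\mathcal M'\to\mathcal M$ is not pointwise injective); it is a quasi-coherent $\mathbb G$-submodule if $\mathcal M'$ has a $\mathbb G$-module structure for which $\mathcal M'\to\mathcal M$ is a morphism of $\mathbb G$-modules. *)

theory Defs
  imports "HOL-Algebra.Module" "HOL-Algebra.AbelCoset" "HOL-Algebra.Generated_Groups" "HOL-Algebra.Free_Abelian_Groups"
begin

text \<open>
  Universe convention. HOL cannot quantify over all commutative \<open>R\<close>-algebras at once, so a type
  \<open>'u\<close> plays the role of the universe: rings, \<open>R\<close>-algebras, \<open>R\<close>-modules and index sets are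
  exactly those carried by subsets of \<open>'u\<close>. Values of functors may lie in arbitrary types.
  When \<open>'u\<close> is infinite, polynomial rings in \<open>'u\<close>-many variables over a \<open>'u\<close>-small ring and
  symmetric algebras of \<open>'u\<close>-small modules are again (up to isomorphism) \<open>'u\<close>-small, which is the
  closure property that representability (Yoneda) arguments use.

  A commutative \<open>R\<close>-algebra is the library's \<^term>\<open>algebra R S\<close>.
\<close>

type_synonym 'u alg = "('u, 'u) module"

text \<open>The \<^term>\<open>extensional\<close> clause makes morphisms with equal values equal as HOL functions.\<close>

definition alg_hom :: "'u ring \<Rightarrow> 'u alg \<Rightarrow> 'u alg \<Rightarrow> ('u \<Rightarrow> 'u) set" where
  "alg_hom R S T = {h \<in> ring_hom S T.
     h \<in> extensional (carrier S) \<and>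
     (\<forall>r\<in>carrier R. \<forall>s\<in>carrier S. h (r \<odot>\<^bsub>S\<^esub> s) = r \<odot>\<^bsub>T\<^esub> h s)}"

abbreviation id_hom :: "'u alg \<Rightarrow> 'u \<Rightarrow> 'u" where
  "id_hom S \<equiv> (\<lambda>s\<in>carrier S. s)"

text \<open>A ring as a module (and algebra) over itself.\<close>

definition self_module :: "('u, 'z) ring_scheme \<Rightarrow> 'u alg" where
  "self_module S = \<lparr>carrier = carrier S, monoid.mult = monoid.mult S, one = \<one>\<^bsub>S\<^esub>,
     ring.zero = \<zero>\<^bsub>S\<^esub>, add = ring.add S, smult = monoid.mult S\<rparr>"

section \<open>Functors\<close>

text \<open>
  \<open>'s\<close> is the type of the structures taken as values (records of sets, monoids, modules, ...)
  and \<open>'x\<close> the type of their elements.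
\<close>

record ('u, 'x, 's) ftor =
  obj :: "'u alg \<Rightarrow> 's"
  arr :: "'u alg \<Rightarrow> 'u alg \<Rightarrow> ('u \<Rightarrow> 'u) \<Rightarrow> 'x \<Rightarrow> 'x"

type_synonym ('u, 'x) monoid_ftor = "('u, 'x, 'x monoid) ftor"
type_synonym ('u, 'x) module_ftor = "('u, 'x, ('u, 'x) module) ftor"

definition set_functor :: "'u ring \<Rightarrow> ('u, 'x, ('x, 'z) partial_object_scheme) ftor \<Rightarrow> bool" where
  "set_functor R F \<longleftrightarrow>
     (\<forall>S T h. algebra R S \<longrightarrow> algebra R T \<longrightarrow> h \<in> alg_hom R S T \<longrightarrow>
        arr F S T h \<in> carrier (obj F S) \<rightarrow> carrier (obj F T)) \<and>
     (\<forall>S x. algebra R S \<longrightarrow> x \<in> carrier (obj F S) \<longrightarrow> arr F S S (id_hom S) x = x) \<and>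
     (\<forall>S T U h k x. algebra R S \<longrightarrow> algebra R T \<longrightarrow> algebra R U \<longrightarrow>
        h \<in> alg_hom R S T \<longrightarrow> k \<in> alg_hom R T U \<longrightarrow> x \<in> carrier (obj F S) \<longrightarrow>
        arr F S U (compose (carrier S) k h) x = arr F T U k (arr F S T h x))"

definition monoid_functor :: "'u ring \<Rightarrow> ('u, 'g) monoid_ftor \<Rightarrow> bool" where
  "monoid_functor R G \<longleftrightarrow> set_functor R G \<and>
     (\<forall>S. algebra R S \<longrightarrow> Group.monoid (obj G S)) \<and>
     (\<forall>S T h. algebra R S \<longrightarrow> algebra R T \<longrightarrow> h \<in> alg_hom R S T \<longrightarrow>
        arr G S T h \<in> hom (obj G S) (obj G T) \<and> arr G S T h \<one>\<^bsub>obj G S\<^esub> = \<one>\<^bsub>obj G T\<^esub>)"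

definition module_functor :: "'u ring \<Rightarrow> ('u, 'x) module_ftor \<Rightarrow> bool" where
  "module_functor R M \<longleftrightarrow> set_functor R M \<and>
     (\<forall>S. algebra R S \<longrightarrow> module S (obj M S)) \<and>
     (\<forall>S T h. algebra R S \<longrightarrow> algebra R T \<longrightarrow> h \<in> alg_hom R S T \<longrightarrow>
        (\<forall>x\<in>carrier (obj M S). \<forall>y\<in>carrier (obj M S).
           arr M S T h (x \<oplus>\<^bsub>obj M S\<^esub> y) = arr M S T h x \<oplus>\<^bsub>obj M T\<^esub> arr M S T h y) \<and>
        (\<forall>s\<in>carrier S. \<forall>x\<in>carrier (obj M S).
           arr M S T h (s \<odot>\<^bsub>obj M S\<^esub> x) = h s \<odot>\<^bsub>obj M T\<^esub> arr M S T h x))"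

text \<open>
  The structural morphism from the functor of rings \<open>S \<mapsto> S\<close> is \<open>s \<mapsto> s \<odot> \<one>\<close>; it is
  required to be a ring morphism with central image that induces the given module structure.
\<close>

definition algebra_functor :: "'u ring \<Rightarrow> ('u, 'x) module_ftor \<Rightarrow> bool" where
  "algebra_functor R A \<longleftrightarrow> module_functor R A \<and>
     (\<forall>S. algebra R S \<longrightarrow> ring (obj A S) \<and>
        (\<lambda>s. s \<odot>\<^bsub>obj A S\<^esub> \<one>\<^bsub>obj A S\<^esub>) \<in> ring_hom S (obj A S) \<and>
        (\<forall>s\<in>carrier S. \<forall>a\<in>carrier (obj A S).
           (s \<odot>\<^bsub>obj A S\<^esub> \<one>\<^bsub>obj A S\<^esub>) \<otimes>\<^bsub>obj A S\<^esub> a = a \<otimes>\<^bsub>obj A S\<^esub> (s \<odot>\<^bsub>obj A S\<^esub> \<one>\<^bsub>obj A S\<^esub>) \<and>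
           s \<odot>\<^bsub>obj A S\<^esub> a = (s \<odot>\<^bsub>obj A S\<^esub> \<one>\<^bsub>obj A S\<^esub>) \<otimes>\<^bsub>obj A S\<^esub> a)) \<and>
     (\<forall>S T h. algebra R S \<longrightarrow> algebra R T \<longrightarrow> h \<in> alg_hom R S T \<longrightarrow>
        arr A S T h \<in> ring_hom (obj A S) (obj A T))"

section \<open>Morphisms of functors\<close>

definition set_morphism ::
  "'u ring \<Rightarrow> ('u, 'x, ('x, 'z) partial_object_scheme) ftor \<Rightarrow>
     ('u, 'y, ('y, 'w) partial_object_scheme) ftor \<Rightarrow> ('u alg \<Rightarrow> 'x \<Rightarrow> 'y) \<Rightarrow> bool" where
  "set_morphism R F F' f \<longleftrightarrow>
     (\<forall>S. algebra R S \<longrightarrow> f S \<in> carrier (obj F S) \<rightarrow> carrier (obj F' S)) \<and>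
     (\<forall>S T h x. algebra R S \<longrightarrow> algebra R T \<longrightarrow> h \<in> alg_hom R S T \<longrightarrow> x \<in> carrier (obj F S) \<longrightarrow>
        f T (arr F S T h x) = arr F' S T h (f S x))"

definition monoid_morphism ::
  "'u ring \<Rightarrow> ('u, 'x, ('x, 'z) monoid_scheme) ftor \<Rightarrow>
     ('u, 'y, ('y, 'w) monoid_scheme) ftor \<Rightarrow> ('u alg \<Rightarrow> 'x \<Rightarrow> 'y) \<Rightarrow> bool" where
  "monoid_morphism R G H f \<longleftrightarrow> set_morphism R G H f \<and>
     (\<forall>S. algebra R S \<longrightarrow> f S \<in> hom (obj G S) (obj H S) \<and> f S \<one>\<^bsub>obj G S\<^esub> = \<one>\<^bsub>obj H S\<^esub>)"

definition module_morphism ::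
  "'u ring \<Rightarrow> ('u, 'x) module_ftor \<Rightarrow> ('u, 'y) module_ftor \<Rightarrow> ('u alg \<Rightarrow> 'x \<Rightarrow> 'y) \<Rightarrow> bool" where
  "module_morphism R M M' f \<longleftrightarrow> set_morphism R M M' f \<and>
     (\<forall>S. algebra R S \<longrightarrow>
        (\<forall>x\<in>carrier (obj M S). \<forall>y\<in>carrier (obj M S).
           f S (x \<oplus>\<^bsub>obj M S\<^esub> y) = f S x \<oplus>\<^bsub>obj M' S\<^esub> f S y) \<and>
        (\<forall>s\<in>carrier S. \<forall>x\<in>carrier (obj M S).
           f S (s \<odot>\<^bsub>obj M S\<^esub> x) = s \<odot>\<^bsub>obj M' S\<^esub> f S x))"

definition algebra_morphism ::
  "'u ring \<Rightarrow> ('u, 'x) module_ftor \<Rightarrow> ('u, 'y) module_ftor \<Rightarrow> ('u alg \<Rightarrow> 'x \<Rightarrow> 'y) \<Rightarrow> bool" where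
  "algebra_morphism R A B f \<longleftrightarrow> module_morphism R A B f \<and> monoid_morphism R A B f"

section \<open>Functors of morphisms\<close>

text \<open>
  An \<open>S\<close>-algebra, for an \<open>R\<close>-algebra \<open>S\<close>, is given as an \<open>R\<close>-algebra \<open>T\<close> with a morphism
  \<open>\<phi> : S \<rightarrow> T\<close>; so a morphism between the restrictions of two functors to \<open>S\<close>-algebras is a family
  indexed by the pairs \<open>(T, \<phi>)\<close>.
\<close>

definition alg_over :: "'u ring \<Rightarrow> 'u alg \<Rightarrow> 'u alg \<Rightarrow> ('u \<Rightarrow> 'u) \<Rightarrow> bool" where
  "alg_over R S T \<phi> \<longleftrightarrow> algebra R T \<and> \<phi> \<in> alg_hom R S T"

type_synonym ('u, 'x, 'y) family = "'u alg \<Rightarrow> ('u \<Rightarrow> 'u) \<Rightarrow> 'x \<Rightarrow> 'y"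

definition family_over ::
  "'u ring \<Rightarrow> 'u alg \<Rightarrow> ('u alg \<Rightarrow> ('u \<Rightarrow> 'u) \<Rightarrow> 'b) \<Rightarrow> 'u alg \<Rightarrow> ('u \<Rightarrow> 'u) \<Rightarrow> 'b" where
  "family_over R S t = (\<lambda>T \<phi>. if alg_over R S T \<phi> then t T \<phi> else undefined)"

definition Hom_over ::
  "'u ring \<Rightarrow> 'u alg \<Rightarrow> ('u, 'x, ('x, 'z) partial_object_scheme) ftor \<Rightarrow>
     ('u, 'y, ('y, 'w) partial_object_scheme) ftor \<Rightarrow> ('u, 'x, 'y) family set" where
  "Hom_over R S F F' = {t.
     t = family_over R S t \<and>
     (\<forall>T \<phi>. alg_over R S T \<phi> \<longrightarrow> t T \<phi> \<in> carrier (obj F T) \<rightarrow>\<^sub>E carrier (obj F' T)) \<and>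
     (\<forall>T \<phi> U h x. alg_over R S T \<phi> \<longrightarrow> alg_over R T U h \<longrightarrow> x \<in> carrier (obj F T) \<longrightarrow>
        t U (compose (carrier S) h \<phi>) (arr F T U h x) = arr F' T U h (t T \<phi> x))}"

definition lin_Hom_over ::
  "'u ring \<Rightarrow> 'u alg \<Rightarrow> ('u, 'x) module_ftor \<Rightarrow> ('u, 'y) module_ftor \<Rightarrow> ('u, 'x, 'y) family set" where
  "lin_Hom_over R S M M' = {t \<in> Hom_over R S M M'. \<forall>T \<phi>. alg_over R S T \<phi> \<longrightarrow>
     (\<forall>x\<in>carrier (obj M T). \<forall>y\<in>carrier (obj M T).
        t T \<phi> (x \<oplus>\<^bsub>obj M T\<^esub> y) = t T \<phi> x \<oplus>\<^bsub>obj M' T\<^esub> t T \<phi> y) \<and>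
     (\<forall>a\<in>carrier T. \<forall>x\<in>carrier (obj M T).
        t T \<phi> (a \<odot>\<^bsub>obj M T\<^esub> x) = a \<odot>\<^bsub>obj M' T\<^esub> t T \<phi> x)}"

text \<open>
  The \<open>S\<close>-module structure that a set \<open>H\<close> of families inherits pointwise from the target. The
  fields \<^term>\<open>monoid.mult\<close> and \<^term>\<open>one\<close> of a module record carry no meaning.
\<close>

definition pointwise_module ::
  "'u ring \<Rightarrow> 'u alg \<Rightarrow> ('u, 'x, ('x, 'z) partial_object_scheme) ftor \<Rightarrow> ('u, 'y) module_ftor \<Rightarrow>
     ('u, 'x, 'y) family set \<Rightarrow> ('u, ('u, 'x, 'y) family) module" where
  "pointwise_module R S F M' H = \<lparr>carrier = H, monoid.mult = undefined, one = undefined,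
     ring.zero = family_over R S (\<lambda>T \<phi>. \<lambda>x\<in>carrier (obj F T). \<zero>\<^bsub>obj M' T\<^esub>),
     add = (\<lambda>t u. family_over R S (\<lambda>T \<phi>. \<lambda>x\<in>carrier (obj F T). t T \<phi> x \<oplus>\<^bsub>obj M' T\<^esub> u T \<phi> x)),
     smult = (\<lambda>s t. family_over R S (\<lambda>T \<phi>. \<lambda>x\<in>carrier (obj F T). \<phi> s \<odot>\<^bsub>obj M' T\<^esub> t T \<phi> x))\<rparr>"

definition restrict_family ::
  "'u ring \<Rightarrow> 'u alg \<Rightarrow> 'u alg \<Rightarrow> ('u \<Rightarrow> 'u) \<Rightarrow> ('u, 'x, 'y) family \<Rightarrow> ('u, 'x, 'y) family" where
  "restrict_family R S S' h t = family_over R S' (\<lambda>T \<phi>. t T (compose (carrier S) \<phi> h))"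

definition base_functor :: "('u, 'u) module_ftor" where
  "base_functor = \<lparr>obj = self_module, arr = (\<lambda>S T h. h)\<rparr>"

definition function_functor ::
  "'u ring \<Rightarrow> ('u, 'x, ('x, 'z) partial_object_scheme) ftor \<Rightarrow>
     ('u, ('u, 'x, 'u) family) module_ftor" where
  "function_functor R F =
     \<lparr>obj = (\<lambda>S. pointwise_module R S F base_functor (Hom_over R S F base_functor)),
      arr = restrict_family R\<rparr>"

definition internal_Hom ::
  "'u ring \<Rightarrow> ('u, 'x) module_ftor \<Rightarrow> ('u, 'y) module_ftor \<Rightarrow>
     ('u, ('u, 'x, 'y) family) module_ftor" where
  "internal_Hom R M M' =
     \<lparr>obj = (\<lambda>S. pointwise_module R S M M' (lin_Hom_over R S M M')),
      arr = restrict_family R\<rparr>"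

definition dual_functor ::
  "'u ring \<Rightarrow> ('u, 'x) module_ftor \<Rightarrow> ('u, ('u, 'x, 'u) family) module_ftor" where
  "dual_functor R M = internal_Hom R M base_functor"

definition with_mult_one ::
  "('u, 'x) module_ftor \<Rightarrow> ('u alg \<Rightarrow> 'x \<Rightarrow> 'x \<Rightarrow> 'x) \<Rightarrow> ('u alg \<Rightarrow> 'x) \<Rightarrow> ('u, 'x) module_ftor" where
  "with_mult_one M m e = M\<lparr>obj := (\<lambda>S. (obj M S)\<lparr>monoid.mult := m S, one := e S\<rparr>)\<rparr>"

definition End_functor ::
  "'u ring \<Rightarrow> ('u, 'x) module_ftor \<Rightarrow> ('u, ('u, 'x, 'x) family) module_ftor" where
  "End_functor R M = with_mult_one (internal_Hom R M M)
     (\<lambda>S t u. family_over R S (\<lambda>T \<phi>. compose (carrier (obj M T)) (t T \<phi>) (u T \<phi>)))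
     (\<lambda>S. family_over R S (\<lambda>T \<phi>. \<lambda>x\<in>carrier (obj M T). x))"

section \<open>Essentially free modules\<close>

text \<open>\<open>free_functor \<alpha>\<close> is the direct sum of copies of \<^term>\<open>base_functor\<close> indexed by \<open>\<alpha>\<close>.\<close>

definition free_functor :: "'u set \<Rightarrow> ('u, 'u \<Rightarrow> 'u) module_ftor" where
  "free_functor \<alpha> =
     \<lparr>obj = (\<lambda>S. \<lparr>carrier = {c \<in> \<alpha> \<rightarrow>\<^sub>E carrier S. finite {i \<in> \<alpha>. c i \<noteq> \<zero>\<^bsub>S\<^esub>}},
        monoid.mult = undefined, one = undefined,
        ring.zero = (\<lambda>i\<in>\<alpha>. \<zero>\<^bsub>S\<^esub>),
        add = (\<lambda>c d. \<lambda>i\<in>\<alpha>. c i \<oplus>\<^bsub>S\<^esub> d i),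
        smult = (\<lambda>s c. \<lambda>i\<in>\<alpha>. s \<otimes>\<^bsub>S\<^esub> c i)\<rparr>),
      arr = (\<lambda>S T h c. \<lambda>i\<in>\<alpha>. h (c i))\<rparr>"

text \<open>The transition map for \<open>\<alpha> \<subseteq> \<beta>\<close> is the projection, i.e. restriction of families to \<open>\<alpha>\<close>.\<close>

definition lim_free_functor :: "'u set set \<Rightarrow> ('u, 'u set \<Rightarrow> 'u \<Rightarrow> 'u) module_ftor" where
  "lim_free_functor P =
     \<lparr>obj = (\<lambda>S. \<lparr>carrier = {c \<in> (\<Pi>\<^sub>E \<alpha>\<in>P. carrier (obj (free_functor \<alpha>) S)).
          \<forall>\<alpha>\<in>P. \<forall>\<beta>\<in>P. \<alpha> \<subseteq> \<beta> \<longrightarrow> restrict (c \<beta>) \<alpha> = c \<alpha>},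
        monoid.mult = undefined, one = undefined,
        ring.zero = (\<lambda>\<alpha>\<in>P. \<zero>\<^bsub>obj (free_functor \<alpha>) S\<^esub>),
        add = (\<lambda>c d. \<lambda>\<alpha>\<in>P. c \<alpha> \<oplus>\<^bsub>obj (free_functor \<alpha>) S\<^esub> d \<alpha>),
        smult = (\<lambda>s c. \<lambda>\<alpha>\<in>P. s \<odot>\<^bsub>obj (free_functor \<alpha>) S\<^esub> c \<alpha>)\<rparr>),
      arr = (\<lambda>S T h c. \<lambda>\<alpha>\<in>P. arr (free_functor \<alpha>) S T h (c \<alpha>))\<rparr>"

definition essentially_free :: "'u ring \<Rightarrow> ('u, 'x) module_ftor \<Rightarrow> bool" where
  "essentially_free R M \<longleftrightarrow> module_functor R M \<and>
     (\<exists>(I :: 'u set) P. P \<subseteq> Pow I \<and> (\<forall>\<alpha>\<in>P. \<forall>\<beta>\<in>P. \<alpha> \<union> \<beta> \<in> P) \<and>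
        (\<exists>f. module_morphism R M (lim_free_functor P) f \<and>
           (\<forall>S. algebra R S \<longrightarrow>
              bij_betw (f S) (carrier (obj M S)) (carrier (obj (lim_free_functor P) S)))))"

section \<open>Functors of \<open>G\<close>-modules and the algebra dual to the functions on \<open>G\<close>\<close>

type_synonym ('u, 'a, 'x) action = "'u alg \<Rightarrow> 'a \<Rightarrow> ('u, 'x, 'x) family"

definition act :: "('u, 'a, 'x) action \<Rightarrow> 'u alg \<Rightarrow> 'a \<Rightarrow> 'x \<Rightarrow> 'x" where
  "act \<rho> S a x = \<rho> S a S (id_hom S) x"

definition G_module ::
  "'u ring \<Rightarrow> ('u, 'g) monoid_ftor \<Rightarrow> ('u, 'x) module_ftor \<Rightarrow> ('u, 'g, 'x) action \<Rightarrow> bool" where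
  "G_module R G M \<rho> \<longleftrightarrow> module_functor R M \<and> monoid_morphism R G (End_functor R M) \<rho>"

definition G_module_morphism ::
  "'u ring \<Rightarrow> ('u, 'g) monoid_ftor \<Rightarrow> ('u, 'x) module_ftor \<Rightarrow> ('u, 'g, 'x) action \<Rightarrow>
     ('u, 'y) module_ftor \<Rightarrow> ('u, 'g, 'y) action \<Rightarrow> ('u alg \<Rightarrow> 'x \<Rightarrow> 'y) \<Rightarrow> bool" where
  "G_module_morphism R G M \<rho> M' \<rho>' f \<longleftrightarrow> module_morphism R M M' f \<and>
     (\<forall>S. algebra R S \<longrightarrow> (\<forall>g\<in>carrier (obj G S). \<forall>x\<in>carrier (obj M S).
        f S (act \<rho> S g x) = act \<rho>' S g (f S x)))"

type_synonym ('u, 'g) dist = "('u, ('u, 'g, 'u) family, 'u) family"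

definition evaluation ::
  "'u ring \<Rightarrow> ('u, 'g) monoid_ftor \<Rightarrow> 'u alg \<Rightarrow> 'g \<Rightarrow> ('u, 'g) dist" where
  "evaluation R G S g = family_over R S (\<lambda>T \<phi>. \<lambda>a\<in>carrier (obj (function_functor R G) T).
     a T (id_hom T) (arr G S T \<phi> g))"

text \<open>
  \<open>A\<close> is the dual of the functor of functions on \<open>G\<close> together with a structure of functor of
  algebras for which evaluation is a morphism of functors of monoids. This determines \<open>A\<close> (on
  the relevant carriers) when the functor of functions is reflexive.
\<close>

definition dual_algebra ::
  "'u ring \<Rightarrow> ('u, 'g) monoid_ftor \<Rightarrow> ('u, ('u, 'g) dist) module_ftor \<Rightarrow> bool" where
  "dual_algebra R G A \<longleftrightarrow> (\<exists>m e. A = with_mult_one (dual_functor R (function_functor R G)) m e) \<and>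
     algebra_functor R A \<and> monoid_morphism R G A (evaluation R G)"

text \<open>
  \<open>\<sigma>\<close> is an extension of the \<open>G\<close>-action \<open>\<rho>\<close> to a morphism of functors of algebras; it exists and is
  unique (on the relevant carriers) when \<open>M\<close> is the dual of a functor of modules.
\<close>

definition extends_action ::
  "'u ring \<Rightarrow> ('u, 'g) monoid_ftor \<Rightarrow> ('u, ('u, 'g) dist) module_ftor \<Rightarrow> ('u, 'x) module_ftor \<Rightarrow>
     ('u, 'g, 'x) action \<Rightarrow> ('u, ('u, 'g) dist, 'x) action \<Rightarrow> bool" where
  "extends_action R G A M \<rho> \<sigma> \<longleftrightarrow> algebra_morphism R A (End_functor R M) \<sigma> \<and>
     (\<forall>S. algebra R S \<longrightarrow> (\<forall>g\<in>carrier (obj G S). \<sigma> S (evaluation R G S g) = \<rho> S g))"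

text \<open>
  Morphisms of modules over a possibly noncommutative ring \<open>A\<close> acting through \<open>\<cdot>\<close> and \<open>\<cdot>'\<close>
  (the library's modules are over commutative rings).
\<close>

definition left_module_hom ::
  "('a, 'z) ring_scheme \<Rightarrow> ('x, 'v) ring_scheme \<Rightarrow> ('a \<Rightarrow> 'x \<Rightarrow> 'x) \<Rightarrow>
     ('y, 'w) ring_scheme \<Rightarrow> ('a \<Rightarrow> 'y \<Rightarrow> 'y) \<Rightarrow> ('x \<Rightarrow> 'y) \<Rightarrow> bool" where
  "left_module_hom A M p M' p' f \<longleftrightarrow> f \<in> carrier M \<rightarrow> carrier M' \<and>
     (\<forall>x\<in>carrier M. \<forall>y\<in>carrier M. f (x \<oplus>\<^bsub>M\<^esub> y) = f x \<oplus>\<^bsub>M'\<^esub> f y) \<and>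
     (\<forall>a\<in>carrier A. \<forall>x\<in>carrier M. f (p a x) = p' a (f x))"

definition left_submodule ::
  "('a, 'z) ring_scheme \<Rightarrow> ('x, 'v) ring_scheme \<Rightarrow> ('a \<Rightarrow> 'x \<Rightarrow> 'x) \<Rightarrow> 'x set \<Rightarrow> bool" where
  "left_submodule A M p N \<longleftrightarrow> additive_subgroup N M \<and> (\<forall>a\<in>carrier A. \<forall>x\<in>N. p a x \<in> N)"

section \<open>Quasi-coherent modules\<close>

type_synonym 'u tensor = "('u \<times> 'u \<Rightarrow>\<^sub>0 int) set"

abbreviation tensor_free :: "('u, 'u) module \<Rightarrow> 'u alg \<Rightarrow> ('u \<times> 'u \<Rightarrow>\<^sub>0 int) monoid" where
  "tensor_free M S \<equiv> free_Abelian_group (carrier M \<times> carrier S)"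

definition tensor_relations :: "'u ring \<Rightarrow> ('u, 'u) module \<Rightarrow> 'u alg \<Rightarrow> 'u tensor" where
  "tensor_relations R M S = generate (tensor_free M S)
     ({frag_of (x \<oplus>\<^bsub>M\<^esub> y, s) - frag_of (x, s) - frag_of (y, s) | x y s.
         x \<in> carrier M \<and> y \<in> carrier M \<and> s \<in> carrier S} \<union>
      {frag_of (x, s \<oplus>\<^bsub>S\<^esub> t) - frag_of (x, s) - frag_of (x, t) | x s t.
         x \<in> carrier M \<and> s \<in> carrier S \<and> t \<in> carrier S} \<union>
      {frag_of (r \<odot>\<^bsub>M\<^esub> x, s) - frag_of (x, r \<odot>\<^bsub>S\<^esub> s) | r x s.
         r \<in> carrier R \<and> x \<in> carrier M \<and> s \<in> carrier S})"

text \<open>The map on cosets modulo \<open>tensor_relations\<close> induced by an additive map \<open>f\<close> of formal sums.\<close>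

definition tensor_map ::
  "'u ring \<Rightarrow> ('u, 'u) module \<Rightarrow> 'u alg \<Rightarrow> (('u \<times> 'u \<Rightarrow>\<^sub>0 int) \<Rightarrow> ('u \<times> 'u \<Rightarrow>\<^sub>0 int)) \<Rightarrow>
     'u tensor \<Rightarrow> 'u tensor" where
  "tensor_map R M S f C = (\<Union>c\<in>C. tensor_relations R M S #>\<^bsub>tensor_free M S\<^esub> f c)"

definition pure_tensor :: "'u ring \<Rightarrow> ('u, 'u) module \<Rightarrow> 'u alg \<Rightarrow> 'u \<Rightarrow> 'u \<Rightarrow> 'u tensor" where
  "pure_tensor R M S x s = tensor_relations R M S #>\<^bsub>tensor_free M S\<^esub> frag_of (x, s)"

definition tensor_module :: "'u ring \<Rightarrow> ('u, 'u) module \<Rightarrow> 'u alg \<Rightarrow> ('u, 'u tensor) module" where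
  "tensor_module R M S =
     \<lparr>carrier = carrier (tensor_free M S Mod tensor_relations R M S),
      monoid.mult = undefined, one = undefined,
      ring.zero = monoid.one (tensor_free M S Mod tensor_relations R M S),
      add = monoid.mult (tensor_free M S Mod tensor_relations R M S),
      smult = (\<lambda>s. tensor_map R M S (frag_extend (\<lambda>(x, t). frag_of (x, s \<otimes>\<^bsub>S\<^esub> t))))\<rparr>"

definition quasi_coherent :: "'u ring \<Rightarrow> ('u, 'u) module \<Rightarrow> ('u, 'u tensor) module_ftor" where
  "quasi_coherent R M =
     \<lparr>obj = tensor_module R M,
      arr = (\<lambda>S T h. tensor_map R M T (frag_extend (\<lambda>(x, s). frag_of (x, h s))))\<rparr>"

text \<open>
  For a submodule \<open>N\<close> of \<open>M\<close>, the morphism of quasi-coherent modules induced by the inclusion;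
  it need not be pointwise injective.
\<close>

definition quasi_coherent_incl :: "'u ring \<Rightarrow> ('u, 'u) module \<Rightarrow> 'u alg \<Rightarrow> 'u tensor \<Rightarrow> 'u tensor" where
  "quasi_coherent_incl R M S = tensor_map R M S (\<lambda>c. c)"

definition quasi_coherent_G_submodule ::
  "'u ring \<Rightarrow> ('u, 'g) monoid_ftor \<Rightarrow> ('u, 'u) module \<Rightarrow> ('u, 'g, 'u tensor) action \<Rightarrow> 'u set \<Rightarrow> bool"
  where
  "quasi_coherent_G_submodule R G M \<rho> N \<longleftrightarrow> submodule N R M \<and>
     (\<exists>\<rho>'. G_module R G (quasi_coherent R (M\<lparr>carrier := N\<rparr>)) \<rho>' \<and>
        G_module_morphism R G (quasi_coherent R (M\<lparr>carrier := N\<rparr>)) \<rho>' (quasi_coherent R M) \<rho>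
          (quasi_coherent_incl R M))"

text \<open>
  An action on the module \<open>M \<otimes>\<^sub>R R\<close> of \<open>R\<close>-points, transported to \<open>M\<close> along \<open>x \<mapsto> x \<otimes> 1\<close>.
\<close>

definition action_on_module ::
  "'u ring \<Rightarrow> ('u, 'u) module \<Rightarrow> ('u, 'a, 'u tensor) action \<Rightarrow> 'a \<Rightarrow> 'u \<Rightarrow> 'u" where
  "action_on_module R M \<sigma> a x =
     the_inv_into (carrier M) (\<lambda>y. pure_tensor R M (self_module R) y \<one>\<^bsub>R\<^esub>)
       (act \<sigma> (self_module R) a (pure_tensor R M (self_module R) x \<one>\<^bsub>R\<^esub>))"

end

theory Submission
  imports Defs
begin

text \<open>
  An essentially free module is a functor \<open>S \<mapsto> {d : J \<rightarrow> S | d has finite support on every K \<in> \<K>}\<close>.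
  Evaluating a linear map \<open>w\<close> from such a functor at the generic point \<open>(t\<^sub>j)\<close> over a square-zero
  extension, and specializing to \<open>\<epsilon> x\<close> over the dual numbers, gives \<open>w(x) = \<Sum>\<^sub>j x\<^sub>j w(e\<^sub>j)\<close> with
  finitely many nonzero terms, for scalar and for quasi-coherent targets. Hence linear maps are
  determined by their values on points over \<open>R\<close>; duals are again of this form, with the orthogonal
  family of subsets; and a linear form on the dual of the functions on \<open>G\<close> is evaluation at a function,
  so it vanishes if it vanishes at the points of \<open>G\<close>. The first assertion follows by applying this to
  the two bilinear maps \<open>f(a x)\<close> and \<open>a f(x)\<close>. For a \<open>G\<close>-submodule, the class of \<open>a x\<close> in the quotient
  vanishes at all points of \<open>G\<close>, hence everywhere; for a stable submodule, the same expansion lifts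
  \<open>a \<mapsto> a x\<close> to the submodule, and uniqueness gives the axioms of an action.
\<close>

section \<open>Algebra homomorphisms\<close>

text \<open>A generic point could live over a polynomial ring, but a linear map sees only its part
  of degree one; over a square-zero extension that part is all there is, and no grading has to be
  handled. The price is that the generic point specializes to \<epsilon> \<open>x\<close> rather
  than to \<open>x\<close>, so a target must allow \<epsilon> to be cancelled. Two obstacles shape
  the treatment of submodules. Density of evaluations rests on reflexivity, hence is available for
  scalar forms and, coordinatewise, for targets with coordinates; a quotient \<open>M / N\<close>
  need not have coordinates. It is therefore placed as an ideal in an algebra, where scalar forms
  can detect its elements. Moreover the map from \<open>N \<otimes> S\<close> to
  \<open>M \<otimes> S\<close> may fail to be injective, so an identity in
  \<open>N \<otimes> S\<close> cannot be read off in \<open>M \<otimes> S\<close>. Such identities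
  are verified over \<open>R\<close>, where injectivity holds, and carried to all \<open>S\<close>
  by uniqueness of natural linear maps, one variable at a time.\<close>

lemma self_module_simps [simp]:
  "carrier (self_module S) = carrier S" "monoid.mult (self_module S) = monoid.mult S"
  "one (self_module S) = one S" "ring.zero (self_module S) = ring.zero S"
  "ring.add (self_module S) = ring.add S" "module.smult (self_module S) = monoid.mult S"
  by (simp_all add: self_module_def)

lemma cring_self_module: "cring S \<Longrightarrow> cring (self_module S)"
proof -
  assume "cring S"
  then interpret cring S .
  show ?thesis
    by (intro cringI abelian_groupI comm_monoidI)
      (auto simp: a_ac m_ac l_distr r_distr intro: l_neg)
qed

lemma algebra_self_module: "cring S \<Longrightarrow> algebra S (self_module S)"
proof -
  assume S: "cring S"
  then interpret cring S .
  show ?thesis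
    by (rule algebraI[OF S cring_self_module[OF S]])
      (auto simp: m_assoc l_distr r_distr)
qed

lemma module_self_module: "cring S \<Longrightarrow> module S (self_module S)"
  using algebra_self_module algebra.module by blast

lemma algebra_cring: "algebra R S \<Longrightarrow> cring S"
  by (rule algebra.M_cring)

lemma algebra_base: "algebra R S \<Longrightarrow> cring R"
  by (rule algebra.R_cring)

lemma alg_homD:
  assumes "h \<in> alg_hom R S T"
  shows "h \<in> ring_hom S T" "h \<in> extensional (carrier S)" "h \<in> carrier S \<rightarrow> carrier T"
    and "\<And>x. x \<in> carrier S \<Longrightarrow> h x \<in> carrier T"
    and "\<And>x y. x \<in> carrier S \<Longrightarrow> y \<in> carrier S \<Longrightarrow> h (x \<oplus>\<^bsub>S\<^esub> y) = h x \<oplus>\<^bsub>T\<^esub> h y"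
    and "\<And>x y. x \<in> carrier S \<Longrightarrow> y \<in> carrier S \<Longrightarrow> h (x \<otimes>\<^bsub>S\<^esub> y) = h x \<otimes>\<^bsub>T\<^esub> h y"
    and "h \<one>\<^bsub>S\<^esub> = \<one>\<^bsub>T\<^esub>"
    and "\<And>r x. r \<in> carrier R \<Longrightarrow> x \<in> carrier S \<Longrightarrow> h (r \<odot>\<^bsub>S\<^esub> x) = r \<odot>\<^bsub>T\<^esub> h x"
  using assms by (auto simp: alg_hom_def ring_hom_def)

lemma alg_hom_zero:
  assumes "algebra R S" "algebra R T" "h \<in> alg_hom R S T"
  shows "h \<zero>\<^bsub>S\<^esub> = \<zero>\<^bsub>T\<^esub>"
  using assms ring_hom_zero alg_homD(1) algebra_cring cring.axioms(1) by metis

lemma alg_homI: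
  assumes "\<And>x. x \<in> carrier S \<Longrightarrow> h x \<in> carrier T"
    and "\<And>x y. x \<in> carrier S \<Longrightarrow> y \<in> carrier S \<Longrightarrow> h (x \<oplus>\<^bsub>S\<^esub> y) = h x \<oplus>\<^bsub>T\<^esub> h y"
    and "\<And>x y. x \<in> carrier S \<Longrightarrow> y \<in> carrier S \<Longrightarrow> h (x \<otimes>\<^bsub>S\<^esub> y) = h x \<otimes>\<^bsub>T\<^esub> h y"
    and "h \<one>\<^bsub>S\<^esub> = \<one>\<^bsub>T\<^esub>"
    and "\<And>r x. r \<in> carrier R \<Longrightarrow> x \<in> carrier S \<Longrightarrow> h (r \<odot>\<^bsub>S\<^esub> x) = r \<odot>\<^bsub>T\<^esub> h x"
    and "h \<in> extensional (carrier S)"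
  shows "h \<in> alg_hom R S T"
  using assms by (auto simp: alg_hom_def ring_hom_def)

lemma id_hom_in: "algebra R S \<Longrightarrow> id_hom S \<in> alg_hom R S S"
proof -
  assume "algebra R S"
  then interpret algebra R S .
  show ?thesis by (rule alg_homI) auto
qed

lemma compose_alg_hom:
  assumes "algebra R S" "h \<in> alg_hom R S T" "k \<in> alg_hom R T U"
  shows "compose (carrier S) k h \<in> alg_hom R S U"
proof -
  interpret algebra R S by fact
  show ?thesis
    using alg_homD[OF assms(2)] alg_homD[OF assms(3)]
    by (intro alg_homI) (auto simp: compose_def)
qed

lemma compose_id_hom_left:
  "h \<in> alg_hom R S T \<Longrightarrow> compose (carrier S) (id_hom T) h = h"
  using alg_homD(2,4)
  by (intro extensionalityI[of _ "carrier S"]) (fastforce simp: compose_def)+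

lemma compose_id_hom_right:
  "h \<in> alg_hom R S T \<Longrightarrow> compose (carrier S) h (id_hom S) = h"
  using alg_homD(2)
  by (intro extensionalityI[of _ "carrier S"]) (fastforce simp: compose_def)+

lemma alg_over_id: "algebra R S \<Longrightarrow> alg_over R S S (id_hom S)"
  by (simp add: alg_over_def id_hom_in)

lemma alg_overD:
  assumes "alg_over R S T \<phi>"
  shows "algebra R T" "\<phi> \<in> alg_hom R S T"
  using assms by (auto simp: alg_over_def)

lemma alg_over_compose:
  assumes "algebra R S" "alg_over R S T \<phi>" "alg_over R T U h"
  shows "alg_over R S U (compose (carrier S) h \<phi>)"
  using assms compose_alg_hom by (auto simp: alg_over_def)

text \<open>The structural map of an \<open>R\<close>-algebra. Since \<open>self_module R\<close> is
  initial, a family over \<open>self_module R\<close> has exactly one index per algebra, namely this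
  map.\<close>

definition unit_hom :: "'u ring \<Rightarrow> 'u alg \<Rightarrow> 'u \<Rightarrow> 'u" where
  "unit_hom R T = (\<lambda>r\<in>carrier R. r \<odot>\<^bsub>T\<^esub> \<one>\<^bsub>T\<^esub>)"

lemma unit_hom_in:
  assumes "algebra R T"
  shows "unit_hom R T \<in> alg_hom R (self_module R) T"
proof -
  interpret algebra R T by fact
  have "r \<odot>\<^bsub>T\<^esub> \<one>\<^bsub>T\<^esub> \<otimes>\<^bsub>T\<^esub> (s \<odot>\<^bsub>T\<^esub> \<one>\<^bsub>T\<^esub>) = (r \<otimes>\<^bsub>R\<^esub> s) \<odot>\<^bsub>T\<^esub> \<one>\<^bsub>T\<^esub>" if "r \<in> carrier R" "s \<in> carrier R" for r s
    using that by (simp add: smult_assoc1 smult_assoc2)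
  then show ?thesis
    by (intro alg_homI) (auto simp: unit_hom_def smult_l_distr smult_assoc1)
qed

lemma unit_hom_over: "algebra R T \<Longrightarrow> alg_over R (self_module R) T (unit_hom R T)"
  by (simp add: alg_over_def unit_hom_in)

lemma unit_hom_unique:
  assumes "algebra R T" "h \<in> alg_hom R (self_module R) T"
  shows "h = unit_hom R T"
proof -
  interpret algebra R T by fact
  have "h r = unit_hom R T r" if "r \<in> carrier R" for r
    using alg_homD(8)[OF assms(2), of r "\<one>\<^bsub>R\<^esub>"] alg_homD(7)[OF assms(2)] that
    by (simp add: unit_hom_def)
  then show ?thesis
    using alg_homD(2)[OF assms(2)] by (intro extensionalityI[of _ "carrier R"]) (auto simp: unit_hom_def)
qed

lemma compose_unit_hom:
  assumes "algebra R T" "algebra R U" "h \<in> alg_hom R T U"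
  shows "compose (carrier R) h (unit_hom R T) = unit_hom R U"
proof -
  have "compose (carrier (self_module R)) h (unit_hom R T) \<in> alg_hom R (self_module R) U"
    using assms by (intro compose_alg_hom) (auto intro: unit_hom_in algebra_self_module algebra_base)
  then show ?thesis using unit_hom_unique[OF assms(2)] by simp
qed

section \<open>Additive maps and finite sums\<close>

lemma abelian_group_homI':
  assumes "abelian_group A" "abelian_group B" "h \<in> carrier A \<rightarrow> carrier B"
    "\<And>x y. x \<in> carrier A \<Longrightarrow> y \<in> carrier A \<Longrightarrow> h (x \<oplus>\<^bsub>A\<^esub> y) = h x \<oplus>\<^bsub>B\<^esub> h y"
  shows "abelian_group_hom A B h"
  using assms abelian_group.a_group[OF assms(1)] abelian_group.a_group[OF assms(2)]
  by (intro abelian_group_homI) (auto simp: group_hom_def group_hom_axioms_def hom_def)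

lemma (in abelian_group_hom) hom_finsum:
  assumes "finite F" "f \<in> F \<rightarrow> carrier G"
  shows "h (finsum G f F) = finsum H (\<lambda>i. h (f i)) F"
  using assms
proof (induction F)
  case (insert j F)
  then have "finsum G f F \<in> carrier G" "f j \<in> carrier G" "f \<in> F \<rightarrow> carrier G"
      "(\<lambda>i. h (f i)) \<in> F \<rightarrow> carrier H" "h (f j) \<in> carrier H"
    by (auto intro!: G.finsum_closed hom_closed)
  with insert show ?case by simp
qed simp

lemma abelian_group_hom_compose:
  assumes "abelian_group_hom A B f" "abelian_group_hom B C g"
  shows "abelian_group_hom A C (\<lambda>x. g (f x))"
proof -
  interpret f: abelian_group_hom A B f by fact
  interpret g: abelian_group_hom B C g by fact
  show ?thesis
    by (rule abelian_group_homI') (auto intro: f.G.abelian_group_axioms g.H.abelian_group_axioms)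
qed

lemma (in abelian_group) finsum_delta:
  assumes "finite F" "j \<in> F" "a \<in> carrier G"
  shows "finsum G (\<lambda>i. if i = j then a else \<zero>) F = a"
  using add.finprod_singleton[of j F "\<lambda>_. a"] assms by (simp add: eq_commute)

lemma (in abelian_group) finsum_superset:
  assumes "finite B" "A \<subseteq> B" "f \<in> B \<rightarrow> carrier G" "\<And>i. i \<in> B - A \<Longrightarrow> f i = \<zero>"
  shows "finsum G f A = finsum G f B"
  using assms by (intro add.finprod_mono_neutral_cong_left) auto

lemma module_abelian_group: "module S E \<Longrightarrow> abelian_group E"
  by (rule module.axioms(2))

lemma module_smult_hom:
  assumes "module S E" "s \<in> carrier S"
  shows "abelian_group_hom E E (\<lambda>x. s \<odot>\<^bsub>E\<^esub> x)"
proof -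
  interpret module S E by fact
  show ?thesis using assms(2)
    by (intro abelian_group_homI') (auto intro: M.abelian_group_axioms simp: smult_r_distr)
qed

lemma alg_hom_abelian_group_hom:
  assumes "algebra R S" "algebra R T" "h \<in> alg_hom R S T"
  shows "abelian_group_hom S T h"
proof -
  interpret S: cring S using assms algebra_cring by auto
  interpret T: cring T using assms algebra_cring by auto
  show ?thesis using alg_homD[OF assms(3)]
    by (intro abelian_group_homI') (auto intro: S.abelian_group_axioms T.abelian_group_axioms)
qed

section \<open>Square-zero extensions\<close>

text \<open>The elements of the square-zero extension are pairs encoded in the universe.\<close>

definition sqz_enc :: "'u alg \<Rightarrow> ('u, 'e) module \<Rightarrow> 'u \<times> 'e \<Rightarrow> 'u" where
  "sqz_enc S E = (SOME f. inj_on f (carrier S \<times> carrier E))"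

definition sqz_dec :: "'u alg \<Rightarrow> ('u, 'e) module \<Rightarrow> 'u \<Rightarrow> 'u \<times> 'e" where
  "sqz_dec S E = the_inv_into (carrier S \<times> carrier E) (sqz_enc S E)"

text \<open>The trivial extension of \<open>S\<close> by \<open>E\<close>, in which two elements of
  \<open>E\<close> multiply to zero. Only \<open>S\<close> acts on \<open>E\<close>, so a scalar
  \<open>r\<close> of \<open>R\<close> acts on the second component through
  \<open>r \<odot> \<one>\<close>.\<close>

definition sqz :: "'u alg \<Rightarrow> ('u, 'e) module \<Rightarrow> 'u alg" where
  "sqz S E =
     \<lparr>carrier = sqz_enc S E ` (carrier S \<times> carrier E),
      monoid.mult = (\<lambda>x y. case (sqz_dec S E x, sqz_dec S E y) of ((s, e), (t, d)) \<Rightarrow>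
        sqz_enc S E (s \<otimes>\<^bsub>S\<^esub> t, s \<odot>\<^bsub>E\<^esub> d \<oplus>\<^bsub>E\<^esub> t \<odot>\<^bsub>E\<^esub> e)),
      one = sqz_enc S E (\<one>\<^bsub>S\<^esub>, \<zero>\<^bsub>E\<^esub>),
      ring.zero = sqz_enc S E (\<zero>\<^bsub>S\<^esub>, \<zero>\<^bsub>E\<^esub>),
      add = (\<lambda>x y. case (sqz_dec S E x, sqz_dec S E y) of ((s, e), (t, d)) \<Rightarrow>
        sqz_enc S E (s \<oplus>\<^bsub>S\<^esub> t, e \<oplus>\<^bsub>E\<^esub> d)),
      smult = (\<lambda>r x. case sqz_dec S E x of (s, e) \<Rightarrow>
        sqz_enc S E (r \<odot>\<^bsub>S\<^esub> s, (r \<odot>\<^bsub>S\<^esub> \<one>\<^bsub>S\<^esub>) \<odot>\<^bsub>E\<^esub> e))\<rparr>"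

definition sqz_incl :: "'u alg \<Rightarrow> ('u, 'e) module \<Rightarrow> 'u \<Rightarrow> 'u" where
  "sqz_incl S E = (\<lambda>s\<in>carrier S. sqz_enc S E (s, \<zero>\<^bsub>E\<^esub>))"

text \<open>The assumption \<open>small\<close> is about cardinality: \<open>E\<close> may have
  elements of another type, for instance functions on an index set, and the pairs must still be
  codable by elements of the universe.\<close>

locale square_zero =
  fixes R :: "'u ring" and S :: "'u alg" and E :: "('u, 'e) module"
  assumes alg: "algebra R S" and mod: "module S E"
    and small: "\<exists>f :: 'u \<times> 'e \<Rightarrow> 'u. inj_on f (carrier S \<times> carrier E)"
begin

sublocale A: algebra R S by (rule alg)
sublocale E: module S E by (rule mod)

lemma inj_enc: "inj_on (sqz_enc S E) (carrier S \<times> carrier E)"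
  unfolding sqz_enc_def by (rule someI_ex[OF small])

lemma dec_enc [simp]:
  "s \<in> carrier S \<Longrightarrow> e \<in> carrier E \<Longrightarrow> sqz_dec S E (sqz_enc S E (s, e)) = (s, e)"
  unfolding sqz_dec_def by (rule the_inv_into_f_f[OF inj_enc]) auto

lemma enc_closed [simp]:
  "s \<in> carrier S \<Longrightarrow> e \<in> carrier E \<Longrightarrow> sqz_enc S E (s, e) \<in> carrier (sqz S E)"
  by (auto simp: sqz_def)

lemma enc_inject [simp]:
  assumes "s \<in> carrier S" "e \<in> carrier E" "t \<in> carrier S" "d \<in> carrier E"
  shows "sqz_enc S E (s, e) = sqz_enc S E (t, d) \<longleftrightarrow> s = t \<and> e = d"
  using assms inj_onD[OF inj_enc, of "(s, e)" "(t, d)"] by auto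

lemma sqz_cases:
  assumes "x \<in> carrier (sqz S E)"
  obtains s e where "s \<in> carrier S" "e \<in> carrier E" "x = sqz_enc S E (s, e)"
  using assms by (auto simp: sqz_def)

lemma sqz_simps [simp]:
  assumes "s \<in> carrier S" "e \<in> carrier E" "t \<in> carrier S" "d \<in> carrier E"
  shows "sqz_enc S E (s, e) \<otimes>\<^bsub>sqz S E\<^esub> sqz_enc S E (t, d) =
      sqz_enc S E (s \<otimes>\<^bsub>S\<^esub> t, s \<odot>\<^bsub>E\<^esub> d \<oplus>\<^bsub>E\<^esub> t \<odot>\<^bsub>E\<^esub> e)"
    and "sqz_enc S E (s, e) \<oplus>\<^bsub>sqz S E\<^esub> sqz_enc S E (t, d) = sqz_enc S E (s \<oplus>\<^bsub>S\<^esub> t, e \<oplus>\<^bsub>E\<^esub> d)"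
  using assms by (simp_all add: sqz_def)

lemma sqz_smult [simp]:
  "s \<in> carrier S \<Longrightarrow> e \<in> carrier E \<Longrightarrow> r \<odot>\<^bsub>sqz S E\<^esub> sqz_enc S E (s, e) =
      sqz_enc S E (r \<odot>\<^bsub>S\<^esub> s, (r \<odot>\<^bsub>S\<^esub> \<one>\<^bsub>S\<^esub>) \<odot>\<^bsub>E\<^esub> e)"
  by (simp add: sqz_def)

lemma sqz_one [simp]: "\<one>\<^bsub>sqz S E\<^esub> = sqz_enc S E (\<one>\<^bsub>S\<^esub>, \<zero>\<^bsub>E\<^esub>)"
  and sqz_zero [simp]: "\<zero>\<^bsub>sqz S E\<^esub> = sqz_enc S E (\<zero>\<^bsub>S\<^esub>, \<zero>\<^bsub>E\<^esub>)"
  by (simp_all add: sqz_def)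

lemma abelian_group_sqz: "abelian_group (sqz S E)"
proof (rule abelian_groupI)
  fix x assume "x \<in> carrier (sqz S E)"
  then obtain s e where x: "s \<in> carrier S" "e \<in> carrier E" "x = sqz_enc S E (s, e)"
    by (rule sqz_cases)
  then show "\<exists>y\<in>carrier (sqz S E). y \<oplus>\<^bsub>sqz S E\<^esub> x = \<zero>\<^bsub>sqz S E\<^esub>"
    by (intro bexI[of _ "sqz_enc S E (\<ominus>\<^bsub>S\<^esub> s, \<ominus>\<^bsub>E\<^esub> e)"]) (auto simp: A.M.l_neg E.M.l_neg)
qed (auto elim!: sqz_cases simp: A.M.a_ac E.M.a_ac)

lemma comm_monoid_sqz: "comm_monoid (sqz S E)"
proof (rule comm_monoidI)
  fix x y z assume "x \<in> carrier (sqz S E)" "y \<in> carrier (sqz S E)" "z \<in> carrier (sqz S E)"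
  then show "x \<otimes>\<^bsub>sqz S E\<^esub> y \<otimes>\<^bsub>sqz S E\<^esub> z = x \<otimes>\<^bsub>sqz S E\<^esub> (y \<otimes>\<^bsub>sqz S E\<^esub> z)"
    by (auto elim!: sqz_cases simp: A.m_ac E.smult_r_distr E.M.a_ac
        E.smult_assoc1[symmetric])
next
  fix x y assume "x \<in> carrier (sqz S E)" "y \<in> carrier (sqz S E)"
  then show "x \<otimes>\<^bsub>sqz S E\<^esub> y = y \<otimes>\<^bsub>sqz S E\<^esub> x"
    by (auto elim!: sqz_cases simp: A.m_comm E.M.a_comm)
qed (auto elim!: sqz_cases)

lemma cring_sqz: "cring (sqz S E)"
proof (rule cringI)
  fix x y z assume "x \<in> carrier (sqz S E)" "y \<in> carrier (sqz S E)" "z \<in> carrier (sqz S E)"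
  then show "(x \<oplus>\<^bsub>sqz S E\<^esub> y) \<otimes>\<^bsub>sqz S E\<^esub> z =
      x \<otimes>\<^bsub>sqz S E\<^esub> z \<oplus>\<^bsub>sqz S E\<^esub> y \<otimes>\<^bsub>sqz S E\<^esub> z"
    by (auto elim!: sqz_cases simp: A.l_distr E.smult_r_distr E.smult_l_distr E.M.a_ac)
qed (auto intro: abelian_group_sqz comm_monoid_sqz)

lemma algebra_sqz: "algebra R (sqz S E)"
proof -
  \<comment> \<open>\<open>E\<close> has no \<open>R\<close>-action of its own; associativity of
    scalars is that of the \<open>S\<close>-action, applied to \<open>r \<odot> \<one>\<close> and
    \<open>s \<odot> \<one>\<close>.\<close>
  have [simp]: "(r \<odot>\<^bsub>S\<^esub> (s \<odot>\<^bsub>S\<^esub> \<one>\<^bsub>S\<^esub>)) \<odot>\<^bsub>E\<^esub> e = (r \<odot>\<^bsub>S\<^esub> \<one>\<^bsub>S\<^esub>) \<odot>\<^bsub>E\<^esub> ((s \<odot>\<^bsub>S\<^esub> \<one>\<^bsub>S\<^esub>) \<odot>\<^bsub>E\<^esub> e)"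
    if "r \<in> carrier R" "s \<in> carrier R" "e \<in> carrier E" for r s e
    using that by (simp add: A.smult_assoc2 flip: E.smult_assoc1)
  show ?thesis
  proof (rule algebraI)
    fix a x y assume a: "a \<in> carrier R" and "x \<in> carrier (sqz S E)" "y \<in> carrier (sqz S E)"
    then obtain s e t d where x: "s \<in> carrier S" "e \<in> carrier E" "x = sqz_enc S E (s, e)"
      and y: "t \<in> carrier S" "d \<in> carrier E" "y = sqz_enc S E (t, d)"
      by (metis sqz_cases)
    have 1: "(a \<odot>\<^bsub>S\<^esub> s) \<odot>\<^bsub>E\<^esub> d = (a \<odot>\<^bsub>S\<^esub> \<one>\<^bsub>S\<^esub>) \<odot>\<^bsub>E\<^esub> (s \<odot>\<^bsub>E\<^esub> d)"
      using a x y by (simp add: A.smult_assoc2 flip: E.smult_assoc1)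
    have 2: "t \<odot>\<^bsub>E\<^esub> ((a \<odot>\<^bsub>S\<^esub> \<one>\<^bsub>S\<^esub>) \<odot>\<^bsub>E\<^esub> e) = (a \<odot>\<^bsub>S\<^esub> \<one>\<^bsub>S\<^esub>) \<odot>\<^bsub>E\<^esub> (t \<odot>\<^bsub>E\<^esub> e)"
      using a x y by (simp add: A.m_comm flip: E.smult_assoc1)
    show "(a \<odot>\<^bsub>sqz S E\<^esub> x) \<otimes>\<^bsub>sqz S E\<^esub> y = a \<odot>\<^bsub>sqz S E\<^esub> (x \<otimes>\<^bsub>sqz S E\<^esub> y)"
      using a x y 2 by (simp add: 1 A.smult_assoc2 E.smult_r_distr)
  qed (auto elim!: sqz_cases intro: A.R.cring_axioms cring_sqz
      simp: A.smult_l_distr E.smult_l_distr A.smult_r_distr E.smult_r_distr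
        A.smult_assoc1 E.smult_assoc1)
qed

lemma sqz_incl_in: "sqz_incl S E \<in> alg_hom R S (sqz S E)"
  by (rule alg_homI) (auto simp: sqz_incl_def)

lemma sqz_incl_over: "alg_over R S (sqz S E) (sqz_incl S E)"
  by (simp add: alg_over_def algebra_sqz sqz_incl_in)

end

text \<open>Functoriality of the extension along \<open>h\<close> together with an additive
  \<open>k\<close> that is semilinear over \<open>h\<close>. The specializations of the generic
  point below have this shape.\<close>

definition sqz_map ::
  "'u alg \<Rightarrow> ('u, 'e) module \<Rightarrow> 'u alg \<Rightarrow> ('u, 'd) module \<Rightarrow> ('u \<Rightarrow> 'u) \<Rightarrow> ('e \<Rightarrow> 'd) \<Rightarrow> 'u \<Rightarrow> 'u" where
  "sqz_map S E T D h k =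
     (\<lambda>x\<in>carrier (sqz S E). case sqz_dec S E x of (s, e) \<Rightarrow> sqz_enc T D (h s, k e))"

lemma sqz_map_enc:
  assumes "square_zero R S E" "s \<in> carrier S" "e \<in> carrier E"
  shows "sqz_map S E T D h k (sqz_enc S E (s, e)) = sqz_enc T D (h s, k e)"
proof -
  interpret square_zero R S E by fact
  show ?thesis using assms(2,3) by (simp add: sqz_map_def)
qed

lemma sqz_map_in:
  assumes S: "square_zero R S E" and T: "square_zero R T D" and h: "h \<in> alg_hom R S T"
    and k: "abelian_group_hom E D k"
    and lin: "\<And>s e. s \<in> carrier S \<Longrightarrow> e \<in> carrier E \<Longrightarrow> k (s \<odot>\<^bsub>E\<^esub> e) = h s \<odot>\<^bsub>D\<^esub> k e"
  shows "sqz_map S E T D h k \<in> alg_hom R (sqz S E) (sqz T D)"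
proof -
  interpret S: square_zero R S E by fact
  interpret T: square_zero R T D by fact
  interpret k: abelian_group_hom E D k by fact
  note h = alg_homD[OF h]
  note [simp] = sqz_map_enc[OF S] h lin
  show ?thesis
  proof (rule alg_homI)
    show "sqz_map S E T D h k \<in> extensional (carrier (sqz S E))"
      by (simp add: sqz_map_def)
  qed (auto elim!: S.sqz_cases)
qed

text \<open>An infinite set is equipotent to its square; this is where the assumption on the
  universe first enters.\<close>

lemma inj_pair_universe:
  assumes "infinite (UNIV :: 'u set)"
  shows "\<exists>f :: 'u \<times> 'u \<Rightarrow> 'u. inj_on f (X \<times> Y)"
proof -
  have "(UNIV :: 'u set) \<times> (UNIV :: 'u set) \<approx> (UNIV :: 'u set)"
    using card_of_Times_same_infinite[OF assms] eqpoll_iff_card_of_ordIso by blast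
  then obtain f :: "'u \<times> 'u \<Rightarrow> 'u" where "inj f"
    by (auto simp: eqpoll_def bij_betw_def)
  then show ?thesis using inj_on_subset by blast
qed

section \<open>Free modules and the two kinds of square-zero extension in use\<close>

lemma free_functor_simps [simp]:
  "carrier (obj (free_functor K) S) = {c \<in> K \<rightarrow>\<^sub>E carrier S. finite {i \<in> K. c i \<noteq> \<zero>\<^bsub>S\<^esub>}}"
  "\<zero>\<^bsub>obj (free_functor K) S\<^esub> = (\<lambda>i\<in>K. \<zero>\<^bsub>S\<^esub>)"
  "c \<oplus>\<^bsub>obj (free_functor K) S\<^esub> d = (\<lambda>i\<in>K. c i \<oplus>\<^bsub>S\<^esub> d i)"
  "s \<odot>\<^bsub>obj (free_functor K) S\<^esub> c = (\<lambda>i\<in>K. s \<otimes>\<^bsub>S\<^esub> c i)"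
  by (simp_all add: free_functor_def)

lemma module_free:
  assumes "cring S"
  shows "module S (obj (free_functor K) S)"
proof -
  interpret cring S by fact
  \<comment> \<open>The support of \<open>f\<close> lies in the union of two finite supports. This
    covers sums and, with \<open>d = c\<close>, negatives and scalar multiples.\<close>
  have carI: "(\<lambda>i\<in>K. f i) \<in> carrier (obj (free_functor K) S)"
    if c: "c \<in> carrier (obj (free_functor K) S)" and d: "d \<in> carrier (obj (free_functor K) S)"
      and f: "\<And>i. i \<in> K \<Longrightarrow> f i \<in> carrier S"
      and z: "\<And>i. i \<in> K \<Longrightarrow> c i = \<zero>\<^bsub>S\<^esub> \<Longrightarrow> d i = \<zero>\<^bsub>S\<^esub> \<Longrightarrow> f i = \<zero>\<^bsub>S\<^esub>" for c d f
  proof -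
    have "finite ({i \<in> K. c i \<noteq> \<zero>\<^bsub>S\<^esub>} \<union> {i \<in> K. d i \<noteq> \<zero>\<^bsub>S\<^esub>})"
      using c d by simp
    moreover have "{i \<in> K. restrict f K i \<noteq> \<zero>\<^bsub>S\<^esub>} \<subseteq> {i \<in> K. c i \<noteq> \<zero>\<^bsub>S\<^esub>} \<union> {i \<in> K. d i \<noteq> \<zero>\<^bsub>S\<^esub>}"
      using z by auto
    ultimately have "finite {i \<in> K. restrict f K i \<noteq> \<zero>\<^bsub>S\<^esub>}"
      by (rule rev_finite_subset)
    then show ?thesis using f by simp
  qed
  have ext: "restrict f K = c" if "c \<in> K \<rightarrow>\<^sub>E carrier S" "\<And>i. i \<in> K \<Longrightarrow> f i = c i" for c f
    using that by (auto simp: fun_eq_iff PiE_iff extensional_def)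
  have mem: "\<And>i. i \<in> K \<Longrightarrow> c i \<in> carrier S" if "c \<in> K \<rightarrow>\<^sub>E carrier S" for c
    using that by auto
  show ?thesis
  proof (rule moduleI)
    show "abelian_group (obj (free_functor K) S)"
    proof (rule abelian_groupI)
      fix c assume c: "c \<in> carrier (obj (free_functor K) S)"
      then have "(\<lambda>i\<in>K. \<ominus>\<^bsub>S\<^esub> c i) \<in> carrier (obj (free_functor K) S)"
        by (intro carI[of c c]) (auto dest: mem)
      then show "\<exists>d\<in>carrier (obj (free_functor K) S).
          d \<oplus>\<^bsub>obj (free_functor K) S\<^esub> c = \<zero>\<^bsub>obj (free_functor K) S\<^esub>"
        by (rule rev_bexI) (use c in \<open>auto intro!: restrict_ext dest: mem simp: l_neg\<close>)
      show "\<zero>\<^bsub>obj (free_functor K) S\<^esub> \<oplus>\<^bsub>obj (free_functor K) S\<^esub> c = c"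
        using c by (auto intro!: ext dest: mem)
    next
      fix c d assume cd: "c \<in> carrier (obj (free_functor K) S)" "d \<in> carrier (obj (free_functor K) S)"
      then show "c \<oplus>\<^bsub>obj (free_functor K) S\<^esub> d \<in> carrier (obj (free_functor K) S)"
        unfolding free_functor_simps(3) by (intro carI[of c d]) (auto dest: mem)
      show "c \<oplus>\<^bsub>obj (free_functor K) S\<^esub> d = d \<oplus>\<^bsub>obj (free_functor K) S\<^esub> c"
        using cd by (auto intro!: restrict_ext a_comm dest: mem)
    qed (auto intro!: restrict_ext a_assoc dest: mem)
  next
    fix s c assume "s \<in> carrier S" "c \<in> carrier (obj (free_functor K) S)"
    then show "s \<odot>\<^bsub>obj (free_functor K) S\<^esub> c \<in> carrier (obj (free_functor K) S)"
      unfolding free_functor_simps(4) by (intro carI[of c c]) (auto dest: mem)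
  next
    fix c assume "c \<in> carrier (obj (free_functor K) S)"
    then show "\<one>\<^bsub>S\<^esub> \<odot>\<^bsub>obj (free_functor K) S\<^esub> c = c"
      by (auto intro!: ext dest: mem)
  qed (auto simp: assms intro!: restrict_ext l_distr r_distr m_assoc dest: mem)
qed

text \<open>A finitely supported function is recorded by a finite set of pairs, and an infinite set
  has no more finite sets of pairs than elements. So the extension by a free module on any index set
  of the universe fits in the universe.\<close>

lemma free_small:
  assumes inf: "infinite (UNIV :: 'u set)"
  shows "\<exists>f :: 'u \<times> ('u \<Rightarrow> 'u) \<Rightarrow> 'u. inj_on f (X \<times> carrier (obj (free_functor K) (S :: 'u alg)))"
proof -
  \<comment> \<open>The zero vector in extensional form, \<open>undefined\<close> off
    \<open>K\<close>: a vector of the free module differs from it only on its support.\<close>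
  define k where "k = restrict (\<lambda>i. \<zero>\<^bsub>S\<^esub>) K"
  let ?V = "UNIV :: 'u set"
  let ?E = "carrier (obj (free_functor K) S)"
  have "?E \<subseteq> {f. f ` ?V \<subseteq> ?V \<and> {x. f x \<noteq> k x} \<subseteq> ?V \<and> finite {x. f x \<noteq> k x}}"
  proof
    fix c assume "c \<in> ?E"
    then have c: "c \<in> extensional K" "finite {i \<in> K. c i \<noteq> \<zero>\<^bsub>S\<^esub>}"
      by (simp_all add: PiE_iff)
    have "{x. c x \<noteq> k x} \<subseteq> {i \<in> K. c i \<noteq> \<zero>\<^bsub>S\<^esub>}"
    proof clarify
      fix i assume "c i \<noteq> k i"
      then show "i \<in> K \<and> c i \<noteq> \<zero>\<^bsub>S\<^esub>"
        by (cases "i \<in> K") (simp_all add: k_def extensional_arb[OF c(1)])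
    qed
    then have "finite {x. c x \<noteq> k x}"
      using c(2) by (rule finite_subset)
    then show "c \<in> {f. f ` ?V \<subseteq> ?V \<and> {x. f x \<noteq> k x} \<subseteq> ?V \<and> finite {x. f x \<noteq> k x}}"
      by (intro CollectI conjI subset_UNIV)
  qed
  then have "?E \<lesssim> {f. f ` ?V \<subseteq> ?V \<and> {x. f x \<noteq> k x} \<subseteq> ?V \<and> finite {x. f x \<noteq> k x}}"
    by (rule subset_imp_lepoll)
  also have "\<dots> \<lesssim> Fpow (?V \<times> ?V)"
    by (rule lepoll_restricted_funspace)
  also have "\<dots> \<approx> ?V \<times> ?V"
    by (rule eqpoll_Fpow) (use inf finite_prod in auto)
  also have "\<dots> \<approx> ?V"
    using card_of_Times_same_infinite[OF inf] eqpoll_iff_card_of_ordIso by blast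
  finally have "?E \<lesssim> ?V" .
  then obtain g :: "('u \<Rightarrow> 'u) \<Rightarrow> 'u" where g: "inj_on g ?E"
    unfolding lepoll_def by blast
  obtain f :: "'u \<times> 'u \<Rightarrow> 'u" where "inj_on f (UNIV \<times> UNIV)"
    using inj_pair_universe[OF inf] by blast
  then have f: "inj f" by simp
  have "inj_on (\<lambda>(s, c). f (s, g c)) (X \<times> ?E)"
    using g by (auto simp: inj_on_def dest: injD[OF f])
  then show ?thesis by blast
qed

abbreviation free_ext :: "'u alg \<Rightarrow> 'u set \<Rightarrow> 'u alg" where
  "free_ext S K \<equiv> sqz S (obj (free_functor K) S)"

abbreviation dual_numbers :: "'u alg \<Rightarrow> 'u alg" where
  "dual_numbers S \<equiv> sqz S (self_module S)"

abbreviation eps :: "'u alg \<Rightarrow> 'u" where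
  "eps S \<equiv> sqz_enc S (self_module S) (\<zero>\<^bsub>S\<^esub>, \<one>\<^bsub>S\<^esub>)"

lemma square_zero_free:
  assumes "infinite (UNIV :: 'u set)" "algebra R (S :: 'u alg)"
  shows "square_zero R S (obj (free_functor K) S)"
  using assms by (intro square_zero.intro module_free algebra_cring free_small) auto

lemma square_zero_dual:
  assumes "infinite (UNIV :: 'u set)" "algebra R (S :: 'u alg)"
  shows "square_zero R S (self_module S)"
  using assms by (intro square_zero.intro module_self_module algebra_cring inj_pair_universe) auto

section \<open>Module functors and natural linear maps\<close>

lemma module_functorD:
  assumes "module_functor R M"
  shows "algebra R S \<Longrightarrow> module S (obj M S)"
    and "algebra R S \<Longrightarrow> algebra R T \<Longrightarrow> h \<in> alg_hom R S T \<Longrightarrow>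
      abelian_group_hom (obj M S) (obj M T) (arr M S T h)"
    and "algebra R S \<Longrightarrow> algebra R T \<Longrightarrow> h \<in> alg_hom R S T \<Longrightarrow> x \<in> carrier (obj M S) \<Longrightarrow>
      arr M S T h x \<in> carrier (obj M T)"
    and "algebra R S \<Longrightarrow> algebra R T \<Longrightarrow> h \<in> alg_hom R S T \<Longrightarrow> s \<in> carrier S \<Longrightarrow>
      x \<in> carrier (obj M S) \<Longrightarrow> arr M S T h (s \<odot>\<^bsub>obj M S\<^esub> x) = h s \<odot>\<^bsub>obj M T\<^esub> arr M S T h x"
    and "algebra R S \<Longrightarrow> x \<in> carrier (obj M S) \<Longrightarrow> arr M S S (id_hom S) x = x"
    and "algebra R S \<Longrightarrow> algebra R T \<Longrightarrow> algebra R U \<Longrightarrow> h \<in> alg_hom R S T \<Longrightarrow>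
      k \<in> alg_hom R T U \<Longrightarrow> x \<in> carrier (obj M S) \<Longrightarrow>
      arr M S U (compose (carrier S) k h) x = arr M T U k (arr M S T h x)"
proof -
  show mod: "module S (obj M S)" if "algebra R S" for S
    using assms that by (simp add: module_functor_def)
  show cl: "arr M S T h x \<in> carrier (obj M T)" if "algebra R S" "algebra R T" "h \<in> alg_hom R S T"
    "x \<in> carrier (obj M S)" for S T h x
    using assms that by (auto simp: module_functor_def set_functor_def)
  show "abelian_group_hom (obj M S) (obj M T) (arr M S T h)"
    if "algebra R S" "algebra R T" "h \<in> alg_hom R S T"
    using assms that cl module_abelian_group[OF mod[OF that(1)]] module_abelian_group[OF mod[OF that(2)]]
    by (intro abelian_group_homI') (auto simp: module_functor_def)
qed (use assms in \<open>auto simp: module_functor_def set_functor_def\<close>)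

text \<open>The conditions of \<open>lin_Hom_over\<close> without its normal form outside carriers
  and indices. Families can then be written and composed as plain functions.\<close>

definition natural_linear ::
  "'u ring \<Rightarrow> 'u alg \<Rightarrow> ('u, 'x) module_ftor \<Rightarrow> ('u, 'y) module_ftor \<Rightarrow> ('u, 'x, 'y) family \<Rightarrow> bool"
  where
  "natural_linear R S L Q w \<longleftrightarrow>
     (\<forall>T \<phi>. alg_over R S T \<phi> \<longrightarrow>
        (\<forall>x\<in>carrier (obj L T). w T \<phi> x \<in> carrier (obj Q T)) \<and>
        (\<forall>x\<in>carrier (obj L T). \<forall>y\<in>carrier (obj L T).
           w T \<phi> (x \<oplus>\<^bsub>obj L T\<^esub> y) = w T \<phi> x \<oplus>\<^bsub>obj Q T\<^esub> w T \<phi> y) \<and>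
        (\<forall>t\<in>carrier T. \<forall>x\<in>carrier (obj L T).
           w T \<phi> (t \<odot>\<^bsub>obj L T\<^esub> x) = t \<odot>\<^bsub>obj Q T\<^esub> w T \<phi> x)) \<and>
     (\<forall>T \<phi> U h x. alg_over R S T \<phi> \<longrightarrow> alg_over R T U h \<longrightarrow> x \<in> carrier (obj L T) \<longrightarrow>
        w U (compose (carrier S) h \<phi>) (arr L T U h x) = arr Q T U h (w T \<phi> x))"

lemma natural_linearI:
  assumes "\<And>T \<phi> x. alg_over R S T \<phi> \<Longrightarrow> x \<in> carrier (obj L T) \<Longrightarrow> w T \<phi> x \<in> carrier (obj Q T)"
    and "\<And>T \<phi> x y. alg_over R S T \<phi> \<Longrightarrow> x \<in> carrier (obj L T) \<Longrightarrow> y \<in> carrier (obj L T) \<Longrightarrow>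
      w T \<phi> (x \<oplus>\<^bsub>obj L T\<^esub> y) = w T \<phi> x \<oplus>\<^bsub>obj Q T\<^esub> w T \<phi> y"
    and "\<And>T \<phi> t x. alg_over R S T \<phi> \<Longrightarrow> t \<in> carrier T \<Longrightarrow> x \<in> carrier (obj L T) \<Longrightarrow>
      w T \<phi> (t \<odot>\<^bsub>obj L T\<^esub> x) = t \<odot>\<^bsub>obj Q T\<^esub> w T \<phi> x"
    and "\<And>T \<phi> U h x. alg_over R S T \<phi> \<Longrightarrow> alg_over R T U h \<Longrightarrow> x \<in> carrier (obj L T) \<Longrightarrow>
      w U (compose (carrier S) h \<phi>) (arr L T U h x) = arr Q T U h (w T \<phi> x)"
  shows "natural_linear R S L Q w"
  using assms unfolding natural_linear_def by blast

lemma natural_linearD: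
  assumes "natural_linear R S L Q w"
  shows "alg_over R S T \<phi> \<Longrightarrow> x \<in> carrier (obj L T) \<Longrightarrow> w T \<phi> x \<in> carrier (obj Q T)"
    and "alg_over R S T \<phi> \<Longrightarrow> x \<in> carrier (obj L T) \<Longrightarrow> y \<in> carrier (obj L T) \<Longrightarrow>
      w T \<phi> (x \<oplus>\<^bsub>obj L T\<^esub> y) = w T \<phi> x \<oplus>\<^bsub>obj Q T\<^esub> w T \<phi> y"
    and "alg_over R S T \<phi> \<Longrightarrow> t \<in> carrier T \<Longrightarrow> x \<in> carrier (obj L T) \<Longrightarrow>
      w T \<phi> (t \<odot>\<^bsub>obj L T\<^esub> x) = t \<odot>\<^bsub>obj Q T\<^esub> w T \<phi> x"
    and "alg_over R S T \<phi> \<Longrightarrow> alg_over R T U h \<Longrightarrow> x \<in> carrier (obj L T) \<Longrightarrow>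
      w U (compose (carrier S) h \<phi>) (arr L T U h x) = arr Q T U h (w T \<phi> x)"
  using assms unfolding natural_linear_def by blast+

lemma natural_linear_hom:
  assumes "module_functor R L" "module_functor R Q" "natural_linear R S L Q w" "alg_over R S T \<phi>"
  shows "abelian_group_hom (obj L T) (obj Q T) (w T \<phi>)"
proof -
  have "module T (obj L T)" "module T (obj Q T)"
    using assms module_functorD(1) alg_overD(1) by blast+
  then show ?thesis
    using natural_linearD[OF assms(3,4)]
    by (intro abelian_group_homI' module_abelian_group) auto
qed

lemma natural_linear_compose:
  assumes w: "natural_linear R S L Q w" and v: "natural_linear R S Q P v"
  shows "natural_linear R S L P (\<lambda>T \<phi> x. v T \<phi> (w T \<phi> x))"
  using natural_linearD[OF w] natural_linearD[OF v]
  by (intro natural_linearI) auto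

text \<open>Natural bilinear maps. Fixing either argument gives a natural linear map in the other,
  so an identity between pairings can be extended from coordinate vectors one variable at a
  time.\<close>

definition natural_pairing ::
  "'u ring \<Rightarrow> ('u, 'a) module_ftor \<Rightarrow> ('u, 'x) module_ftor \<Rightarrow> ('u, 'y) module_ftor \<Rightarrow>
     ('u alg \<Rightarrow> 'a \<Rightarrow> 'x \<Rightarrow> 'y) \<Rightarrow> bool" where
  "natural_pairing R A B C p \<longleftrightarrow>
     (\<forall>S. algebra R S \<longrightarrow> (\<forall>a\<in>carrier (obj A S). \<forall>x\<in>carrier (obj B S).
        p S a x \<in> carrier (obj C S) \<and>
        (\<forall>b\<in>carrier (obj A S). p S (a \<oplus>\<^bsub>obj A S\<^esub> b) x = p S a x \<oplus>\<^bsub>obj C S\<^esub> p S b x) \<and>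
        (\<forall>y\<in>carrier (obj B S). p S a (x \<oplus>\<^bsub>obj B S\<^esub> y) = p S a x \<oplus>\<^bsub>obj C S\<^esub> p S a y) \<and>
        (\<forall>s\<in>carrier S. p S (s \<odot>\<^bsub>obj A S\<^esub> a) x = s \<odot>\<^bsub>obj C S\<^esub> p S a x \<and>
           p S a (s \<odot>\<^bsub>obj B S\<^esub> x) = s \<odot>\<^bsub>obj C S\<^esub> p S a x) \<and>
        (\<forall>T h. alg_over R S T h \<longrightarrow>
           p T (arr A S T h a) (arr B S T h x) = arr C S T h (p S a x))))"

lemma natural_pairing_left:
  assumes p: "natural_pairing R A B C p" and B: "module_functor R B" and S: "algebra R S"
    and x: "x \<in> carrier (obj B S)"
  shows "natural_linear R S A C (\<lambda>T \<phi> a. p T a (arr B S T \<phi> x))"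
proof -
  have arr: "arr B S T \<phi> x \<in> carrier (obj B T)" if "alg_over R S T \<phi>" for T \<phi>
    using module_functorD(3)[OF B S alg_overD[OF that] x] .
  have comp: "arr B S U (compose (carrier S) h \<phi>) x = arr B T U h (arr B S T \<phi> x)"
    if "alg_over R S T \<phi>" "alg_over R T U h" for T \<phi> U h
    using module_functorD(6)[OF B S _ _ _ _ x] alg_overD[OF that(1)] alg_overD[OF that(2)] by simp
  show ?thesis
    using p by (intro natural_linearI) (simp_all add: natural_pairing_def arr comp alg_overD(1))
qed

lemma natural_pairing_right:
  assumes p: "natural_pairing R A B C p" and A: "module_functor R A" and S: "algebra R S"
    and a: "a \<in> carrier (obj A S)"
  shows "natural_linear R S B C (\<lambda>T \<phi>. p T (arr A S T \<phi> a))"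
proof -
  have arr: "arr A S T \<phi> a \<in> carrier (obj A T)" if "alg_over R S T \<phi>" for T \<phi>
    using module_functorD(3)[OF A S alg_overD[OF that] a] .
  have comp: "arr A S U (compose (carrier S) h \<phi>) a = arr A T U h (arr A S T \<phi> a)"
    if "alg_over R S T \<phi>" "alg_over R T U h" for T \<phi> U h
    using module_functorD(6)[OF A S _ _ _ _ a] alg_overD[OF that(1)] alg_overD[OF that(2)] by simp
  show ?thesis
    using p by (intro natural_linearI) (simp_all add: natural_pairing_def arr comp alg_overD(1))
qed

lemma module_functor_base:
  assumes "cring R"
  shows "module_functor R (base_functor :: ('u, 'u) module_ftor)"
proof -
  have "module S (self_module S)" if "algebra R S" for S :: "'u alg"
    using that by (simp add: module_self_module algebra_cring)
  then show ?thesis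
    by (auto simp: module_functor_def set_functor_def base_functor_def alg_homD compose_def)
qed

lemma base_functor_simps [simp]:
  "obj base_functor S = self_module S" "arr base_functor S T h = h"
  by (simp_all add: base_functor_def)

section \<open>Targets of linear type\<close>

text \<open>
  A point over the square-zero extension of \<open>S\<close> by the free module on \<open>K\<close> should involve only
  finitely many of the coordinates in \<open>K\<close>.
\<close>

definition determined_by ::
  "'u ring \<Rightarrow> ('u, 'y) module_ftor \<Rightarrow> 'u alg \<Rightarrow> 'u set \<Rightarrow> 'u set \<Rightarrow> 'y \<Rightarrow> bool" where
  "determined_by R Q S K F z \<longleftrightarrow> (\<forall>T g h. algebra R T \<longrightarrow>
     g \<in> alg_hom R (free_ext S K) T \<longrightarrow> h \<in> alg_hom R (free_ext S K) T \<longrightarrow>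
     (\<forall>s\<in>carrier S. \<forall>c\<in>carrier (obj (free_functor K) S). (\<forall>i\<in>K - F. c i = \<zero>\<^bsub>S\<^esub>) \<longrightarrow>
        g (sqz_enc S (obj (free_functor K) S) (s, c)) =
        h (sqz_enc S (obj (free_functor K) S) (s, c))) \<longrightarrow>
     arr Q (free_ext S K) T g z = arr Q (free_ext S K) T h z)"

definition finitary_target :: "'u ring \<Rightarrow> ('u, 'y) module_ftor \<Rightarrow> bool" where
  "finitary_target R Q \<longleftrightarrow> (\<forall>S K z. algebra R S \<longrightarrow> z \<in> carrier (obj Q (free_ext S K)) \<longrightarrow>
     (\<exists>F. finite F \<and> F \<subseteq> K \<and> determined_by R Q S K F z))"

text \<open>Over the dual numbers the generic point specializes to \<epsilon> \<open>x\<close>, so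
  the method computes \<epsilon> \<open>w(x)\<close>. This condition recovers \<open>w(x)\<close>
  from it.\<close>

definition eps_faithful :: "'u ring \<Rightarrow> ('u, 'y) module_ftor \<Rightarrow> bool" where
  "eps_faithful R Q \<longleftrightarrow> (\<forall>T y z. algebra R T \<longrightarrow> y \<in> carrier (obj Q T) \<longrightarrow> z \<in> carrier (obj Q T) \<longrightarrow>
     eps T \<odot>\<^bsub>obj Q (dual_numbers T)\<^esub> arr Q T (dual_numbers T) (sqz_incl T (self_module T)) y =
     eps T \<odot>\<^bsub>obj Q (dual_numbers T)\<^esub> arr Q T (dual_numbers T) (sqz_incl T (self_module T)) z \<longrightarrow>
     y = z)"

definition linear_target :: "'u ring \<Rightarrow> ('u, 'y) module_ftor \<Rightarrow> bool" where
  "linear_target R Q \<longleftrightarrow> module_functor R Q \<and> finitary_target R Q \<and> eps_faithful R Q"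

lemma determined_byD:
  assumes "determined_by R Q S K F z" "algebra R T"
    and "g \<in> alg_hom R (free_ext S K) T" "h \<in> alg_hom R (free_ext S K) T"
    and "\<And>s c. \<lbrakk>s \<in> carrier S; c \<in> carrier (obj (free_functor K) S); \<And>i. i \<in> K - F \<Longrightarrow> c i = \<zero>\<^bsub>S\<^esub>\<rbrakk> \<Longrightarrow>
      g (sqz_enc S (obj (free_functor K) S) (s, c)) = h (sqz_enc S (obj (free_functor K) S) (s, c))"
  shows "arr Q (free_ext S K) T g z = arr Q (free_ext S K) T h z"
proof -
  have "\<forall>s\<in>carrier S. \<forall>c\<in>carrier (obj (free_functor K) S). (\<forall>i\<in>K - F. c i = \<zero>\<^bsub>S\<^esub>) \<longrightarrow>
      g (sqz_enc S (obj (free_functor K) S) (s, c)) = h (sqz_enc S (obj (free_functor K) S) (s, c))"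
    using assms(5) by blast
  then show ?thesis using assms(1-4) unfolding determined_by_def by blast
qed

text \<open>A scalar over the extension is a pair \<open>(s, c)\<close>, and \<open>c\<close> has
  finite support by definition of a direct sum. Cancellation holds because \<epsilon> times
  \<open>(y, 0)\<close> is \<open>(0, y)\<close>.\<close>

lemma linear_target_base:
  assumes inf: "infinite (UNIV :: 'u set)" and R: "cring R"
  shows "linear_target R (base_functor :: ('u, 'u) module_ftor)"
proof -
  have "finitary_target R (base_functor :: ('u, 'u) module_ftor)"
    unfolding finitary_target_def
  proof (intro allI impI)
    fix S :: "'u alg" and K z
    assume S: "algebra R S" and z: "z \<in> carrier (obj base_functor (free_ext S K))"
    interpret square_zero R S "obj (free_functor K) S"
      by (rule square_zero_free[OF inf S])
    obtain s c where z: "s \<in> carrier S" "c \<in> carrier (obj (free_functor K) S)"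
        "z = sqz_enc S (obj (free_functor K) S) (s, c)"
      using z by (auto elim: sqz_cases)
    have "determined_by R base_functor S K {i \<in> K. c i \<noteq> \<zero>\<^bsub>S\<^esub>} z"
      using z unfolding determined_by_def by auto
    then show "\<exists>F. finite F \<and> F \<subseteq> K \<and> determined_by R base_functor S K F z"
      using z by (intro exI[of _ "{i \<in> K. c i \<noteq> \<zero>\<^bsub>S\<^esub>}"]) auto
  qed
  moreover have "eps_faithful R (base_functor :: ('u, 'u) module_ftor)"
    unfolding eps_faithful_def
  proof (intro allI impI)
    fix T :: "'u alg" and y z :: 'u
    assume T: "algebra R T" and yz: "y \<in> carrier (obj base_functor T)" "z \<in> carrier (obj base_functor T)"
    interpret square_zero R T "self_module T"
      by (rule square_zero_dual[OF inf T])
    assume "eps T \<odot>\<^bsub>obj base_functor (dual_numbers T)\<^esub> arr base_functor T (dual_numbers T) (sqz_incl T (self_module T)) y =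
     eps T \<odot>\<^bsub>obj base_functor (dual_numbers T)\<^esub> arr base_functor T (dual_numbers T) (sqz_incl T (self_module T)) z"
    then show "y = z"
      using yz E.smult_closed by (simp add: sqz_incl_def)
  qed
  ultimately show ?thesis
    by (simp add: linear_target_def module_functor_base[OF R])
qed

section \<open>Functors with coordinates\<close>

text \<open>
  Essentially free modules have such coordinates, with \<open>J\<close> the union and \<open>\<K>\<close> the family of the
  given index sets, and so have their duals, with the family \<open>perp\<close> below.
\<close>

locale coordinates =
  fixes R :: "'u ring" and L :: "('u, 'x) module_ftor" and J :: "'u set" and \<K> :: "'u set set"
    and c :: "'u alg \<Rightarrow> 'x \<Rightarrow> 'u \<Rightarrow> 'u"
  assumes universe: "infinite (UNIV :: 'u set)" and base: "cring R" and is_functor: "module_functor R L"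
    and c_closed: "\<And>S x j. algebra R S \<Longrightarrow> x \<in> carrier (obj L S) \<Longrightarrow> j \<in> J \<Longrightarrow> c S x j \<in> carrier S"
    and c_add: "\<And>S x y j. algebra R S \<Longrightarrow> x \<in> carrier (obj L S) \<Longrightarrow> y \<in> carrier (obj L S) \<Longrightarrow> j \<in> J \<Longrightarrow>
      c S (x \<oplus>\<^bsub>obj L S\<^esub> y) j = c S x j \<oplus>\<^bsub>S\<^esub> c S y j"
    and c_smult: "\<And>S s x j. algebra R S \<Longrightarrow> s \<in> carrier S \<Longrightarrow> x \<in> carrier (obj L S) \<Longrightarrow> j \<in> J \<Longrightarrow>
      c S (s \<odot>\<^bsub>obj L S\<^esub> x) j = s \<otimes>\<^bsub>S\<^esub> c S x j"
    and c_arr: "\<And>S T h x j. algebra R S \<Longrightarrow> algebra R T \<Longrightarrow> h \<in> alg_hom R S T \<Longrightarrow>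
      x \<in> carrier (obj L S) \<Longrightarrow> j \<in> J \<Longrightarrow> c T (arr L S T h x) j = h (c S x j)"
    and c_inj: "\<And>S x y. algebra R S \<Longrightarrow> x \<in> carrier (obj L S) \<Longrightarrow> y \<in> carrier (obj L S) \<Longrightarrow>
      (\<And>j. j \<in> J \<Longrightarrow> c S x j = c S y j) \<Longrightarrow> x = y"
    and c_finite: "\<And>S x K. algebra R S \<Longrightarrow> x \<in> carrier (obj L S) \<Longrightarrow> K \<in> \<K> \<Longrightarrow>
      finite {j \<in> J \<inter> K. c S x j \<noteq> \<zero>\<^bsub>S\<^esub>}"
    and c_surj: "\<And>S d. algebra R S \<Longrightarrow> d \<in> J \<rightarrow> carrier S \<Longrightarrow>
      (\<And>K. K \<in> \<K> \<Longrightarrow> finite {j \<in> J \<inter> K. d j \<noteq> \<zero>\<^bsub>S\<^esub>}) \<Longrightarrow>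
      \<exists>x\<in>carrier (obj L S). \<forall>j\<in>J. c S x j = d j"
begin

definition unit :: "'u alg \<Rightarrow> 'u \<Rightarrow> 'x" where
  "unit S j = (SOME x. x \<in> carrier (obj L S) \<and>
     (\<forall>i\<in>J. c S x i = (if i = j then \<one>\<^bsub>S\<^esub> else \<zero>\<^bsub>S\<^esub>)))"

text \<open>Orthogonality in the sense of finite intersections. Every support of a point belongs to
  it, and every function supported in one of its members is the coordinate function of a point;
  hence generic points exist on such sets.\<close>

definition perp :: "'u set set" where
  "perp = {K. K \<subseteq> J \<and> (\<forall>K'\<in>\<K>. finite (K \<inter> K'))}"

text \<open>A single index is finite on every member of \<open>\<K>\<close>, so the coordinate
  vector exists. For \<open>j\<close> outside \<open>J\<close> all its coordinates are zero;
  membership thus holds for every \<open>j\<close>.\<close>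

lemma unit:
  assumes "algebra R S"
  shows "unit S j \<in> carrier (obj L S)"
    and "i \<in> J \<Longrightarrow> c S (unit S j) i = (if i = j then \<one>\<^bsub>S\<^esub> else \<zero>\<^bsub>S\<^esub>)"
proof -
  interpret cring S using assms by (rule algebra_cring)
  have "finite {i \<in> J \<inter> K. (if i = j then \<one>\<^bsub>S\<^esub> else \<zero>\<^bsub>S\<^esub>) \<noteq> \<zero>\<^bsub>S\<^esub>}" for K
    by (rule finite_subset[of _ "{j}"]) auto
  then have "\<exists>x. x \<in> carrier (obj L S) \<and> (\<forall>i\<in>J. c S x i = (if i = j then \<one>\<^bsub>S\<^esub> else \<zero>\<^bsub>S\<^esub>))"
    using c_surj[OF assms, of "\<lambda>i. if i = j then \<one>\<^bsub>S\<^esub> else \<zero>\<^bsub>S\<^esub>"] by auto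
  then have "unit S j \<in> carrier (obj L S) \<and>
      (\<forall>i\<in>J. c S (unit S j) i = (if i = j then \<one>\<^bsub>S\<^esub> else \<zero>\<^bsub>S\<^esub>))"
    unfolding unit_def by (rule someI_ex)
  then show "unit S j \<in> carrier (obj L S)"
    and "i \<in> J \<Longrightarrow> c S (unit S j) i = (if i = j then \<one>\<^bsub>S\<^esub> else \<zero>\<^bsub>S\<^esub>)"
    by auto
qed

lemma c_hom:
  assumes "algebra R S" "j \<in> J"
  shows "abelian_group_hom (obj L S) S (\<lambda>x. c S x j)"
proof -
  interpret S: cring S using assms(1) by (rule algebra_cring)
  interpret L: module S "obj L S" using module_functorD(1)[OF is_functor assms(1)] .
  show ?thesis
    using assms c_closed c_add
    by (intro abelian_group_homI') (auto intro: S.abelian_group_axioms L.M.abelian_group_axioms)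
qed

text \<open>Algebra homomorphisms preserve zero and one, and points are determined by their
  coordinates. In particular every coordinate vector is a base change from \<open>R\<close>.\<close>

lemma arr_unit:
  assumes "algebra R S" "algebra R T" "h \<in> alg_hom R S T" "j \<in> J"
  shows "arr L S T h (unit S j) = unit T j"
  using assms alg_hom_zero[OF assms(1-3)] alg_homD(7)[OF assms(3)]
  by (intro c_inj[of T]) (auto simp: unit c_arr intro: module_functorD(3)[OF is_functor])

lemma c_finsum:
  assumes S: "algebra R S" and F: "finite F" "F \<subseteq> J" and a: "a \<in> F \<rightarrow> carrier S" and i: "i \<in> J"
  shows "c S (finsum (obj L S) (\<lambda>j. a j \<odot>\<^bsub>obj L S\<^esub> unit S j) F) i = (if i \<in> F then a i else \<zero>\<^bsub>S\<^esub>)"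
proof -
  interpret S: cring S using S by (rule algebra_cring)
  interpret L: module S "obj L S" using module_functorD(1)[OF is_functor S] .
  interpret c: abelian_group_hom "obj L S" S "\<lambda>x. c S x i" by (rule c_hom[OF S i])
  have "c S (finsum (obj L S) (\<lambda>j. a j \<odot>\<^bsub>obj L S\<^esub> unit S j) F) i =
      finsum S (\<lambda>j. c S (a j \<odot>\<^bsub>obj L S\<^esub> unit S j) i) F"
    using a unit(1)[OF S] by (intro c.hom_finsum[OF F(1)]) auto
  also have "\<dots> = finsum S (\<lambda>j. if j = i then a j else \<zero>\<^bsub>S\<^esub>) F"
    using funcset_mem[OF a] unit[OF S] i by (intro S.finsum_cong') (auto simp: c_smult[OF S])
  also have "\<dots> = (if i \<in> F then a i else \<zero>\<^bsub>S\<^esub>)"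
  proof (cases "i \<in> F")
    case True
    have "finsum S (\<lambda>j. if j = i then a j else \<zero>\<^bsub>S\<^esub>) F = finsum S (\<lambda>j. if j = i then a i else \<zero>\<^bsub>S\<^esub>) F"
      using a True by (intro S.finsum_cong') auto
    then show ?thesis using S.finsum_delta[OF F(1) True funcset_mem[OF a True]] True by simp
  next
    case False
    then have "finsum S (\<lambda>j. if j = i then a j else \<zero>\<^bsub>S\<^esub>) F = finsum S (\<lambda>j. \<zero>\<^bsub>S\<^esub>) F"
      by (intro S.finsum_cong') auto
    then show ?thesis using False by simp
  qed
  finally show ?thesis .
qed

text \<open>
  The generic point with coordinates \<open>t\<^sub>j\<close> over \<open>S \<oplus> \<Oplus>\<^sub>j S t\<^sub>j\<close> specializes to \<open>\<epsilon> x\<close> for every point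
  \<open>x\<close> supported in \<open>K\<close>, and its image under \<open>w\<close> involves finitely many of the \<open>t\<^sub>j\<close> only.
\<close>

lemma finite_determination:
  assumes Q: "linear_target R Q" and w: "natural_linear R S L Q w" and S: "algebra R S"
    and K: "K \<in> perp"
  obtains F where "finite F" "F \<subseteq> K"
    "\<And>T \<phi> x y. \<lbrakk>alg_over R S T \<phi>; x \<in> carrier (obj L T); y \<in> carrier (obj L T);
       \<And>j. j \<in> J - K \<Longrightarrow> c T x j = \<zero>\<^bsub>T\<^esub>; \<And>j. j \<in> J - K \<Longrightarrow> c T y j = \<zero>\<^bsub>T\<^esub>;
       \<And>j. j \<in> F \<Longrightarrow> c T x j = c T y j\<rbrakk> \<Longrightarrow> w T \<phi> x = w T \<phi> y"
proof -
  define E where "E = obj (free_functor K) S"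
  define S' where "S' = sqz S E"
  have KJ: "K \<subseteq> J" using K by (auto simp: perp_def)
  have sq: "square_zero R S E" unfolding E_def by (rule square_zero_free[OF universe S])
  interpret sq: square_zero R S E by (rule sq)
  have S': "algebra R S'" unfolding S'_def by (rule sq.algebra_sqz)
  \<comment> \<open>The variable \<open>t j\<close>: the basis vector of index \<open>j\<close>,
    placed in the square-zero ideal.\<close>
  define t where "t = (\<lambda>j. sqz_enc S E (\<zero>\<^bsub>S\<^esub>, \<lambda>i\<in>K. if i = j then \<one>\<^bsub>S\<^esub> else \<zero>\<^bsub>S\<^esub>))"
  have delta: "(\<lambda>i\<in>K. if i = j then \<one>\<^bsub>S\<^esub> else \<zero>\<^bsub>S\<^esub>) \<in> carrier E" for j
  proof -
    have "finite {i \<in> K. (\<lambda>i\<in>K. if i = j then \<one>\<^bsub>S\<^esub> else \<zero>\<^bsub>S\<^esub>) i \<noteq> \<zero>\<^bsub>S\<^esub>}"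
      by (rule finite_subset[of _ "{j}"]) auto
    then show ?thesis by (simp add: E_def)
  qed
  have t: "t j \<in> carrier S'" for j
    using delta by (simp add: t_def S'_def)
  \<comment> \<open>\<open>K\<close> meets each member of \<open>\<K>\<close> in a finite set, so
    the family of all variables indexed by \<open>K\<close>, extended by zero, is a point: the
    generic point \<open>u\<close>.\<close>
  have "\<exists>u\<in>carrier (obj L S'). \<forall>j\<in>J. c S' u j = (if j \<in> K then t j else \<zero>\<^bsub>S'\<^esub>)"
  proof (rule c_surj[OF S'])
    show "(\<lambda>j. if j \<in> K then t j else \<zero>\<^bsub>S'\<^esub>) \<in> J \<rightarrow> carrier S'"
      using t algebra_cring[OF S'] by (auto intro: cring.cring_simprules)
    fix K' assume "K' \<in> \<K>"
    with K have "finite (K \<inter> K')" by (auto simp: perp_def)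
    then show "finite {j \<in> J \<inter> K'. (if j \<in> K then t j else \<zero>\<^bsub>S'\<^esub>) \<noteq> \<zero>\<^bsub>S'\<^esub>}"
      by (rule rev_finite_subset) auto
  qed
  then obtain u where u: "u \<in> carrier (obj L S')"
    and cu: "\<And>j. j \<in> J \<Longrightarrow> c S' u j = (if j \<in> K then t j else \<zero>\<^bsub>S'\<^esub>)" by auto
  have over: "alg_over R S S' (sqz_incl S E)"
    unfolding S'_def by (rule sq.sqz_incl_over)
  define z where "z = w S' (sqz_incl S E) u"
  have "z \<in> carrier (obj Q S')"
    unfolding z_def by (rule natural_linearD(1)[OF w over u])
  \<comment> \<open>\<open>F\<close> depends only on the image \<open>z\<close> of the generic
    point; one finite set serves all \<open>T\<close>, \<open>x\<close> and
    \<open>y\<close>.\<close>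
  then obtain F where F: "finite F" "F \<subseteq> K" and det: "determined_by R Q S K F z"
    using Q S unfolding linear_target_def finitary_target_def S'_def E_def by blast
  show thesis
  proof (rule that[OF F])
    fix T \<phi> x y
    assume T: "alg_over R S T \<phi>" and x: "x \<in> carrier (obj L T)" and y: "y \<in> carrier (obj L T)"
      and supp: "\<And>j. j \<in> J - K \<Longrightarrow> c T x j = \<zero>\<^bsub>T\<^esub>" "\<And>j. j \<in> J - K \<Longrightarrow> c T y j = \<zero>\<^bsub>T\<^esub>"
      and eq: "\<And>j. j \<in> F \<Longrightarrow> c T x j = c T y j"
    note T' = alg_overD[OF T]
    interpret T: square_zero R T "self_module T" by (rule square_zero_dual[OF universe T'(1)])
    let ?D = "dual_numbers T"
    let ?\<iota> = "sqz_incl T (self_module T)"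
    have D: "algebra R ?D" by (rule T.algebra_sqz)
    have TD: "alg_over R T ?D ?\<iota>" by (rule T.sqz_incl_over)
    \<comment> \<open>The linear map sending the basis vector of index \<open>j\<close> to the
      coordinate of \<open>x\<close> at \<open>j\<close>. The sum runs over the support of
      \<open>d\<close>, which is finite, while that of \<open>x\<close> may be infinite.\<close>
    define k where "k = (\<lambda>x d. finsum T (\<lambda>j. \<phi> (d j) \<otimes>\<^bsub>T\<^esub> c T x j) {j \<in> K. d j \<noteq> \<zero>\<^bsub>S\<^esub>})"
    define g where "g = (\<lambda>x. sqz_map S E T (self_module T) \<phi> (k x))"
    interpret \<phi>: abelian_group_hom S T \<phi>
      by (rule alg_hom_abelian_group_hom[OF S T'])
    have k_alt: "k x d = finsum T (\<lambda>j. \<phi> (d j) \<otimes>\<^bsub>T\<^esub> c T x j) B"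
      if "x \<in> carrier (obj L T)" "d \<in> carrier E" "finite B" "B \<subseteq> K" "{j \<in> K. d j \<noteq> \<zero>\<^bsub>S\<^esub>} \<subseteq> B" for x d B
    proof -
      have d: "d j \<in> carrier S" "c T x j \<in> carrier T" if "j \<in> K" for j
        using \<open>d \<in> carrier E\<close> \<open>x \<in> carrier (obj L T)\<close> that KJ by (auto simp: E_def intro: c_closed[OF T'(1)])
      then show ?thesis
        unfolding k_def using that
        by (intro T.A.M.finsum_superset) (auto intro!: T.A.m_closed)
    qed
    have k: "abelian_group_hom E (self_module T) (k x)"
      and k_lin: "\<And>s d. s \<in> carrier S \<Longrightarrow> d \<in> carrier E \<Longrightarrow> k x (s \<odot>\<^bsub>E\<^esub> d) = \<phi> s \<odot>\<^bsub>self_module T\<^esub> k x d"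
      if x: "x \<in> carrier (obj L T)" for x
    proof -
      have cx: "c T x j \<in> carrier T" if "j \<in> K" for j
        using x that KJ by (auto intro: c_closed[OF T'(1)])
      have dS: "d j \<in> carrier S" if "d \<in> carrier E" "j \<in> K" for d j
        using that by (auto simp: E_def)
      have finS: "finite {j \<in> K. d j \<noteq> \<zero>\<^bsub>S\<^esub>}" if "d \<in> carrier E" for d
        using that by (auto simp: E_def)
      show "abelian_group_hom E (self_module T) (k x)"
      proof (rule abelian_group_homI')
        show "k x \<in> carrier E \<rightarrow> carrier (self_module T)"
          unfolding k_def using cx dS by (auto intro!: T.A.M.finsum_closed T.A.m_closed)
        fix d e assume de: "d \<in> carrier E" "e \<in> carrier E"
        define B where "B = {j \<in> K. d j \<noteq> \<zero>\<^bsub>S\<^esub>} \<union> {j \<in> K. e j \<noteq> \<zero>\<^bsub>S\<^esub>}"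
        have B: "finite B" "B \<subseteq> K" "{j \<in> K. d j \<noteq> \<zero>\<^bsub>S\<^esub>} \<subseteq> B" "{j \<in> K. e j \<noteq> \<zero>\<^bsub>S\<^esub>} \<subseteq> B"
          using de finS by (auto simp: B_def)
        have plus: "(d \<oplus>\<^bsub>E\<^esub> e) j = d j \<oplus>\<^bsub>S\<^esub> e j" if "j \<in> K" for j
          using that by (simp add: E_def)
        have inB: "\<phi> (d j) \<in> carrier T" "\<phi> (e j) \<in> carrier T" "c T x j \<in> carrier T"
            "\<phi> ((d \<oplus>\<^bsub>E\<^esub> e) j) = \<phi> (d j) \<oplus>\<^bsub>T\<^esub> \<phi> (e j)" if "j \<in> B" for j
          using that B(2) cx dS[OF de(1), of j] dS[OF de(2), of j] by (auto simp: plus)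
        have "{j \<in> K. (d \<oplus>\<^bsub>E\<^esub> e) j \<noteq> \<zero>\<^bsub>S\<^esub>} \<subseteq> B"
          using plus by (auto simp: B_def)
        then have "k x (d \<oplus>\<^bsub>E\<^esub> e) = finsum T (\<lambda>j. \<phi> ((d \<oplus>\<^bsub>E\<^esub> e) j) \<otimes>\<^bsub>T\<^esub> c T x j) B"
          using de B x by (intro k_alt) auto
        also have "\<dots> = finsum T (\<lambda>j. \<phi> (d j) \<otimes>\<^bsub>T\<^esub> c T x j \<oplus>\<^bsub>T\<^esub> \<phi> (e j) \<otimes>\<^bsub>T\<^esub> c T x j) B"
          by (intro T.A.M.finsum_cong') (simp_all add: inB T.A.l_distr)
        also have "\<dots> = finsum T (\<lambda>j. \<phi> (d j) \<otimes>\<^bsub>T\<^esub> c T x j) B \<oplus>\<^bsub>T\<^esub> finsum T (\<lambda>j. \<phi> (e j) \<otimes>\<^bsub>T\<^esub> c T x j) B"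
          by (intro T.A.M.finsum_addf) (simp_all add: inB)
        also have "\<dots> = k x d \<oplus>\<^bsub>self_module T\<^esub> k x e"
          using k_alt[OF x de(1) B(1-3)] k_alt[OF x de(2) B(1,2,4)] by simp
        finally show "k x (d \<oplus>\<^bsub>E\<^esub> e) = k x d \<oplus>\<^bsub>self_module T\<^esub> k x e" .
      qed (auto intro: sq.E.M.abelian_group_axioms T.E.M.abelian_group_axioms)
      fix s d assume s: "s \<in> carrier S" and d: "d \<in> carrier E"
      define B where "B = {j \<in> K. d j \<noteq> \<zero>\<^bsub>S\<^esub>}"
      have B: "finite B" "B \<subseteq> K" "{j \<in> K. d j \<noteq> \<zero>\<^bsub>S\<^esub>} \<subseteq> B"
        using d finS by (auto simp: B_def)
      have times: "(s \<odot>\<^bsub>E\<^esub> d) j = s \<otimes>\<^bsub>S\<^esub> d j" if "j \<in> K" for j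
        using that by (simp add: E_def)
      have inB: "\<phi> (d j) \<in> carrier T" "c T x j \<in> carrier T"
          "\<phi> ((s \<odot>\<^bsub>E\<^esub> d) j) = \<phi> s \<otimes>\<^bsub>T\<^esub> \<phi> (d j)" if "j \<in> B" for j
        using that B(2) cx dS[OF d, of j] s by (auto simp: times alg_homD(6)[OF T'(2)])
      have s': "\<phi> s \<in> carrier T" using s by simp
      have "{j \<in> K. (s \<odot>\<^bsub>E\<^esub> d) j \<noteq> \<zero>\<^bsub>S\<^esub>} \<subseteq> B"
        using times s by (auto simp: B_def)
      then have "k x (s \<odot>\<^bsub>E\<^esub> d) = finsum T (\<lambda>j. \<phi> ((s \<odot>\<^bsub>E\<^esub> d) j) \<otimes>\<^bsub>T\<^esub> c T x j) B"
        using s d B x by (intro k_alt) auto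
      also have "\<dots> = finsum T (\<lambda>j. \<phi> s \<otimes>\<^bsub>T\<^esub> (\<phi> (d j) \<otimes>\<^bsub>T\<^esub> c T x j)) B"
        by (intro T.A.M.finsum_cong') (simp_all add: inB s' T.A.m_assoc)
      also have "\<dots> = \<phi> s \<otimes>\<^bsub>T\<^esub> finsum T (\<lambda>j. \<phi> (d j) \<otimes>\<^bsub>T\<^esub> c T x j) B"
        using B(1) by (intro T.A.finsum_rdistr[symmetric]) (simp_all add: inB s')
      finally show "k x (s \<odot>\<^bsub>E\<^esub> d) = \<phi> s \<odot>\<^bsub>self_module T\<^esub> k x d"
        using k_alt[OF x d B] by simp
    qed
    have g: "g x \<in> alg_hom R S' ?D" if "x \<in> carrier (obj L T)" for x
      unfolding g_def S'_def
      by (rule sqz_map_in[OF sq T.square_zero_axioms T'(2) k[OF that]]) (rule k_lin[OF that])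
    have g_enc: "g x (sqz_enc S E (s, d)) = sqz_enc T (self_module T) (\<phi> s, k x d)"
      if "s \<in> carrier S" "d \<in> carrier E" for s d x
      unfolding g_def using that by (rule sqz_map_enc[OF sq])
    have kx: "k x d \<in> carrier T" if "x \<in> carrier (obj L T)" "d \<in> carrier E" for x d
      using abelian_group_hom.hom_closed[OF k[OF that(1)] that(2)] by simp
    have g_t: "g x (t j) = sqz_enc T (self_module T) (\<zero>\<^bsub>T\<^esub>, c T x j)"
      if x: "x \<in> carrier (obj L T)" and j: "j \<in> K" for x j
    proof -
      let ?d = "\<lambda>i\<in>K. if i = j then \<one>\<^bsub>S\<^esub> else \<zero>\<^bsub>S\<^esub>"
      have cx: "c T x j \<in> carrier T" using x j KJ by (auto intro: c_closed[OF T'(1)])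
      have "k x ?d = finsum T (\<lambda>i. \<phi> (?d i) \<otimes>\<^bsub>T\<^esub> c T x i) {j}"
        using j by (intro k_alt[OF x delta]) (auto split: if_splits)
      also have "\<dots> = finsum T (\<lambda>i. c T x i) {j}"
        using j cx alg_homD(7)[OF T'(2)] by (intro T.A.M.finsum_cong') auto
      also have "\<dots> = c T x j"
        using T.A.M.finsum_insert[of "{}" j "\<lambda>i. c T x i"] cx by simp
      finally have "k x ?d = c T x j" .
      then show ?thesis
        using g_enc[OF _ delta, of "\<zero>\<^bsub>S\<^esub>" x j] by (simp add: t_def)
    qed
    \<comment> \<open>On \<open>S\<close> the specialization \<open>g x\<close> is the structure map
      into the dual numbers of \<open>T\<close>. Naturality of \<open>w\<close> along
      \<open>g x\<close> and along the inclusion of \<open>T\<close> therefore end in the same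
      component.\<close>
    have comp: "compose (carrier S) (g x) (sqz_incl S E) = compose (carrier S) ?\<iota> \<phi>"
      if x: "x \<in> carrier (obj L T)" for x
    proof (rule extensionalityI[of _ "carrier S"])
      fix s assume s: "s \<in> carrier S"
      have "k x \<zero>\<^bsub>E\<^esub> = \<zero>\<^bsub>T\<^esub>"
        using abelian_group_hom.hom_zero[OF k[OF x]] by simp
      then show "compose (carrier S) (g x) (sqz_incl S E) s = compose (carrier S) ?\<iota> \<phi> s"
        using s by (simp add: compose_def sqz_incl_def g_enc)
    qed (auto simp: compose_def)
    \<comment> \<open>Specializing \<open>w\<close> of the generic point gives \<open>w\<close> of
      \<epsilon> \<open>x\<close>, and linearity moves \<epsilon> outside; thus \<open>z\<close>
      determines \<epsilon> \<open>w(x)\<close>.\<close>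
    have special: "eps T \<odot>\<^bsub>obj Q ?D\<^esub> arr Q T ?D ?\<iota> (w T \<phi> x) = arr Q S' ?D (g x) z"
      if x: "x \<in> carrier (obj L T)" and supp: "\<And>j. j \<in> J - K \<Longrightarrow> c T x j = \<zero>\<^bsub>T\<^esub>" for x
    proof -
      have epsD: "eps T \<in> carrier ?D" by simp
      have \<iota>x: "arr L T ?D ?\<iota> x \<in> carrier (obj L ?D)"
        using module_functorD(3)[OF is_functor T'(1) D T.sqz_incl_in x] .
      have overD: "alg_over R S' ?D (g x)" using g[OF x] D by (simp add: alg_over_def)
      have SD: "alg_over R S ?D (compose (carrier S) ?\<iota> \<phi>)"
        by (rule alg_over_compose[OF S T TD])
      have gu: "arr L S' ?D (g x) u = eps T \<odot>\<^bsub>obj L ?D\<^esub> arr L T ?D ?\<iota> x"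
      proof (rule c_inj[OF D])
        show "arr L S' ?D (g x) u \<in> carrier (obj L ?D)"
          using module_functorD(3)[OF is_functor S' D g[OF x] u] .
        show "eps T \<odot>\<^bsub>obj L ?D\<^esub> arr L T ?D ?\<iota> x \<in> carrier (obj L ?D)"
          using module.smult_closed[OF module_functorD(1)[OF is_functor D] epsD \<iota>x] .
        fix j assume j: "j \<in> J"
        have cx: "c T x j \<in> carrier T" using x j by (auto intro: c_closed[OF T'(1)])
        then have "c ?D (eps T \<odot>\<^bsub>obj L ?D\<^esub> arr L T ?D ?\<iota> x) j = sqz_enc T (self_module T) (\<zero>\<^bsub>T\<^esub>, c T x j)"
          using c_smult[OF D epsD \<iota>x j] c_arr[OF T'(1) D T.sqz_incl_in x j]
          by (simp add: sqz_incl_def)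
        moreover have "c ?D (arr L S' ?D (g x) u) j = sqz_enc T (self_module T) (\<zero>\<^bsub>T\<^esub>, c T x j)"
        proof (cases "j \<in> K")
          case True
          then show ?thesis using c_arr[OF S' D g[OF x] u j] cu[OF j] g_t[OF x] by simp
        next
          case False
          then show ?thesis
            using c_arr[OF S' D g[OF x] u j] cu[OF j] alg_hom_zero[OF S' D g[OF x]] supp j by simp
        qed
        ultimately show "c ?D (arr L S' ?D (g x) u) j =
            c ?D (eps T \<odot>\<^bsub>obj L ?D\<^esub> arr L T ?D ?\<iota> x) j" by simp
      qed
      have "arr Q S' ?D (g x) z = w ?D (compose (carrier S) ?\<iota> \<phi>) (arr L S' ?D (g x) u)"
        unfolding z_def comp[OF x, symmetric]
        by (rule natural_linearD(4)[OF w over overD u, symmetric])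
      also have "\<dots> = eps T \<odot>\<^bsub>obj Q ?D\<^esub> w ?D (compose (carrier S) ?\<iota> \<phi>) (arr L T ?D ?\<iota> x)"
        unfolding gu by (rule natural_linearD(3)[OF w SD epsD \<iota>x])
      also have "\<dots> = eps T \<odot>\<^bsub>obj Q ?D\<^esub> arr Q T ?D ?\<iota> (w T \<phi> x)"
        by (simp only: natural_linearD(4)[OF w T TD x])
      finally show ?thesis by simp
    qed
    \<comment> \<open>\<open>z\<close> involves only variables indexed by \<open>F\<close>, and
      \<open>g x\<close> and \<open>g y\<close> treat those alike because \<open>x\<close> and
      \<open>y\<close> have equal coordinates there.\<close>
    have "arr Q S' ?D (g x) z = arr Q S' ?D (g y) z"
      unfolding S'_def E_def
    proof (rule determined_byD[OF det D])
      show "g x \<in> alg_hom R (free_ext S K) ?D" "g y \<in> alg_hom R (free_ext S K) ?D"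
        using g x y by (simp_all add: S'_def E_def)
      fix s d assume s: "s \<in> carrier S" and "d \<in> carrier (obj (free_functor K) S)"
        and dF: "\<And>i. i \<in> K - F \<Longrightarrow> d i = \<zero>\<^bsub>S\<^esub>"
      then have d: "d \<in> carrier E" by (simp add: E_def)
      have B: "finite F" "F \<subseteq> K" "{j \<in> K. d j \<noteq> \<zero>\<^bsub>S\<^esub>} \<subseteq> F"
        using F dF by auto
      have "k x d = k y d"
        unfolding k_alt[OF x d B] k_alt[OF y d B] using d F KJ y
        by (intro T.A.M.finsum_cong') (auto simp: eq E_def subset_iff intro!: c_closed[OF T'(1)] T.A.m_closed \<phi>.hom_closed)
      then show "g x (sqz_enc S (obj (free_functor K) S) (s, d)) =
          g y (sqz_enc S (obj (free_functor K) S) (s, d))"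
        unfolding E_def[symmetric] using s d by (simp add: g_enc)
    qed
    then have "eps T \<odot>\<^bsub>obj Q ?D\<^esub> arr Q T ?D ?\<iota> (w T \<phi> x) = eps T \<odot>\<^bsub>obj Q ?D\<^esub> arr Q T ?D ?\<iota> (w T \<phi> y)"
      using special[OF x supp(1)] special[OF y supp(2)] by simp
    then show "w T \<phi> x = w T \<phi> y"
      using Q T'(1) natural_linearD(1)[OF w T] x y
      unfolding linear_target_def eps_faithful_def by blast
  qed
qed

lemma perp_support:
  assumes "algebra R S" "x \<in> carrier (obj L S)"
  shows "{j \<in> J. c S x j \<noteq> \<zero>\<^bsub>S\<^esub>} \<in> perp"
proof -
  have "{j \<in> J. c S x j \<noteq> \<zero>\<^bsub>S\<^esub>} \<inter> K = {j \<in> J \<inter> K. c S x j \<noteq> \<zero>\<^bsub>S\<^esub>}" for K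
    by auto
  then show ?thesis using c_finite[OF assms] by (auto simp: perp_def)
qed

text \<open>Coordinate vectors over \<open>T\<close> are base changes of those over
  \<open>S\<close>; so the values at units over \<open>S\<close> fix those over every
  \<open>T\<close>.\<close>

lemma natural_linear_unit:
  assumes w: "natural_linear R S L Q w" and S: "algebra R S" and T: "alg_over R S T \<phi>" and j: "j \<in> J"
  shows "w T \<phi> (unit T j) = arr Q S T \<phi> (w S (id_hom S) (unit S j))"
  using natural_linearD(4)[OF w alg_over_id[OF S] T unit(1)[OF S, of j]] alg_overD[OF T]
    compose_id_hom_right[of \<phi> R S T] arr_unit[OF S _ _ j] by simp

text \<open>On the determining set \<open>F\<close>, \<open>x\<close> agrees with a finite
  combination of units of index in \<open>F\<close>, so both have the same image. A unit of index in
  \<open>K - F\<close> agrees there with zero, whence the finiteness of nonzero values. The set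
  \<open>B\<close> is left free so that several expansions can share one index set.\<close>

lemma expansion:
  assumes Q: "linear_target R Q" and w: "natural_linear R S L Q w" and S: "algebra R S"
    and K: "K \<in> perp"
  shows "finite {j \<in> K. w S (id_hom S) (unit S j) \<noteq> \<zero>\<^bsub>obj Q S\<^esub>}"
    and "\<And>T \<phi> x B. \<lbrakk>alg_over R S T \<phi>; x \<in> carrier (obj L T); \<And>j. j \<in> J - K \<Longrightarrow> c T x j = \<zero>\<^bsub>T\<^esub>;
      finite B; B \<subseteq> J; {j \<in> K. c T x j \<noteq> \<zero>\<^bsub>T\<^esub> \<and> w S (id_hom S) (unit S j) \<noteq> \<zero>\<^bsub>obj Q S\<^esub>} \<subseteq> B\<rbrakk> \<Longrightarrow>
      w T \<phi> x = finsum (obj Q T) (\<lambda>j. c T x j \<odot>\<^bsub>obj Q T\<^esub> w T \<phi> (unit T j)) B"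
proof -
  have KJ: "K \<subseteq> J" using K by (auto simp: perp_def)
  have QF: "module_functor R Q" using Q by (simp add: linear_target_def)
  obtain F where F: "finite F" "F \<subseteq> K" and det:
    "\<And>T \<phi> x y. \<lbrakk>alg_over R S T \<phi>; x \<in> carrier (obj L T); y \<in> carrier (obj L T);
       \<And>j. j \<in> J - K \<Longrightarrow> c T x j = \<zero>\<^bsub>T\<^esub>; \<And>j. j \<in> J - K \<Longrightarrow> c T y j = \<zero>\<^bsub>T\<^esub>;
       \<And>j. j \<in> F \<Longrightarrow> c T x j = c T y j\<rbrakk> \<Longrightarrow> w T \<phi> x = w T \<phi> y"
    using finite_determination[OF Q w S K] by blast
  have FJ: "F \<subseteq> J" using F KJ by auto
  have id: "alg_over R S S (id_hom S)" by (rule alg_over_id[OF S])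
  have zero: "w S (id_hom S) (unit S j) = \<zero>\<^bsub>obj Q S\<^esub>" if "j \<in> K - F" for j
  proof -
    interpret h: abelian_group_hom "obj L S" "obj Q S" "w S (id_hom S)"
      by (rule natural_linear_hom[OF is_functor QF w id])
    have c0: "c S \<zero>\<^bsub>obj L S\<^esub> i = \<zero>\<^bsub>S\<^esub>" if "i \<in> J" for i
      using abelian_group_hom.hom_zero[OF c_hom[OF S that]] .
    have "w S (id_hom S) (unit S j) = w S (id_hom S) \<zero>\<^bsub>obj L S\<^esub>"
      using that FJ KJ by (intro det[OF id unit(1)[OF S] h.G.zero_closed]) (auto simp: unit[OF S] c0 subset_iff)
    then show ?thesis by simp
  qed
  then have sub: "{j \<in> K. w S (id_hom S) (unit S j) \<noteq> \<zero>\<^bsub>obj Q S\<^esub>} \<subseteq> F" by auto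
  then show "finite {j \<in> K. w S (id_hom S) (unit S j) \<noteq> \<zero>\<^bsub>obj Q S\<^esub>}"
    using F(1) by (rule finite_subset)
  fix T \<phi> x B
  assume T: "alg_over R S T \<phi>" and x: "x \<in> carrier (obj L T)"
    and supp: "\<And>j. j \<in> J - K \<Longrightarrow> c T x j = \<zero>\<^bsub>T\<^esub>"
    and B: "finite B" "B \<subseteq> J" "{j \<in> K. c T x j \<noteq> \<zero>\<^bsub>T\<^esub> \<and> w S (id_hom S) (unit S j) \<noteq> \<zero>\<^bsub>obj Q S\<^esub>} \<subseteq> B"
  note T' = alg_overD[OF T]
  interpret T: cring T using T'(1) by (rule algebra_cring)
  interpret L: module T "obj L T" using module_functorD(1)[OF is_functor T'(1)] .
  interpret Q: module T "obj Q T" using module_functorD(1)[OF QF T'(1)] .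
  interpret h: abelian_group_hom "obj L T" "obj Q T" "w T \<phi>"
    by (rule natural_linear_hom[OF is_functor QF w T])
  have cx: "c T x j \<in> carrier T" if "j \<in> J" for j
    using c_closed[OF T'(1) x that] .
  have smult_unit: "c T x j \<odot>\<^bsub>obj L T\<^esub> unit T j \<in> carrier (obj L T)" if "j \<in> J" for j
    using cx[OF that] unit(1)[OF T'(1)] by simp
  have termQ: "c T x j \<odot>\<^bsub>obj Q T\<^esub> w T \<phi> (unit T j) \<in> carrier (obj Q T)" if "j \<in> J" for j
    using cx[OF that] unit(1)[OF T'(1)] by simp
  let ?x = "finsum (obj L T) (\<lambda>j. c T x j \<odot>\<^bsub>obj L T\<^esub> unit T j) F"
  have c_fin: "c T ?x i = (if i \<in> F then c T x i else \<zero>\<^bsub>T\<^esub>)" if "i \<in> J" for i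
    using FJ cx by (intro c_finsum[OF T'(1) F(1) FJ _ that]) auto
  have "w T \<phi> x = w T \<phi> ?x"
  proof (rule det[OF T x])
    show "?x \<in> carrier (obj L T)"
      using smult_unit FJ by (intro L.M.finsum_closed) auto
  qed (use c_fin supp F FJ in auto)
  also have "\<dots> = finsum (obj Q T) (\<lambda>j. w T \<phi> (c T x j \<odot>\<^bsub>obj L T\<^esub> unit T j)) F"
    using smult_unit FJ by (intro h.hom_finsum[OF F(1)]) auto
  also have "\<dots> = finsum (obj Q T) (\<lambda>j. c T x j \<odot>\<^bsub>obj Q T\<^esub> w T \<phi> (unit T j)) F"
    using FJ cx unit(1)[OF T'(1)] termQ
    by (intro Q.M.finsum_cong') (auto simp: natural_linearD(3)[OF w T])
  \<comment> \<open>\<open>F\<close> and \<open>B\<close> each contain every index with a nonzero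
    term: off \<open>K\<close> the coordinate vanishes, and on \<open>K - F\<close> the value at the
    unit does.\<close>
  also have "\<dots> = finsum (obj Q T) (\<lambda>j. c T x j \<odot>\<^bsub>obj Q T\<^esub> w T \<phi> (unit T j)) B"
  proof (intro Q.M.add.finprod_mono_neutral_cong)
    have wz: "w T \<phi> (unit T j) = \<zero>\<^bsub>obj Q T\<^esub>" if "w S (id_hom S) (unit S j) = \<zero>\<^bsub>obj Q S\<^esub>" "j \<in> J" for j
      using natural_linear_unit[OF w S T that(2)] that(1)
        abelian_group_hom.hom_zero[OF module_functorD(2)[OF QF S T']] by simp
    have vanish: "c T x j \<odot>\<^bsub>obj Q T\<^esub> w T \<phi> (unit T j) = \<zero>\<^bsub>obj Q T\<^esub>"
      if "j \<in> J" and n: "j \<notin> K \<or> c T x j = \<zero>\<^bsub>T\<^esub> \<or> w S (id_hom S) (unit S j) = \<zero>\<^bsub>obj Q S\<^esub>" for j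
    proof -
      have "c T x j = \<zero>\<^bsub>T\<^esub> \<or> w T \<phi> (unit T j) = \<zero>\<^bsub>obj Q T\<^esub>"
        using that wz supp by auto
      then show ?thesis using cx[OF \<open>j \<in> J\<close>] unit(1)[OF T'(1)] by auto
    qed
    show "c T x j \<odot>\<^bsub>obj Q T\<^esub> w T \<phi> (unit T j) = \<zero>\<^bsub>obj Q T\<^esub>" if "j \<in> B - F" for j
      using vanish[of j] that B(2) sub by auto
    show "c T x j \<odot>\<^bsub>obj Q T\<^esub> w T \<phi> (unit T j) = \<zero>\<^bsub>obj Q T\<^esub>" if "j \<in> F - B" for j
      using vanish[of j] that B(3) FJ by auto
  qed (use F FJ B termQ in auto)
  finally show "w T \<phi> x = finsum (obj Q T) (\<lambda>j. c T x j \<odot>\<^bsub>obj Q T\<^esub> w T \<phi> (unit T j)) B" .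
qed

text \<open>Both maps are expanded over the support of \<open>x\<close>. The units with nonzero
  image are the same for \<open>w\<close> and \<open>v\<close>, so one finite index set serves both
  sums.\<close>

lemma natural_linear_unique:
  assumes Q: "linear_target R Q" and w: "natural_linear R S L Q w" and v: "natural_linear R S L Q v"
    and S: "algebra R S" and eq: "\<And>j. j \<in> J \<Longrightarrow> w S (id_hom S) (unit S j) = v S (id_hom S) (unit S j)"
    and T: "alg_over R S T \<phi>" and x: "x \<in> carrier (obj L T)"
  shows "w T \<phi> x = v T \<phi> x"
proof -
  note T' = alg_overD[OF T]
  let ?K = "{j \<in> J. c T x j \<noteq> \<zero>\<^bsub>T\<^esub>}"
  have K: "?K \<in> perp" using perp_support[OF T'(1) x] .
  define B where "B = {j \<in> ?K. w S (id_hom S) (unit S j) \<noteq> \<zero>\<^bsub>obj Q S\<^esub>}"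
  have B: "finite B" "B \<subseteq> J" using expansion(1)[OF Q w S K] by (auto simp: B_def)
  have "w T \<phi> x = finsum (obj Q T) (\<lambda>j. c T x j \<odot>\<^bsub>obj Q T\<^esub> w T \<phi> (unit T j)) B"
    using B by (intro expansion(2)[OF Q w S K T x]) (auto simp: B_def)
  moreover have "v T \<phi> x = finsum (obj Q T) (\<lambda>j. c T x j \<odot>\<^bsub>obj Q T\<^esub> v T \<phi> (unit T j)) B"
    using B eq by (intro expansion(2)[OF Q v S K T x]) (auto simp: B_def)
  moreover have "w T \<phi> (unit T j) = v T \<phi> (unit T j)" if "j \<in> J" for j
    using natural_linear_unit[OF w S T that] natural_linear_unit[OF v S T that] eq[OF that] by simp
  ultimately show ?thesis
  proof -
    interpret T: cring T using T'(1) by (rule algebra_cring)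
    have QF: "module_functor R Q" using Q by (simp add: linear_target_def)
    interpret Q: module T "obj Q T" using module_functorD(1)[OF QF T'(1)] .
    have "finsum (obj Q T) (\<lambda>j. c T x j \<odot>\<^bsub>obj Q T\<^esub> w T \<phi> (unit T j)) B =
        finsum (obj Q T) (\<lambda>j. c T x j \<odot>\<^bsub>obj Q T\<^esub> v T \<phi> (unit T j)) B"
      using B \<open>\<And>j. j \<in> J \<Longrightarrow> w T \<phi> (unit T j) = v T \<phi> (unit T j)\<close>
        natural_linearD(1)[OF v T unit(1)[OF T'(1)]] c_closed[OF T'(1) x]
      by (intro Q.M.finsum_cong') auto
    then show ?thesis
      using \<open>w T \<phi> x = _\<close> \<open>v T \<phi> x = _\<close> by simp
  qed
qed

text \<open>Composing with coordinates, which are themselves linear forms, reduces a target with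
  coordinates to the scalar case.\<close>

lemma coordinate_natural_linear:
  assumes "algebra R S" "j \<in> J"
  shows "natural_linear R S L base_functor (\<lambda>T \<phi> x. c T x j)"
  using assms by (intro natural_linearI) (auto simp: alg_over_def c_closed c_add c_smult c_arr)

end

section \<open>Families of maps and the functors they form\<close>

lemma family_over_apply [simp]: "alg_over R S T \<phi> \<Longrightarrow> family_over R S t T \<phi> = t T \<phi>"
  by (simp add: family_over_def)

lemma family_over_idem [simp]: "family_over R S (family_over R S t) = family_over R S t"
  by (simp add: family_over_def fun_eq_iff)

lemma family_eqI:
  assumes "t = family_over R S t" "u = family_over R S u"
    and "\<And>T \<phi>. alg_over R S T \<phi> \<Longrightarrow> t T \<phi> = u T \<phi>"
  shows "t = u"
proof -
  have "family_over R S t = family_over R S u"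
    using assms(3) by (auto simp: family_over_def fun_eq_iff)
  then show ?thesis using assms(1,2) by simp
qed

lemma Hom_overD:
  assumes "t \<in> Hom_over R S F F'"
  shows "t = family_over R S t"
    and "alg_over R S T \<phi> \<Longrightarrow> t T \<phi> \<in> carrier (obj F T) \<rightarrow>\<^sub>E carrier (obj F' T)"
    and "alg_over R S T \<phi> \<Longrightarrow> alg_over R T U h \<Longrightarrow> x \<in> carrier (obj F T) \<Longrightarrow>
      t U (compose (carrier S) h \<phi>) (arr F T U h x) = arr F' T U h (t T \<phi> x)"
  using assms unfolding Hom_over_def by blast+

lemma lin_Hom_over_natural_linear:
  assumes "t \<in> lin_Hom_over R S M M'"
  shows "natural_linear R S M M' t"
proof -
  have t: "t \<in> Hom_over R S M M'" using assms by (simp add: lin_Hom_over_def)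
  show ?thesis
  proof (rule natural_linearI)
    fix T \<phi> x assume "alg_over R S T \<phi>" "x \<in> carrier (obj M T)"
    then show "t T \<phi> x \<in> carrier (obj M' T)" using Hom_overD(2)[OF t] by blast
  qed (use assms Hom_overD(3)[OF t] in \<open>simp_all add: lin_Hom_over_def\<close>)
qed

lemma lin_Hom_over_eqI:
  assumes "t \<in> lin_Hom_over R S M M'" "u \<in> lin_Hom_over R S M M'"
    and "\<And>T \<phi> x. alg_over R S T \<phi> \<Longrightarrow> x \<in> carrier (obj M T) \<Longrightarrow> t T \<phi> x = u T \<phi> x"
  shows "t = u"
proof -
  have t: "t \<in> Hom_over R S M M'" and u: "u \<in> Hom_over R S M M'"
    using assms(1,2) by (auto simp: lin_Hom_over_def)
  show ?thesis
  proof (rule family_eqI[OF Hom_overD(1)[OF t] Hom_overD(1)[OF u]])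
    fix T \<phi> assume T: "alg_over R S T \<phi>"
    show "t T \<phi> = u T \<phi>"
      by (rule PiE_ext[OF Hom_overD(2)[OF t T] Hom_overD(2)[OF u T] assms(3)[OF T]])
  qed
qed

lemma lin_Hom_overI:
  assumes M: "module_functor R M" and S: "algebra R S" and w: "natural_linear R S M M' w"
  shows "family_over R S (\<lambda>T \<phi>. \<lambda>x\<in>carrier (obj M T). w T \<phi> x) \<in> lin_Hom_over R S M M'"
proof -
  have mod: "module T (obj M T)" if "alg_over R S T \<phi>" for T \<phi>
    using module_functorD(1)[OF M] alg_overD(1)[OF that] .
  have arr: "arr M T U h x \<in> carrier (obj M U)" if "alg_over R S T \<phi>" "alg_over R T U h" "x \<in> carrier (obj M T)"
    for T \<phi> U h x
    using that alg_overD module_functorD(3)[OF M] by metis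
  have add: "x \<oplus>\<^bsub>obj M T\<^esub> y \<in> carrier (obj M T)"
    if "alg_over R S T \<phi>" "x \<in> carrier (obj M T)" "y \<in> carrier (obj M T)" for T \<phi> x y
    using abelian_groupE(1)[OF module_abelian_group[OF mod[OF that(1)]]] that(2,3) .
  have smult: "t \<odot>\<^bsub>obj M T\<^esub> x \<in> carrier (obj M T)"
    if "alg_over R S T \<phi>" "t \<in> carrier T" "x \<in> carrier (obj M T)" for T \<phi> t x
    using module.smult_closed[OF mod[OF that(1)]] that(2,3) .
  note comp = alg_over_compose[OF S]
  show ?thesis
    unfolding lin_Hom_over_def Hom_over_def
    using natural_linearD[OF w] by (simp add: arr add smult comp)
qed

lemma with_mult_one_simps [simp]:
  "carrier (obj (with_mult_one M m e) S) = carrier (obj M S)"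
  "\<zero>\<^bsub>obj (with_mult_one M m e) S\<^esub> = \<zero>\<^bsub>obj M S\<^esub>"
  "add (obj (with_mult_one M m e) S) = add (obj M S)"
  "module.smult (obj (with_mult_one M m e) S) = module.smult (obj M S)"
  "monoid.mult (obj (with_mult_one M m e) S) = m S"
  "\<one>\<^bsub>obj (with_mult_one M m e) S\<^esub> = e S"
  "arr (with_mult_one M m e) = arr M"
  by (simp_all add: with_mult_one_def)

lemma internal_Hom_simps [simp]:
  "carrier (obj (internal_Hom R M M') S) = lin_Hom_over R S M M'"
  "t \<oplus>\<^bsub>obj (internal_Hom R M M') S\<^esub> u =
     family_over R S (\<lambda>T \<phi>. \<lambda>x\<in>carrier (obj M T). t T \<phi> x \<oplus>\<^bsub>obj M' T\<^esub> u T \<phi> x)"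
  "s \<odot>\<^bsub>obj (internal_Hom R M M') S\<^esub> t =
     family_over R S (\<lambda>T \<phi>. \<lambda>x\<in>carrier (obj M T). \<phi> s \<odot>\<^bsub>obj M' T\<^esub> t T \<phi> x)"
  "arr (internal_Hom R M M') = restrict_family R"
  by (simp_all add: internal_Hom_def pointwise_module_def)

lemma restrict_family_apply:
  "alg_over R S' T \<phi> \<Longrightarrow> restrict_family R S S' h t T \<phi> = t T (compose (carrier S) \<phi> h)"
  by (simp add: restrict_family_def)

section \<open>Duals and reflexivity\<close>

context coordinates
begin

abbreviation dual_coord :: "'u alg \<Rightarrow> ('u, 'x, 'u) family \<Rightarrow> 'u \<Rightarrow> 'u" where
  "dual_coord S y j \<equiv> y S (id_hom S) (unit S j)"

text \<open>The converse of \<open>expansion\<close>: \<open>w\<close> sends \<open>x\<close> to the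
  sum of its coordinates times the base changes of the \<open>q j\<close>. The sum is finite because
  the support of \<open>x\<close> belongs to \<open>perp\<close>, on whose members \<open>q\<close>
  is nonzero finitely often.\<close>

lemma linear_combination:
  assumes Q: "module_functor R Q" and S: "algebra R S" and q: "q \<in> J \<rightarrow> carrier (obj Q S)"
    and fin: "\<And>K. K \<in> perp \<Longrightarrow> finite {j \<in> J \<inter> K. q j \<noteq> \<zero>\<^bsub>obj Q S\<^esub>}"
  shows "\<exists>w. natural_linear R S L Q w \<and> (\<forall>j\<in>J. w S (id_hom S) (unit S j) = q j)"
proof -
  \<comment> \<open>Vanishing of \<open>q j\<close> is tested over \<open>S\<close> once for all, so
    the index set can only shrink under base change.\<close>
  define supp where "supp = (\<lambda>T x. {j \<in> J. q j \<noteq> \<zero>\<^bsub>obj Q S\<^esub> \<and> c T x j \<noteq> \<zero>\<^bsub>T\<^esub>})"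
  define f where "f = (\<lambda>T \<phi> x j. c T x j \<odot>\<^bsub>obj Q T\<^esub> arr Q S T \<phi> (q j))"
  define w where "w = (\<lambda>T \<phi> x. finsum (obj Q T) (f T \<phi> x) (supp T x))"
  have fin': "finite (supp T x)" if "alg_over R S T \<phi>" "x \<in> carrier (obj L T)" for T \<phi> x
    unfolding supp_def
    by (rule finite_subset[OF _ fin[OF perp_support[OF alg_overD(1)[OF that(1)] that(2)]]]) auto
  have supp_J: "supp T x \<subseteq> J" for T x by (auto simp: supp_def)
  have qT: "arr Q S T \<phi> (q j) \<in> carrier (obj Q T)" if "alg_over R S T \<phi>" "j \<in> J" for T \<phi> j
    using module_functorD(3)[OF Q S alg_overD[OF that(1)] funcset_mem[OF q that(2)]] .
  have f_in: "f T \<phi> x j \<in> carrier (obj Q T)"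
    if "alg_over R S T \<phi>" "x \<in> carrier (obj L T)" "j \<in> J" for T \<phi> x j
    unfolding f_def
    by (rule module.smult_closed[OF module_functorD(1)[OF Q alg_overD(1)[OF that(1)]]
          c_closed[OF alg_overD(1)[OF that(1)] that(2,3)] qT[OF that(1,3)]])
  \<comment> \<open>The support varies with \<open>x\<close>; comparing the sums for two vectors and
    for their sum takes a common larger index set.\<close>
  have alt: "w T \<phi> x = finsum (obj Q T) (f T \<phi> x) B"
    if T: "alg_over R S T \<phi>" and x: "x \<in> carrier (obj L T)" and B: "finite B" "B \<subseteq> J" "supp T x \<subseteq> B"
    for T \<phi> x B
  proof -
    interpret Q: module T "obj Q T" by (rule module_functorD(1)[OF Q alg_overD(1)[OF T]])
    interpret \<phi>: abelian_group_hom "obj Q S" "obj Q T" "arr Q S T \<phi>"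
      by (rule module_functorD(2)[OF Q S alg_overD[OF T]])
    show ?thesis
      unfolding w_def
    proof (rule Q.M.finsum_superset[OF B(1) B(3)])
      show "f T \<phi> x \<in> B \<rightarrow> carrier (obj Q T)"
        by (intro Pi_I f_in[OF T x] subsetD[OF B(2)])
      fix j assume j: "j \<in> B - supp T x"
      then have jJ: "j \<in> J" using B(2) by auto
      with j have "q j = \<zero>\<^bsub>obj Q S\<^esub> \<or> c T x j = \<zero>\<^bsub>T\<^esub>" by (auto simp: supp_def)
      then show "f T \<phi> x j = \<zero>\<^bsub>obj Q T\<^esub>"
        using c_closed[OF alg_overD(1)[OF T] x jJ] qT[OF T jJ] by (auto simp: f_def)
    qed
  qed
  have "natural_linear R S L Q w"
  proof (rule natural_linearI)
    fix T \<phi> x assume T: "alg_over R S T \<phi>" and x: "x \<in> carrier (obj L T)"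
    interpret Q: module T "obj Q T" by (rule module_functorD(1)[OF Q alg_overD(1)[OF T]])
    show "w T \<phi> x \<in> carrier (obj Q T)"
      unfolding w_def by (intro Q.M.finsum_closed Pi_I f_in[OF T x] subsetD[OF supp_J])
  next
    fix T \<phi> x y assume T: "alg_over R S T \<phi>" and x: "x \<in> carrier (obj L T)" and y: "y \<in> carrier (obj L T)"
    note T' = alg_overD[OF T]
    interpret Q: module T "obj Q T" by (rule module_functorD(1)[OF Q T'(1)])
    interpret L: module T "obj L T" by (rule module_functorD(1)[OF is_functor T'(1)])
    have xy: "x \<oplus>\<^bsub>obj L T\<^esub> y \<in> carrier (obj L T)" using x y by simp
    have f_add: "f T \<phi> (x \<oplus>\<^bsub>obj L T\<^esub> y) j = f T \<phi> x j \<oplus>\<^bsub>obj Q T\<^esub> f T \<phi> y j" if "j \<in> J" for j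
      using c_closed[OF T'(1) x that] c_closed[OF T'(1) y that] qT[OF T that]
      by (simp add: f_def c_add[OF T'(1) x y that] Q.smult_l_distr)
    define B where "B = supp T x \<union> supp T y"
    have B: "finite B" "B \<subseteq> J" "supp T x \<subseteq> B" "supp T y \<subseteq> B"
      using fin'[OF T x] fin'[OF T y] supp_J by (auto simp: B_def)
    have "supp T (x \<oplus>\<^bsub>obj L T\<^esub> y) \<subseteq> B"
      using c_add[OF T'(1) x y] by (auto simp: B_def supp_def)
    then have "w T \<phi> (x \<oplus>\<^bsub>obj L T\<^esub> y) = finsum (obj Q T) (f T \<phi> (x \<oplus>\<^bsub>obj L T\<^esub> y)) B"
      by (rule alt[OF T xy B(1,2)])
    also have "\<dots> = finsum (obj Q T) (\<lambda>j. f T \<phi> x j \<oplus>\<^bsub>obj Q T\<^esub> f T \<phi> y j) B"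
      by (intro Q.M.finsum_cong' refl Pi_I Q.M.add.m_closed f_in[OF T x] f_in[OF T y] f_add subsetD[OF B(2)])
    also have "\<dots> = w T \<phi> x \<oplus>\<^bsub>obj Q T\<^esub> w T \<phi> y"
      unfolding alt[OF T x B(1-3)] alt[OF T y B(1,2,4)]
      by (intro Q.M.finsum_addf Pi_I f_in[OF T x] f_in[OF T y] subsetD[OF B(2)])
    finally show "w T \<phi> (x \<oplus>\<^bsub>obj L T\<^esub> y) = w T \<phi> x \<oplus>\<^bsub>obj Q T\<^esub> w T \<phi> y" .
  next
    fix T \<phi> t x assume T: "alg_over R S T \<phi>" and t: "t \<in> carrier T" and x: "x \<in> carrier (obj L T)"
    note T' = alg_overD[OF T]
    interpret Q: module T "obj Q T" by (rule module_functorD(1)[OF Q T'(1)])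
    interpret L: module T "obj L T" by (rule module_functorD(1)[OF is_functor T'(1)])
    interpret t: abelian_group_hom "obj Q T" "obj Q T" "\<lambda>y. t \<odot>\<^bsub>obj Q T\<^esub> y"
      by (rule module_smult_hom[OF Q.module_axioms t])
    have tx: "t \<odot>\<^bsub>obj L T\<^esub> x \<in> carrier (obj L T)" using t x by simp
    have f_smult: "f T \<phi> (t \<odot>\<^bsub>obj L T\<^esub> x) j = t \<odot>\<^bsub>obj Q T\<^esub> f T \<phi> x j" if "j \<in> J" for j
      using c_closed[OF T'(1) x that] qT[OF T that] t
      by (simp add: f_def c_smult[OF T'(1) t x that] Q.smult_assoc1)
    note B = fin'[OF T x] supp_J[of T x] subset_refl[of "supp T x"]
    have "supp T (t \<odot>\<^bsub>obj L T\<^esub> x) \<subseteq> supp T x"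
      using c_smult[OF T'(1) t x] t by (auto simp: supp_def)
    then have "w T \<phi> (t \<odot>\<^bsub>obj L T\<^esub> x) = finsum (obj Q T) (f T \<phi> (t \<odot>\<^bsub>obj L T\<^esub> x)) (supp T x)"
      by (rule alt[OF T tx B(1,2)])
    also have "\<dots> = finsum (obj Q T) (\<lambda>j. t \<odot>\<^bsub>obj Q T\<^esub> f T \<phi> x j) (supp T x)"
      by (intro Q.M.finsum_cong' refl Pi_I Q.smult_closed t f_in[OF T x] f_smult subsetD[OF B(2)])
    also have "\<dots> = t \<odot>\<^bsub>obj Q T\<^esub> w T \<phi> x"
      unfolding alt[OF T x B]
      by (intro t.hom_finsum[symmetric] B(1) Pi_I f_in[OF T x] subsetD[OF B(2)])
    finally show "w T \<phi> (t \<odot>\<^bsub>obj L T\<^esub> x) = t \<odot>\<^bsub>obj Q T\<^esub> w T \<phi> x" .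
  next
    fix T \<phi> U h x assume T: "alg_over R S T \<phi>" and U: "alg_over R T U h" and x: "x \<in> carrier (obj L T)"
    note T' = alg_overD[OF T] and U' = alg_overD[OF U] and SU = alg_over_compose[OF S T U]
    interpret QU: module U "obj Q U" by (rule module_functorD(1)[OF Q U'(1)])
    interpret h: abelian_group_hom "obj Q T" "obj Q U" "arr Q T U h"
      by (rule module_functorD(2)[OF Q T'(1) U'])
    have hx: "arr L T U h x \<in> carrier (obj L U)"
      using module_functorD(3)[OF is_functor T'(1) U' x] .
    have f_arr: "f U (compose (carrier S) h \<phi>) (arr L T U h x) j = arr Q T U h (f T \<phi> x j)" if "j \<in> J" for j
      using module_functorD(4)[OF Q T'(1) U' c_closed[OF T'(1) x that] qT[OF T that]]
        module_functorD(6)[OF Q S T'(1) U'(1) T'(2) U'(2) funcset_mem[OF q that]]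
      by (simp add: f_def c_arr[OF T'(1) U' x that])
    note B = fin'[OF T x] supp_J[of T x] subset_refl[of "supp T x"]
    have "supp U (arr L T U h x) \<subseteq> supp T x"
      using c_arr[OF T'(1) U' x] alg_hom_zero[OF T'(1) U'] by (auto simp: supp_def)
    then have "w U (compose (carrier S) h \<phi>) (arr L T U h x) =
        finsum (obj Q U) (f U (compose (carrier S) h \<phi>) (arr L T U h x)) (supp T x)"
      by (rule alt[OF SU hx B(1,2)])
    also have "\<dots> = finsum (obj Q U) (\<lambda>j. arr Q T U h (f T \<phi> x j)) (supp T x)"
      by (intro QU.M.finsum_cong' refl Pi_I h.hom_closed f_in[OF T x] f_arr subsetD[OF B(2)])
    also have "\<dots> = arr Q T U h (w T \<phi> x)"
      unfolding alt[OF T x B]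
      by (intro h.hom_finsum[symmetric] B(1) Pi_I f_in[OF T x] subsetD[OF B(2)])
    finally show "w U (compose (carrier S) h \<phi>) (arr L T U h x) = arr Q T U h (w T \<phi> x)" .
  qed
  moreover have "w S (id_hom S) (unit S j) = q j" if j: "j \<in> J" for j
  proof -
    interpret Q: module S "obj Q S" by (rule module_functorD(1)[OF Q S])
    note qj = funcset_mem[OF q j]
    have "w S (id_hom S) (unit S j) = finsum (obj Q S) (f S (id_hom S) (unit S j)) {j}"
      using j unit[OF S] by (intro alt[OF alg_over_id[OF S]]) (auto simp: supp_def split: if_splits)
    also have "\<dots> = f S (id_hom S) (unit S j) j"
      using Q.M.finsum_insert[of "{}" j "f S (id_hom S) (unit S j)"] f_in[OF alg_over_id[OF S] unit(1)[OF S] j]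
      by simp
    also have "\<dots> = q j"
      using unit(2)[OF S j, of j] module_functorD(5)[OF Q S qj] qj by (simp add: f_def)
    finally show ?thesis .
  qed
  ultimately show ?thesis by blast
qed

text \<open>The values of a linear form at units determine it by
  \<open>natural_linear_unique\<close>, are nonzero finitely often on members of \<open>perp\<close>
  by \<open>expansion\<close>, and are otherwise arbitrary by
  \<open>linear_combination\<close>.\<close>

lemma dual_coordinates:
  assumes A: "A = with_mult_one (dual_functor R L) m e" and AF: "module_functor R A"
  shows "coordinates R A J perp dual_coord"
proof (rule coordinates.intro)
  have obj [simp]: "carrier (obj A S) = lin_Hom_over R S L base_functor" for S
    by (simp add: A dual_functor_def)
  note base_target = linear_target_base[OF universe base]
  note nl = lin_Hom_over_natural_linear[of _ R _ L base_functor]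
  fix S :: "'u alg" assume S: "algebra R S"
  note id = alg_over_id[OF S]
  show "y S (id_hom S) (unit S j) \<in> carrier S" if "y \<in> carrier (obj A S)" for y j
    using natural_linearD(1)[OF nl id unit(1)[OF S]] that by simp
  show "dual_coord S (y \<oplus>\<^bsub>obj A S\<^esub> z) j = dual_coord S y j \<oplus>\<^bsub>S\<^esub> dual_coord S z j" for y z j
    using id unit(1)[OF S] by (simp add: A dual_functor_def)
  show "dual_coord S (s \<odot>\<^bsub>obj A S\<^esub> y) j = s \<otimes>\<^bsub>S\<^esub> dual_coord S y j" if "s \<in> carrier S" for s y j
    using id unit(1)[OF S] that by (simp add: A dual_functor_def)
  show "dual_coord T (arr A S T h y) j = h (dual_coord S y j)"
    if T: "algebra R T" and h: "h \<in> alg_hom R S T" and y: "y \<in> carrier (obj A S)" and j: "j \<in> J" for T h y j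
  proof -
    have over: "alg_over R S T h" using T h by (simp add: alg_over_def)
    have "dual_coord T (arr A S T h y) j = y T h (unit T j)"
      using alg_over_id[OF T] h
      by (simp add: A dual_functor_def restrict_family_apply compose_id_hom_left)
    also have "\<dots> = h (dual_coord S y j)"
      using natural_linear_unit[OF nl S over j] y by simp
    finally show ?thesis .
  qed
  show "y = z" if "y \<in> carrier (obj A S)" "z \<in> carrier (obj A S)"
    "\<And>j. j \<in> J \<Longrightarrow> dual_coord S y j = dual_coord S z j" for y z
  proof (rule lin_Hom_over_eqI)
    show y: "y \<in> lin_Hom_over R S L base_functor" and z: "z \<in> lin_Hom_over R S L base_functor"
      using that by simp_all
    fix T \<phi> x assume "alg_over R S T \<phi>" "x \<in> carrier (obj L T)"
    then show "y T \<phi> x = z T \<phi> x"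
      using natural_linear_unique[OF base_target nl[OF y] nl[OF z] S that(3)] by blast
  qed
  show "finite {j \<in> J \<inter> K. dual_coord S y j \<noteq> \<zero>\<^bsub>S\<^esub>}" if "y \<in> carrier (obj A S)" "K \<in> perp" for y K
  proof -
    have "finite {j \<in> K. dual_coord S y j \<noteq> \<zero>\<^bsub>S\<^esub>}"
      using expansion(1)[OF base_target nl S that(2)] that(1) by simp
    then show ?thesis by (rule rev_finite_subset) auto
  qed
  show "\<exists>y\<in>carrier (obj A S). \<forall>j\<in>J. dual_coord S y j = d j"
    if d: "d \<in> J \<rightarrow> carrier S" and fin: "\<And>K. K \<in> perp \<Longrightarrow> finite {j \<in> J \<inter> K. d j \<noteq> \<zero>\<^bsub>S\<^esub>}" for d
  proof -
    obtain w where w: "natural_linear R S L base_functor w" "\<forall>j\<in>J. w S (id_hom S) (unit S j) = d j"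
      using linear_combination[OF module_functor_base[OF base] S, of d] d fin by auto
    show ?thesis
      using lin_Hom_overI[OF is_functor S w(1)] w(2) unit(1)[OF S] id
      by (intro bexI[of _ "family_over R S (\<lambda>T \<phi>. \<lambda>x\<in>carrier (obj L T). w T \<phi> x)"]) auto
  qed
qed (use universe base AF in auto)

text \<open>The values of \<open>w\<close> at the dual units are taken as the coordinates of
  \<open>F\<close>. They are nonzero finitely often on each member of \<open>\<K>\<close>, because
  its trace on \<open>J\<close> is orthogonal to \<open>perp\<close>. Then \<open>w\<close> and
  evaluation at \<open>F\<close> agree at the dual units, hence everywhere.\<close>

lemma reflexive:
  assumes A: "A = with_mult_one (dual_functor R L) m e" and AF: "module_functor R A"
    and S: "algebra R S" and w: "natural_linear R S A base_functor w"
  obtains F where "F \<in> carrier (obj L S)"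
    "\<And>T \<phi> y. alg_over R S T \<phi> \<Longrightarrow> y \<in> carrier (obj A T) \<Longrightarrow>
       w T \<phi> y = y T (id_hom T) (arr L S T \<phi> F)"
proof -
  interpret D: coordinates R A J perp dual_coord
    by (rule dual_coordinates[OF A AF])
  interpret S: cring S using S by (rule algebra_cring)
  note base_target = linear_target_base[OF universe base]
  have obj [simp]: "carrier (obj A S) = lin_Hom_over R S L base_functor" for S
    by (simp add: A dual_functor_def)
  note nl = lin_Hom_over_natural_linear[of _ R _ L base_functor]
  note id = alg_over_id[OF S]
  define d where "d = (\<lambda>j. w S (id_hom S) (D.unit S j))"
  have "\<exists>F\<in>carrier (obj L S). \<forall>j\<in>J. c S F j = d j"
  proof (rule c_surj[OF S])
    show "d \<in> J \<rightarrow> carrier S"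
      using natural_linearD(1)[OF w id D.unit(1)[OF S]] by (simp add: d_def)
    fix K assume "K \<in> \<K>"
    then have "J \<inter> K \<in> D.perp"
      unfolding D.perp_def by (auto simp: perp_def intro: rev_finite_subset)
    from D.expansion(1)[OF base_target w S this]
    show "finite {j \<in> J \<inter> K. d j \<noteq> \<zero>\<^bsub>S\<^esub>}" by (simp add: d_def)
  qed
  then obtain F where F: "F \<in> carrier (obj L S)" and cF: "\<And>j. j \<in> J \<Longrightarrow> c S F j = d j" by blast
  define v :: "('u, ('u, 'x, 'u) family, 'u) family"
    where "v = (\<lambda>T \<phi> y. y T (id_hom T) (arr L S T \<phi> F))"
  have arrF: "arr L S T \<phi> F \<in> carrier (obj L T)" if "alg_over R S T \<phi>" for T \<phi>
    using module_functorD(3)[OF is_functor S _ _ F] alg_overD[OF that] .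
  have v: "natural_linear R S A base_functor v"
  proof (rule natural_linearI)
    fix T \<phi> assume T: "alg_over R S T \<phi>"
    note idT = alg_over_id[OF alg_overD(1)[OF T]]
    show "v T \<phi> y \<in> carrier (obj base_functor T)" if "y \<in> carrier (obj A T)" for y
      using natural_linearD(1)[OF nl idT arrF[OF T]] that by (simp add: v_def)
    show "v T \<phi> (y \<oplus>\<^bsub>obj A T\<^esub> z) = v T \<phi> y \<oplus>\<^bsub>obj base_functor T\<^esub> v T \<phi> z" for y z
      using idT arrF[OF T] by (simp add: v_def A dual_functor_def)
    show "v T \<phi> (t \<odot>\<^bsub>obj A T\<^esub> y) = t \<odot>\<^bsub>obj base_functor T\<^esub> v T \<phi> y" if "t \<in> carrier T" for t y
      using idT arrF[OF T] that by (simp add: v_def A dual_functor_def)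
    fix U h y assume U: "alg_over R T U h" and y: "y \<in> carrier (obj A T)"
    note T' = alg_overD[OF T] and U' = alg_overD[OF U]
    have "v U (compose (carrier S) h \<phi>) (arr A T U h y) =
        y U h (arr L T U h (arr L S T \<phi> F))"
      using alg_over_id[OF U'(1)] module_functorD(6)[OF is_functor S T'(1) U'(1) T'(2) U'(2) F]
      by (simp add: v_def A dual_functor_def restrict_family_apply compose_id_hom_left[OF U'(2)])
    also have "\<dots> = h (y T (id_hom T) (arr L S T \<phi> F))"
      using natural_linearD(4)[OF nl idT U arrF[OF T]] y compose_id_hom_right[OF U'(2)] by simp
    finally show "v U (compose (carrier S) h \<phi>) (arr A T U h y) = arr base_functor T U h (v T \<phi> y)"
      by (simp add: v_def)
  qed
  have eq: "w S (id_hom S) (D.unit S j) = v S (id_hom S) (D.unit S j)" if j: "j \<in> J" for j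
  proof -
    have y: "D.unit S j \<in> lin_Hom_over R S L base_functor" using D.unit(1)[OF S] by simp
    have coord: "dual_coord S (D.unit S j) i = (if i = j then \<one>\<^bsub>S\<^esub> else \<zero>\<^bsub>S\<^esub>)" if "i \<in> J" for i
      using D.unit(2)[OF S that] .
    let ?K = "{j \<in> J. c S F j \<noteq> \<zero>\<^bsub>S\<^esub>}"
    \<comment> \<open>The dual unit is the form that reads off the coordinate of index
      \<open>j\<close>: in its expansion over the support of \<open>F\<close> only the term at
      \<open>j\<close> can survive.\<close>
    have "D.unit S j S (id_hom S) F = finsum (obj base_functor S)
        (\<lambda>i. c S F i \<odot>\<^bsub>obj base_functor S\<^esub> dual_coord S (D.unit S j) i) {j}"
      using j coord by (intro expansion(2)[OF base_target nl[OF y] S perp_support[OF S F] id F])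
        (auto split: if_splits)
    also have "\<dots> = finsum (self_module S) (\<lambda>i. d i) {j}"
    proof -
      interpret SM: abelian_group "self_module S"
        using module_abelian_group[OF module_self_module[OF S.is_cring]] .
      show ?thesis unfolding base_functor_simps using coord j cF natural_linearD(1)[OF w id D.unit(1)[OF S]]
        by (intro SM.finsum_cong') (auto simp: d_def)
    qed
    also have "\<dots> = d j"
    proof -
      interpret SM: abelian_group "self_module S"
        using module_abelian_group[OF module_self_module[OF S.is_cring]] .
      have "d j \<in> carrier (self_module S)"
        using natural_linearD(1)[OF w id D.unit(1)[OF S]] by (simp add: d_def)
      then show ?thesis
        using SM.finsum_insert[of "{}" j d] by simp
    qed
    finally show ?thesis
      using module_functorD(5)[OF is_functor S F] by (simp add: v_def d_def)
  qed
  show thesis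
  proof (rule that[OF F])
    fix T \<phi> y assume "alg_over R S T \<phi>" "y \<in> carrier (obj A T)"
    then show "w T \<phi> y = y T (id_hom T) (arr L S T \<phi> F)"
      using D.natural_linear_unique[OF base_target w v S eq] by (simp add: v_def)
  qed
qed

lemma natural_linear_unique_coordinates:
  assumes Q: "coordinates R Q J' \<K>' c'" and w: "natural_linear R S L Q w" and v: "natural_linear R S L Q v"
    and S: "algebra R S" and eq: "\<And>j. j \<in> J \<Longrightarrow> w S (id_hom S) (unit S j) = v S (id_hom S) (unit S j)"
    and T: "alg_over R S T \<phi>" and x: "x \<in> carrier (obj L T)"
  shows "w T \<phi> x = v T \<phi> x"
proof -
  interpret Q: coordinates R Q J' \<K>' c' by (rule Q)
  show ?thesis
  proof (rule Q.c_inj[OF alg_overD(1)[OF T] natural_linearD(1)[OF w T x] natural_linearD(1)[OF v T x]])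
    fix j assume "j \<in> J'"
    note c' = Q.coordinate_natural_linear[OF S this]
    show "c' T (w T \<phi> x) j = c' T (v T \<phi> x) j"
      by (rule natural_linear_unique[OF linear_target_base[OF universe base]
            natural_linear_compose[OF w c'] natural_linear_compose[OF v c'] S _ T x])
        (simp add: eq)
  qed
qed

end

section \<open>Coordinates on an essentially free module\<close>

lemma lim_free_functor_simps [simp]:
  "carrier (obj (lim_free_functor P) S) = {c \<in> (\<Pi>\<^sub>E \<alpha>\<in>P. carrier (obj (free_functor \<alpha>) S)).
      \<forall>\<alpha>\<in>P. \<forall>\<beta>\<in>P. \<alpha> \<subseteq> \<beta> \<longrightarrow> restrict (c \<beta>) \<alpha> = c \<alpha>}"
  "x \<oplus>\<^bsub>obj (lim_free_functor P) S\<^esub> y = (\<lambda>\<alpha>\<in>P. x \<alpha> \<oplus>\<^bsub>obj (free_functor \<alpha>) S\<^esub> y \<alpha>)"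
  "s \<odot>\<^bsub>obj (lim_free_functor P) S\<^esub> x = (\<lambda>\<alpha>\<in>P. s \<odot>\<^bsub>obj (free_functor \<alpha>) S\<^esub> x \<alpha>)"
  "arr (lim_free_functor P) S T h x = (\<lambda>\<alpha>\<in>P. arr (free_functor \<alpha>) S T h (x \<alpha>))"
  by (simp_all add: lim_free_functor_def)

text \<open>A compatible family of vectors is a single function on the union of \<open>P\<close>.
  Its value at \<open>j\<close> can be read in any member containing \<open>j\<close>, since two
  members lie in their union, again in \<open>P\<close>. Conversely a function that is finitely
  supported on each member restricts to a compatible family.\<close>

lemma essentially_free_coordinates:
  assumes inf: "infinite (UNIV :: 'u set)" and R: "cring (R :: 'u ring)" and M: "essentially_free R M"
  obtains J \<K> c where "coordinates R M J \<K> c"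
proof -
  obtain P f where P': "\<forall>\<alpha>\<in>P. \<forall>\<beta>\<in>P. \<alpha> \<union> \<beta> \<in> P" and f: "module_morphism R M (lim_free_functor P) f"
    and bij': "\<forall>S. algebra R S \<longrightarrow> bij_betw (f S) (carrier (obj M S)) (carrier (obj (lim_free_functor P) S))"
    using M unfolding essentially_free_def by (elim conjE exE) (rule that)
  note P = bspec[OF bspec[OF P']] and bij = mp[OF spec[OF bij']]
  have MF: "module_functor R M" using M by (simp add: essentially_free_def)
  \<comment> \<open>A chosen member of \<open>P\<close> containing \<open>j\<close>, in which the
    coordinate of index \<open>j\<close> is read.\<close>
  define a where "a = (\<lambda>j. SOME \<alpha>. \<alpha> \<in> P \<and> j \<in> \<alpha>)"
  have a: "a j \<in> P" "j \<in> a j" if "j \<in> \<Union>P" for j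
  proof -
    have "\<exists>\<alpha>. \<alpha> \<in> P \<and> j \<in> \<alpha>" using that by blast
    from someI_ex[OF this] show "a j \<in> P" "j \<in> a j" by (auto simp: a_def)
  qed
  define c where "c = (\<lambda>S x j. f S x (a j) j)"
  have f_in: "f S x \<in> carrier (obj (lim_free_functor P) S)" if "algebra R S" "x \<in> carrier (obj M S)" for S x
    using bij_betw_apply[OF bij[OF that(1)] that(2)] .
  have f_al: "f S x \<alpha> \<in> carrier (obj (free_functor \<alpha>) S)" if "algebra R S" "x \<in> carrier (obj M S)" "\<alpha> \<in> P" for S x \<alpha>
    using f_in[OF that(1,2)] that(3) by (auto simp del: free_functor_simps)
  have c_eq: "f S x \<alpha> j = c S x j" if "algebra R S" "x \<in> carrier (obj M S)" "\<alpha> \<in> P" "j \<in> \<alpha>" for S x \<alpha> j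
  proof -
    have j: "j \<in> \<Union>P" using that by blast
    have r: "restrict (f S x \<beta>) \<gamma> = f S x \<gamma>" if "\<gamma> \<in> P" "\<beta> \<in> P" "\<gamma> \<subseteq> \<beta>" for \<beta> \<gamma>
      using f_in[OF \<open>algebra R S\<close> \<open>x \<in> carrier (obj M S)\<close>] that by (simp del: free_functor_simps)
    have "f S x \<alpha> j = f S x (\<alpha> \<union> a j) j"
      using r[of \<alpha> "\<alpha> \<union> a j"] P[OF that(3) a(1)[OF j]] that(3,4) by (metis Un_upper1 restrict_apply')
    also have "\<dots> = f S x (a j) j"
      using r[of "a j" "\<alpha> \<union> a j"] P[OF that(3) a(1)[OF j]] a[OF j] by (metis Un_upper2 restrict_apply')
    finally show ?thesis by (simp add: c_def)
  qed
  have "coordinates R M (\<Union>P) P c"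
  proof (rule coordinates.intro)
    fix S :: "'u alg" assume S: "algebra R S"
    interpret S: cring S using S by (rule algebra_cring)
    show "c S x j \<in> carrier S" if "x \<in> carrier (obj M S)" "j \<in> \<Union>P" for x j
      using f_al[OF S that(1) a(1)[OF that(2)]] a(2)[OF that(2)] by (auto simp: c_def)
    show "c S (x \<oplus>\<^bsub>obj M S\<^esub> y) j = c S x j \<oplus>\<^bsub>S\<^esub> c S y j"
      if "x \<in> carrier (obj M S)" "y \<in> carrier (obj M S)" "j \<in> \<Union>P" for x y j
    proof -
      have "f S (x \<oplus>\<^bsub>obj M S\<^esub> y) = f S x \<oplus>\<^bsub>obj (lim_free_functor P) S\<^esub> f S y"
        using f S that unfolding module_morphism_def by blast
      then show ?thesis using a[OF that(3)] by (simp add: c_def)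
    qed
    show "c S (s \<odot>\<^bsub>obj M S\<^esub> x) j = s \<otimes>\<^bsub>S\<^esub> c S x j"
      if "s \<in> carrier S" "x \<in> carrier (obj M S)" "j \<in> \<Union>P" for s x j
    proof -
      have "f S (s \<odot>\<^bsub>obj M S\<^esub> x) = s \<odot>\<^bsub>obj (lim_free_functor P) S\<^esub> f S x"
        using f S that unfolding module_morphism_def by blast
      then show ?thesis using a[OF that(3)] by (simp add: c_def)
    qed
    show "c T (arr M S T h x) j = h (c S x j)"
      if "algebra R T" "h \<in> alg_hom R S T" "x \<in> carrier (obj M S)" "j \<in> \<Union>P" for T h x j
    proof -
      have "f T (arr M S T h x) = arr (lim_free_functor P) S T h (f S x)"
        using f S that unfolding module_morphism_def set_morphism_def by blast
      then show ?thesis using a[OF that(4)] by (simp add: c_def free_functor_def)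
    qed
    show "x = y" if x: "x \<in> carrier (obj M S)" and y: "y \<in> carrier (obj M S)"
      and eq: "\<And>j. j \<in> \<Union>P \<Longrightarrow> c S x j = c S y j" for x y
    proof -
      have "f S x \<alpha> = f S y \<alpha>" if "\<alpha> \<in> P" for \<alpha>
      proof (rule PiE_ext)
        show "f S x \<alpha> \<in> \<alpha> \<rightarrow>\<^sub>E carrier S" "f S y \<alpha> \<in> \<alpha> \<rightarrow>\<^sub>E carrier S"
          using f_al[OF S x that] f_al[OF S y that] by simp_all
        show "f S x \<alpha> j = f S y \<alpha> j" if "j \<in> \<alpha>" for j
          using c_eq[OF S x \<open>\<alpha> \<in> P\<close> that] c_eq[OF S y \<open>\<alpha> \<in> P\<close> that] eq \<open>\<alpha> \<in> P\<close> that by auto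
      qed
      moreover have "f S x \<in> extensional P" "f S y \<in> extensional P"
        using f_in[OF S x] f_in[OF S y] by (simp_all add: PiE_iff del: free_functor_simps)
      ultimately have "f S x = f S y" by (intro extensionalityI[of _ P]) auto
      then show ?thesis using bij[OF S] x y by (auto simp: bij_betw_def inj_on_def)
    qed
    show "finite {j \<in> \<Union>P \<inter> K. c S x j \<noteq> \<zero>\<^bsub>S\<^esub>}" if "x \<in> carrier (obj M S)" "K \<in> P" for x K
    proof -
      have "finite {j \<in> K. f S x K j \<noteq> \<zero>\<^bsub>S\<^esub>}" using f_al[OF S that] by simp
      then show ?thesis
        by (rule rev_finite_subset) (auto simp: c_eq[OF S that])
    qed
    show "\<exists>x\<in>carrier (obj M S). \<forall>j\<in>\<Union>P. c S x j = d j"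
      if d: "d \<in> \<Union>P \<rightarrow> carrier S" and fin: "\<And>K. K \<in> P \<Longrightarrow> finite {j \<in> \<Union>P \<inter> K. d j \<noteq> \<zero>\<^bsub>S\<^esub>}" for d
    proof -
      let ?d = "\<lambda>\<alpha>\<in>P. restrict d \<alpha>"
      have "restrict d \<alpha> \<in> carrier (obj (free_functor \<alpha>) S)" if "\<alpha> \<in> P" for \<alpha>
      proof -
        have "finite {i \<in> \<alpha>. restrict d \<alpha> i \<noteq> \<zero>\<^bsub>S\<^esub>}"
          using fin[OF that] by (rule rev_finite_subset) (use that in auto)
        then show ?thesis using d that by auto
      qed
      then have "?d \<in> carrier (obj (lim_free_functor P) S)"
        by (auto simp del: free_functor_simps simp: Int_absorb1)
      then obtain x where x: "x \<in> carrier (obj M S)" "f S x = ?d"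
        using bij[OF S] by (metis bij_betw_imp_surj_on imageE)
      then show ?thesis using a by (intro bexI[of _ x]) (auto simp: c_def)
    qed
  qed (use inf R MF in auto)
  then show thesis by (rule that)
qed

section \<open>Actions of the dual algebra\<close>

lemma function_functor_simps [simp]:
  "carrier (obj (function_functor R G) S) = Hom_over R S G base_functor"
  "arr (function_functor R G) = restrict_family R"
  by (simp_all add: function_functor_def pointwise_module_def)

lemma dual_algebraD:
  assumes "dual_algebra R G A"
  obtains m e where "A = with_mult_one (dual_functor R (function_functor R G)) m e"
    and "algebra_functor R A" "module_functor R A" "monoid_morphism R G A (evaluation R G)"
  using assms unfolding dual_algebra_def algebra_functor_def by blast

lemma evaluation_closed:
  assumes "dual_algebra R G A" "algebra R S" "g \<in> carrier (obj G S)"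
  shows "evaluation R G S g \<in> carrier (obj A S)"
proof -
  have "set_morphism R G A (evaluation R G)"
    using assms(1) unfolding dual_algebra_def monoid_morphism_def by blast
  then show ?thesis using assms(2,3) unfolding set_morphism_def by blast
qed

lemma evaluation_natural:
  assumes "dual_algebra R G A" "algebra R S" "algebra R T" "h \<in> alg_hom R S T" "g \<in> carrier (obj G S)"
  shows "evaluation R G T (arr G S T h g) = arr A S T h (evaluation R G S g)"
proof -
  have "set_morphism R G A (evaluation R G)"
    using assms(1) unfolding dual_algebra_def monoid_morphism_def by blast
  then show ?thesis using assms(2-) unfolding set_morphism_def by blast
qed

text \<open>Both sides read the same component of the family \<open>F\<close>: restriction to
  \<open>T\<close> along \<open>\<phi>\<close>, taken at the identity of \<open>T\<close>, is the
  component at \<open>\<phi>\<close>.\<close>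

lemma evaluation_restrict:
  assumes G: "set_functor R G" and S: "algebra R S" and T: "alg_over R S T \<phi>"
    and F: "F \<in> carrier (obj (function_functor R G) S)" and g: "g \<in> carrier (obj G T)"
    and FT: "arr (function_functor R G) S T \<phi> F \<in> carrier (obj (function_functor R G) T)"
  shows "evaluation R G T g T (id_hom T) (arr (function_functor R G) S T \<phi> F) = F T \<phi> g"
proof -
  note T' = alg_overD[OF T]
  have "arr G T T (id_hom T) g = g"
    using G T'(1) g unfolding set_functor_def by blast
  moreover have "restrict_family R S T \<phi> F T (id_hom T) = F T \<phi>"
    using alg_over_id[OF T'(1)] compose_id_hom_left[OF T'(2)] by (simp add: restrict_family_apply)
  ultimately show ?thesis
    using alg_over_id[OF T'(1)] FT by (simp add: evaluation_def)
qed

text \<open>By reflexivity the evaluations at points of \<open>G\<close> separate linear forms on the dual.\<close>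

lemma evaluation_dense:
  assumes G: "set_functor R G" and c: "coordinates R (function_functor R G) J \<K> c"
    and A: "dual_algebra R G A" and S: "algebra R S"
    and w: "natural_linear R S A base_functor w" and v: "natural_linear R S A base_functor v"
    and eq: "\<And>T \<phi> g. alg_over R S T \<phi> \<Longrightarrow> g \<in> carrier (obj G T) \<Longrightarrow>
      w T \<phi> (evaluation R G T g) = v T \<phi> (evaluation R G T g)"
    and T: "alg_over R S T \<phi>" and y: "y \<in> carrier (obj A T)"
  shows "w T \<phi> y = v T \<phi> y"
proof -
  interpret coordinates R "function_functor R G" J \<K> c by (rule c)
  obtain m e where Adef: "A = with_mult_one (dual_functor R (function_functor R G)) m e"
    and AF: "module_functor R A" using dual_algebraD[OF A] by blast
  obtain F where F: "F \<in> carrier (obj (function_functor R G) S)" and wF: "\<And>T \<phi> y. alg_over R S T \<phi> \<Longrightarrow>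
      y \<in> carrier (obj A T) \<Longrightarrow> w T \<phi> y = y T (id_hom T) (arr (function_functor R G) S T \<phi> F)"
    using reflexive[OF Adef AF S w] by blast
  obtain F' where F': "F' \<in> carrier (obj (function_functor R G) S)" and vF: "\<And>T \<phi> y. alg_over R S T \<phi> \<Longrightarrow>
      y \<in> carrier (obj A T) \<Longrightarrow> v T \<phi> y = y T (id_hom T) (arr (function_functor R G) S T \<phi> F')"
    using reflexive[OF Adef AF S v] by blast
  \<comment> \<open>A function on \<open>G\<close> is a family of maps on points, so agreement of
    \<open>w\<close> and \<open>v\<close> at all evaluations over all \<open>T\<close> is equality
    of the representing functions.\<close>
  have "F = F'"
  proof (rule family_eqI)
    show "F = family_over R S F" "F' = family_over R S F'"
      using F F' Hom_overD(1) by auto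
    fix T \<phi> assume T: "alg_over R S T \<phi>"
    note T' = alg_overD[OF T]
    have ext: "F T \<phi> \<in> carrier (obj G T) \<rightarrow>\<^sub>E carrier (obj base_functor T)"
      "F' T \<phi> \<in> carrier (obj G T) \<rightarrow>\<^sub>E carrier (obj base_functor T)"
      by (rule Hom_overD(2)[OF _ T], use F F' in simp)+
    show "F T \<phi> = F' T \<phi>"
    proof (rule PiE_ext[OF ext])
      fix g assume g: "g \<in> carrier (obj G T)"
      note ev = evaluation_closed[OF A T'(1) g]
      have closed: "arr (function_functor R G) S T \<phi> H \<in> carrier (obj (function_functor R G) T)"
        if "H \<in> carrier (obj (function_functor R G) S)" for H
        using module_functorD(3)[OF is_functor S T' that] .
      show "F T \<phi> g = F' T \<phi> g"
        using eq[OF T g] wF[OF T ev] vF[OF T ev]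
          evaluation_restrict[OF G S T F g closed[OF F]]
          evaluation_restrict[OF G S T F' g closed[OF F']] by simp
    qed
  qed
  then show ?thesis using wF[OF T y] vF[OF T y] by simp
qed

text \<open>Reduces to scalar forms by treating one coordinate of the target at a time.\<close>

lemma evaluation_dense_coordinates:
  assumes G: "set_functor R G" and c: "coordinates R (function_functor R G) J \<K> c"
    and A: "dual_algebra R G A" and S: "algebra R S" and Q: "coordinates R Q J' \<K>' c'"
    and w: "natural_linear R S A Q w" and v: "natural_linear R S A Q v"
    and eq: "\<And>T \<phi> g. alg_over R S T \<phi> \<Longrightarrow> g \<in> carrier (obj G T) \<Longrightarrow>
      w T \<phi> (evaluation R G T g) = v T \<phi> (evaluation R G T g)"
    and T: "alg_over R S T \<phi>" and y: "y \<in> carrier (obj A T)"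
  shows "w T \<phi> y = v T \<phi> y"
proof -
  interpret Q: coordinates R Q J' \<K>' c' by (rule Q)
  show ?thesis
  proof (rule Q.c_inj[OF alg_overD(1)[OF T] natural_linearD(1)[OF w T y] natural_linearD(1)[OF v T y]])
    fix j assume "j \<in> J'"
    note c' = Q.coordinate_natural_linear[OF S this]
    show "c' T (w T \<phi> y) j = c' T (v T \<phi> y) j"
      by (rule evaluation_dense[OF G c A S natural_linear_compose[OF w c'] natural_linear_compose[OF v c'] _ T y])
        (simp add: eq)
  qed
qed

section \<open>Actions given by natural endomorphisms\<close>

lemma End_functor_simps [simp]:
  "carrier (obj (End_functor R M) S) = lin_Hom_over R S M M"
  "t \<oplus>\<^bsub>obj (End_functor R M) S\<^esub> u =
     family_over R S (\<lambda>T \<phi>. \<lambda>x\<in>carrier (obj M T). t T \<phi> x \<oplus>\<^bsub>obj M T\<^esub> u T \<phi> x)"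
  "s \<odot>\<^bsub>obj (End_functor R M) S\<^esub> t =
     family_over R S (\<lambda>T \<phi>. \<lambda>x\<in>carrier (obj M T). \<phi> s \<odot>\<^bsub>obj M T\<^esub> t T \<phi> x)"
  "t \<otimes>\<^bsub>obj (End_functor R M) S\<^esub> u =
     family_over R S (\<lambda>T \<phi>. compose (carrier (obj M T)) (t T \<phi>) (u T \<phi>))"
  "\<one>\<^bsub>obj (End_functor R M) S\<^esub> = family_over R S (\<lambda>T \<phi>. \<lambda>x\<in>carrier (obj M T). x)"
  "arr (End_functor R M) = restrict_family R"
  by (simp_all add: End_functor_def)

text \<open>Naturality of \<open>\<sigma>\<close> recovers the whole endomorphism
  \<open>\<sigma> S a\<close> from actions on points: its component at \<open>h\<close> is the
  action of the image of \<open>a\<close> under \<open>h\<close>. Working with \<open>act\<close>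
  thus loses no information.\<close>

lemma act_set_morphism:
  assumes M: "module_functor R M" and \<sigma>: "set_morphism R F (End_functor R M) \<sigma>"
  shows "algebra R S \<Longrightarrow> a \<in> carrier (obj F S) \<Longrightarrow> \<sigma> S a \<in> lin_Hom_over R S M M"
    and "algebra R S \<Longrightarrow> a \<in> carrier (obj F S) \<Longrightarrow> x \<in> carrier (obj M S) \<Longrightarrow>
      act \<sigma> S a x \<in> carrier (obj M S)"
    and "algebra R S \<Longrightarrow> a \<in> carrier (obj F S) \<Longrightarrow> x \<in> carrier (obj M S) \<Longrightarrow> y \<in> carrier (obj M S) \<Longrightarrow>
      act \<sigma> S a (x \<oplus>\<^bsub>obj M S\<^esub> y) = act \<sigma> S a x \<oplus>\<^bsub>obj M S\<^esub> act \<sigma> S a y"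
    and "algebra R S \<Longrightarrow> a \<in> carrier (obj F S) \<Longrightarrow> s \<in> carrier S \<Longrightarrow> x \<in> carrier (obj M S) \<Longrightarrow>
      act \<sigma> S a (s \<odot>\<^bsub>obj M S\<^esub> x) = s \<odot>\<^bsub>obj M S\<^esub> act \<sigma> S a x"
    and "algebra R S \<Longrightarrow> algebra R T \<Longrightarrow> h \<in> alg_hom R S T \<Longrightarrow> a \<in> carrier (obj F S) \<Longrightarrow>
      \<sigma> S a T h = act \<sigma> T (arr F S T h a)"
    and "algebra R S \<Longrightarrow> algebra R T \<Longrightarrow> h \<in> alg_hom R S T \<Longrightarrow> a \<in> carrier (obj F S) \<Longrightarrow>
      x \<in> carrier (obj M S) \<Longrightarrow> act \<sigma> T (arr F S T h a) (arr M S T h x) = arr M S T h (act \<sigma> S a x)"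
proof -
  show lin: "\<sigma> S a \<in> lin_Hom_over R S M M" if "algebra R S" "a \<in> carrier (obj F S)" for S a
    using \<sigma> that unfolding set_morphism_def by auto
  note nl = lin_Hom_over_natural_linear[OF lin]
  show "act \<sigma> S a x \<in> carrier (obj M S)" if "algebra R S" "a \<in> carrier (obj F S)" "x \<in> carrier (obj M S)"
    unfolding act_def by (rule natural_linearD(1)[OF nl[OF that(1,2)] alg_over_id[OF that(1)] that(3)])
  show "act \<sigma> S a (x \<oplus>\<^bsub>obj M S\<^esub> y) = act \<sigma> S a x \<oplus>\<^bsub>obj M S\<^esub> act \<sigma> S a y"
    if "algebra R S" "a \<in> carrier (obj F S)" "x \<in> carrier (obj M S)" "y \<in> carrier (obj M S)"
    unfolding act_def by (rule natural_linearD(2)[OF nl[OF that(1,2)] alg_over_id[OF that(1)] that(3,4)])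
  show "act \<sigma> S a (s \<odot>\<^bsub>obj M S\<^esub> x) = s \<odot>\<^bsub>obj M S\<^esub> act \<sigma> S a x"
    if "algebra R S" "a \<in> carrier (obj F S)" "s \<in> carrier S" "x \<in> carrier (obj M S)"
    unfolding act_def by (rule natural_linearD(3)[OF nl[OF that(1,2)] alg_over_id[OF that(1)] that(3,4)])
  show act: "\<sigma> S a T h = act \<sigma> T (arr F S T h a)"
    if "algebra R S" "algebra R T" "h \<in> alg_hom R S T" "a \<in> carrier (obj F S)" for S a T h
  proof -
    have "\<sigma> T (arr F S T h a) = restrict_family R S T h (\<sigma> S a)"
      using \<sigma> that unfolding set_morphism_def by auto
    then show ?thesis
      using alg_over_id[OF that(2)] compose_id_hom_left[OF that(3)]
      by (intro ext) (simp add: act_def restrict_family_apply)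
  qed
  show "act \<sigma> T (arr F S T h a) (arr M S T h x) = arr M S T h (act \<sigma> S a x)"
    if "algebra R S" "algebra R T" "h \<in> alg_hom R S T" "a \<in> carrier (obj F S)" "x \<in> carrier (obj M S)"
  proof -
    have "alg_over R S T h" using that by (simp add: alg_over_def)
    from natural_linearD(4)[OF nl[OF that(1,4)] alg_over_id[OF that(1)] this that(5)]
    show ?thesis
      using act[OF that(1-4)] compose_id_hom_right[OF that(3)] by (simp add: act_def)
  qed
qed

lemma extends_actionD:
  assumes \<sigma>: "extends_action R G A M \<rho> \<sigma>"
  shows "set_morphism R A (End_functor R M) \<sigma>"
    and "algebra R S \<Longrightarrow> g \<in> carrier (obj G S) \<Longrightarrow> act \<sigma> S (evaluation R G S g) = act \<rho> S g"
    and "algebra R S \<Longrightarrow> a \<in> carrier (obj A S) \<Longrightarrow> b \<in> carrier (obj A S) \<Longrightarrow> x \<in> carrier (obj M S) \<Longrightarrow>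
      act \<sigma> S (a \<oplus>\<^bsub>obj A S\<^esub> b) x = act \<sigma> S a x \<oplus>\<^bsub>obj M S\<^esub> act \<sigma> S b x"
    and "algebra R S \<Longrightarrow> s \<in> carrier S \<Longrightarrow> a \<in> carrier (obj A S) \<Longrightarrow> x \<in> carrier (obj M S) \<Longrightarrow>
      act \<sigma> S (s \<odot>\<^bsub>obj A S\<^esub> a) x = s \<odot>\<^bsub>obj M S\<^esub> act \<sigma> S a x"
    and "algebra R S \<Longrightarrow> a \<in> carrier (obj A S) \<Longrightarrow> b \<in> carrier (obj A S) \<Longrightarrow> x \<in> carrier (obj M S) \<Longrightarrow>
      act \<sigma> S (a \<otimes>\<^bsub>obj A S\<^esub> b) x = act \<sigma> S a (act \<sigma> S b x)"
    and "algebra R S \<Longrightarrow> x \<in> carrier (obj M S) \<Longrightarrow> act \<sigma> S \<one>\<^bsub>obj A S\<^esub> x = x"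
proof -
  have mm: "module_morphism R A (End_functor R M) \<sigma>" and mon: "monoid_morphism R A (End_functor R M) \<sigma>"
    using \<sigma> unfolding extends_action_def algebra_morphism_def by blast+
  show sm: "set_morphism R A (End_functor R M) \<sigma>" using mm unfolding module_morphism_def by blast
  show "act \<sigma> S (evaluation R G S g) = act \<rho> S g" if "algebra R S" "g \<in> carrier (obj G S)"
    using \<sigma> that unfolding extends_action_def by (simp add: act_def fun_eq_iff)
  show "act \<sigma> S (a \<oplus>\<^bsub>obj A S\<^esub> b) x = act \<sigma> S a x \<oplus>\<^bsub>obj M S\<^esub> act \<sigma> S b x"
    if "algebra R S" "a \<in> carrier (obj A S)" "b \<in> carrier (obj A S)" "x \<in> carrier (obj M S)"
  proof -
    have "\<sigma> S (a \<oplus>\<^bsub>obj A S\<^esub> b) = \<sigma> S a \<oplus>\<^bsub>obj (End_functor R M) S\<^esub> \<sigma> S b"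
      using mm that unfolding module_morphism_def by blast
    then show ?thesis using that alg_over_id[OF that(1)] by (simp add: act_def)
  qed
  show "act \<sigma> S (s \<odot>\<^bsub>obj A S\<^esub> a) x = s \<odot>\<^bsub>obj M S\<^esub> act \<sigma> S a x"
    if "algebra R S" "s \<in> carrier S" "a \<in> carrier (obj A S)" "x \<in> carrier (obj M S)"
  proof -
    have "\<sigma> S (s \<odot>\<^bsub>obj A S\<^esub> a) = s \<odot>\<^bsub>obj (End_functor R M) S\<^esub> \<sigma> S a"
      using mm that unfolding module_morphism_def by blast
    then show ?thesis using that alg_over_id[OF that(1)] by (simp add: act_def)
  qed
  have hom: "\<sigma> S \<in> hom (obj A S) (obj (End_functor R M) S)"
    and one: "\<sigma> S \<one>\<^bsub>obj A S\<^esub> = \<one>\<^bsub>obj (End_functor R M) S\<^esub>" if "algebra R S" for S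
    using mon that unfolding monoid_morphism_def by blast+
  show "act \<sigma> S (a \<otimes>\<^bsub>obj A S\<^esub> b) x = act \<sigma> S a (act \<sigma> S b x)"
    if "algebra R S" "a \<in> carrier (obj A S)" "b \<in> carrier (obj A S)" "x \<in> carrier (obj M S)"
    using hom_mult[OF hom[OF that(1)] that(2,3)] that alg_over_id[OF that(1)]
    by (simp add: act_def compose_def)
  show "act \<sigma> S \<one>\<^bsub>obj A S\<^esub> x = x" if "algebra R S" "x \<in> carrier (obj M S)"
    using one[OF that(1)] that alg_over_id[OF that(1)] by (simp add: act_def)
qed

lemma act_pairing:
  assumes M: "module_functor R M" and \<sigma>: "extends_action R G A M \<rho> \<sigma>"
  shows "natural_pairing R A M M (act \<sigma>)"
  using act_set_morphism(2-4,6)[OF M extends_actionD(1)[OF \<sigma>]] extends_actionD(3,4)[OF \<sigma>]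
  by (simp add: natural_pairing_def alg_over_def)

lemma module_morphism_natural_linear:
  assumes f: "module_morphism R M M' f" and S: "algebra R S"
  shows "natural_linear R S M M' (\<lambda>T \<phi>. f T)"
proof (rule natural_linearI)
  fix T \<phi> assume T: "alg_over R S T \<phi>"
  note T' = alg_overD[OF T]
  show "f T x \<in> carrier (obj M' T)" if "x \<in> carrier (obj M T)" for x
    using f T'(1) that unfolding module_morphism_def set_morphism_def by blast
qed (use f in \<open>auto simp: module_morphism_def set_morphism_def alg_over_def\<close>)

text \<open>
  For the converse direction, compatibility on points over \<open>R\<close> propagates by uniqueness of
  natural linear maps: first in the argument from the dual algebra, then in the argument from \<open>M\<close>.
\<close>

lemma G_module_morphism_iff:
  fixes M :: "('u, 'x) module_ftor" and M' :: "('u, 'y) module_ftor"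
  assumes inf: "infinite (UNIV :: 'u set)" and R: "cring (R :: 'u ring)"
    and G: "monoid_functor R G" and AG: "essentially_free R (function_functor R G)"
    and A: "dual_algebra R G A"
    and M: "essentially_free R M" and M': "essentially_free R M'"
    and \<sigma>: "extends_action R G A M \<rho> \<sigma>" and \<sigma>': "extends_action R G A M' \<rho>' \<sigma>'"
    and f: "module_morphism R M M' f"
  shows "G_module_morphism R G M \<rho> M' \<rho>' f \<longleftrightarrow>
    left_module_hom (obj A (self_module R))
      (obj M (self_module R)) (act \<sigma> (self_module R))
      (obj M' (self_module R)) (act \<sigma>' (self_module R)) (f (self_module R))"
proof -
  let ?R = "self_module R"
  obtain J \<K> c where c: "coordinates R (function_functor R G) J \<K> c"
    using essentially_free_coordinates[OF inf R AG] .
  interpret F: coordinates R "function_functor R G" J \<K> c by (rule c)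
  obtain J1 \<K>1 c1 where "coordinates R M J1 \<K>1 c1"
    using essentially_free_coordinates[OF inf R M] .
  then interpret M: coordinates R M J1 \<K>1 c1 .
  obtain J2 \<K>2 c2 where c2: "coordinates R M' J2 \<K>2 c2"
    using essentially_free_coordinates[OF inf R M'] .
  then interpret M': coordinates R M' J2 \<K>2 c2 by simp
  obtain m e where Adef: "A = with_mult_one (dual_functor R (function_functor R G)) m e"
    and AF: "module_functor R A" using dual_algebraD[OF A] by blast
  interpret A: coordinates R A J F.perp F.dual_coord
    by (rule F.dual_coordinates[OF Adef AF])
  have GS: "set_functor R G" using G by (simp add: monoid_functor_def)
  have R0: "algebra R ?R" by (rule algebra_self_module[OF R])
  note f' = module_morphism_natural_linear[OF f]
  have f_arr: "f T (arr M S T h x) = arr M' S T h (f S x)"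
    if "algebra R S" "algebra R T" "h \<in> alg_hom R S T" "x \<in> carrier (obj M S)" for S T h x
    using f that unfolding module_morphism_def set_morphism_def by blast
  have f_in: "f S x \<in> carrier (obj M' S)" if "algebra R S" "x \<in> carrier (obj M S)" for S x
    using f that unfolding module_morphism_def set_morphism_def by blast
  have f_add: "f S (x \<oplus>\<^bsub>obj M S\<^esub> y) = f S x \<oplus>\<^bsub>obj M' S\<^esub> f S y"
    if "algebra R S" "x \<in> carrier (obj M S)" "y \<in> carrier (obj M S)" for S x y
    using f that unfolding module_morphism_def by blast
  have w: "natural_linear R S A M' (\<lambda>T \<phi> a. f T (act \<sigma> T a (arr M S T \<phi> x)))"
    if "algebra R S" "x \<in> carrier (obj M S)" for S x
    by (rule natural_linear_compose[OF natural_pairing_left[OF act_pairing[OF M.is_functor \<sigma>] M.is_functor that] f'[OF that(1)]])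
  have v: "natural_linear R S A M' (\<lambda>T \<phi> a. act \<sigma>' T a (arr M' S T \<phi> (f S x)))"
    if "algebra R S" "x \<in> carrier (obj M S)" for S x
    by (rule natural_pairing_left[OF act_pairing[OF M'.is_functor \<sigma>'] M'.is_functor that(1) f_in[OF that]])
  show ?thesis
  proof
    assume fG: "G_module_morphism R G M \<rho> M' \<rho>' f"
    have "f ?R (act \<sigma> ?R a x) = act \<sigma>' ?R a (f ?R x)"
      if a: "a \<in> carrier (obj A ?R)" and x: "x \<in> carrier (obj M ?R)" for a x
    proof -
      \<comment> \<open>The identity is wanted over \<open>R\<close> only, but separation needs
        evaluations at points over every algebra; hence \<open>x\<close> is base changed to
        \<open>T\<close> and equivariance of \<open>f\<close> over \<open>T\<close> is used.\<close>
      have "f ?R (act \<sigma> ?R a (arr M ?R ?R (id_hom ?R) x)) =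
          act \<sigma>' ?R a (arr M' ?R ?R (id_hom ?R) (f ?R x))"
      proof (rule evaluation_dense_coordinates[OF GS c A R0 c2 w[OF R0 x] v[OF R0 x] _ alg_over_id[OF R0] a])
        fix T \<phi> g assume T: "alg_over R ?R T \<phi>" and g: "g \<in> carrier (obj G T)"
        note T' = alg_overD[OF T]
        have xT: "arr M ?R T \<phi> x \<in> carrier (obj M T)"
          by (rule module_functorD(3)[OF M.is_functor R0 T' x])
        have "f T (act \<rho> T g (arr M ?R T \<phi> x)) = act \<rho>' T g (f T (arr M ?R T \<phi> x))"
          using fG T'(1) g xT unfolding G_module_morphism_def by blast
        then show "f T (act \<sigma> T (evaluation R G T g) (arr M ?R T \<phi> x)) =
            act \<sigma>' T (evaluation R G T g) (arr M' ?R T \<phi> (f ?R x))"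
          using extends_actionD(2)[OF \<sigma> T'(1) g] extends_actionD(2)[OF \<sigma>' T'(1) g]
            f_arr[OF R0 T' x] by simp
      qed
      then show ?thesis
        using module_functorD(5)[OF M.is_functor R0 x] module_functorD(5)[OF M'.is_functor R0 f_in[OF R0 x]]
        by simp
    qed
    then show "left_module_hom (obj A ?R) (obj M ?R) (act \<sigma> ?R) (obj M' ?R) (act \<sigma>' ?R) (f ?R)"
      unfolding left_module_hom_def using f_in[OF R0] f_add[OF R0] by blast
  next
    assume "left_module_hom (obj A ?R) (obj M ?R) (act \<sigma> ?R) (obj M' ?R) (act \<sigma>' ?R) (f ?R)"
    then have lin: "f ?R (act \<sigma> ?R a x) = act \<sigma>' ?R a (f ?R x)"
      if "a \<in> carrier (obj A ?R)" "x \<in> carrier (obj M ?R)" for a x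
      using that unfolding left_module_hom_def by blast
    have step1: "f T (act \<sigma> T a (arr M ?R T \<phi> x)) = act \<sigma>' T a (arr M' ?R T \<phi> (f ?R x))"
      if x: "x \<in> carrier (obj M ?R)" and T: "alg_over R ?R T \<phi>" and a: "a \<in> carrier (obj A T)" for x T \<phi> a
    proof (rule A.natural_linear_unique_coordinates[OF c2 w[OF R0 x] v[OF R0 x] R0 _ T a])
      fix j
      show "f ?R (act \<sigma> ?R (A.unit ?R j) (arr M ?R ?R (id_hom ?R) x)) =
          act \<sigma>' ?R (A.unit ?R j) (arr M' ?R ?R (id_hom ?R) (f ?R x))"
        using lin[OF A.unit(1)[OF R0] x] module_functorD(5)[OF M.is_functor R0 x]
          module_functorD(5)[OF M'.is_functor R0 f_in[OF R0 x]] by simp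
    qed
    have step2: "f S (act \<sigma> S a x) = act \<sigma>' S a (f S x)"
      if S: "algebra R S" and a: "a \<in> carrier (obj A S)" and x: "x \<in> carrier (obj M S)" for S a x
    proof -
      have aS: "arr A S S (id_hom S) a = a" by (rule module_functorD(5)[OF AF S a])
      have "f S (act \<sigma> S (arr A S S (id_hom S) a) x) = act \<sigma>' S (arr A S S (id_hom S) a) (f S x)"
      proof (rule M.natural_linear_unique_coordinates[OF c2
            natural_linear_compose[OF natural_pairing_right[OF act_pairing[OF M.is_functor \<sigma>] AF S a] f'[OF S]]
            natural_linear_compose[OF f'[OF S] natural_pairing_right[OF act_pairing[OF M'.is_functor \<sigma>'] AF S a]]
            S _ alg_over_id[OF S] x])
        fix j assume j: "j \<in> J1"
        note u = unit_hom_in[OF S]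
        \<comment> \<open>The coordinate vector comes from \<open>R\<close>, so \<open>step1\<close>
          applies, where the vector is defined over \<open>R\<close> while \<open>a\<close> is
          arbitrary.\<close>
        have "M.unit S j = arr M ?R S (unit_hom R S) (M.unit ?R j)"
          using M.arr_unit[OF R0 S u j] by simp
        then show "f S (act \<sigma> S (arr A S S (id_hom S) a) (M.unit S j)) =
            act \<sigma>' S (arr A S S (id_hom S) a) (f S (M.unit S j))"
          using step1[OF M.unit(1)[OF R0] unit_hom_over[OF S] a] aS
            f_arr[OF R0 S u M.unit(1)[OF R0]] by simp
      qed
      then show ?thesis using aS by simp
    qed
    show "G_module_morphism R G M \<rho> M' \<rho>' f"
      unfolding G_module_morphism_def
    proof (intro conjI f allI impI ballI)
      fix S g x assume S: "algebra R S" and g: "g \<in> carrier (obj G S)" and x: "x \<in> carrier (obj M S)"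
      show "f S (act \<rho> S g x) = act \<rho>' S g (f S x)"
        using step2[OF S evaluation_closed[OF A S g] x] extends_actionD(2)[OF \<sigma> S g]
          extends_actionD(2)[OF \<sigma>' S g] by simp
    qed
  qed
qed

section \<open>Tensor products and quasi-coherent modules\<close>

definition balanced ::
  "'u ring \<Rightarrow> ('u, 'u) module \<Rightarrow> 'u alg \<Rightarrow> ('b, 'z) ring_scheme \<Rightarrow> ('u \<Rightarrow> 'u \<Rightarrow> 'b) \<Rightarrow> bool" where
  "balanced R M S B \<beta> \<longleftrightarrow>
     (\<forall>x\<in>carrier M. \<forall>s\<in>carrier S. \<beta> x s \<in> carrier B) \<and>
     (\<forall>x\<in>carrier M. \<forall>y\<in>carrier M. \<forall>s\<in>carrier S. \<beta> (x \<oplus>\<^bsub>M\<^esub> y) s = \<beta> x s \<oplus>\<^bsub>B\<^esub> \<beta> y s) \<and>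
     (\<forall>x\<in>carrier M. \<forall>s\<in>carrier S. \<forall>t\<in>carrier S. \<beta> x (s \<oplus>\<^bsub>S\<^esub> t) = \<beta> x s \<oplus>\<^bsub>B\<^esub> \<beta> x t) \<and>
     (\<forall>r\<in>carrier R. \<forall>x\<in>carrier M. \<forall>s\<in>carrier S. \<beta> (r \<odot>\<^bsub>M\<^esub> x) s = \<beta> x (r \<odot>\<^bsub>S\<^esub> s))"

lemma balancedI:
  assumes "\<And>x s. x \<in> carrier M \<Longrightarrow> s \<in> carrier S \<Longrightarrow> \<beta> x s \<in> carrier B"
    and "\<And>x y s. x \<in> carrier M \<Longrightarrow> y \<in> carrier M \<Longrightarrow> s \<in> carrier S \<Longrightarrow> \<beta> (x \<oplus>\<^bsub>M\<^esub> y) s = \<beta> x s \<oplus>\<^bsub>B\<^esub> \<beta> y s"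
    and "\<And>x s t. x \<in> carrier M \<Longrightarrow> s \<in> carrier S \<Longrightarrow> t \<in> carrier S \<Longrightarrow> \<beta> x (s \<oplus>\<^bsub>S\<^esub> t) = \<beta> x s \<oplus>\<^bsub>B\<^esub> \<beta> x t"
    and "\<And>r x s. r \<in> carrier R \<Longrightarrow> x \<in> carrier M \<Longrightarrow> s \<in> carrier S \<Longrightarrow> \<beta> (r \<odot>\<^bsub>M\<^esub> x) s = \<beta> x (r \<odot>\<^bsub>S\<^esub> s)"
  shows "balanced R M S B \<beta>"
  using assms by (simp add: balanced_def)

lemma tensor_module_simps:
  "carrier (tensor_module R M S) = carrier (tensor_free M S Mod tensor_relations R M S)"
  "\<zero>\<^bsub>tensor_module R M S\<^esub> = \<one>\<^bsub>tensor_free M S Mod tensor_relations R M S\<^esub>"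
  "ring.add (tensor_module R M S) = monoid.mult (tensor_free M S Mod tensor_relations R M S)"
  "module.smult (tensor_module R M S) s =
     tensor_map R M S (frag_extend (\<lambda>(x, t). frag_of (x, s \<otimes>\<^bsub>S\<^esub> t)))"
  by (simp_all add: tensor_module_def)

definition relators :: "'u ring \<Rightarrow> ('u, 'u) module \<Rightarrow> 'u alg \<Rightarrow> ('u \<times> 'u \<Rightarrow>\<^sub>0 int) set" where
  "relators R M S =
     {frag_of (x \<oplus>\<^bsub>M\<^esub> y, s) - frag_of (x, s) - frag_of (y, s) | x y s.
        x \<in> carrier M \<and> y \<in> carrier M \<and> s \<in> carrier S} \<union>
     {frag_of (x, s \<oplus>\<^bsub>S\<^esub> t) - frag_of (x, s) - frag_of (x, t) | x s t.
        x \<in> carrier M \<and> s \<in> carrier S \<and> t \<in> carrier S} \<union>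
     {frag_of (r \<odot>\<^bsub>M\<^esub> x, s) - frag_of (x, r \<odot>\<^bsub>S\<^esub> s) | r x s.
        r \<in> carrier R \<and> x \<in> carrier M \<and> s \<in> carrier S}"

lemma tensor_relations_relators: "tensor_relations R M S = generate (tensor_free M S) (relators R M S)"
  by (simp add: tensor_relations_def relators_def)

locale tensor =
  fixes R :: "'u ring" and M :: "('u, 'u) module" and S :: "'u alg"
  assumes M_module: "module R M" and S_algebra: "algebra R S"
begin

sublocale M: module R M by (rule M_module)
sublocale S: algebra R S by (rule S_algebra)
sublocale F: comm_group "tensor_free M S" by (rule abelian_free_Abelian_group)

abbreviation "T \<equiv> tensor_module R M S"
abbreviation "N \<equiv> tensor_relations R M S"

definition cl :: "('u \<times> 'u \<Rightarrow>\<^sub>0 int) \<Rightarrow> 'u tensor" where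
  "cl c = N #>\<^bsub>tensor_free M S\<^esub> c"

lemma diff_closed:
  assumes "c \<in> carrier (tensor_free M S)" "d \<in> carrier (tensor_free M S)"
  shows "c - d \<in> carrier (tensor_free M S)"
  using assms keys_diff[of c d] by auto

lemma add_closed:
  assumes "c \<in> carrier (tensor_free M S)" "d \<in> carrier (tensor_free M S)"
  shows "c + d \<in> carrier (tensor_free M S)"
  using F.m_closed[OF assms] by simp

lemma frag_closed: "x \<in> carrier M \<Longrightarrow> s \<in> carrier S \<Longrightarrow> frag_of (x, s) \<in> carrier (tensor_free M S)"
  by simp

lemma relators_closed: "relators R M S \<subseteq> carrier (tensor_free M S)"
  unfolding relators_def
  by (intro Un_least subsetI; elim CollectE exE conjE; hypsubst)
    (intro diff_closed frag_closed; simp)+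

lemma normal_relations: "N \<lhd> tensor_free M S"
  unfolding tensor_relations_relators
  using F.generate_is_subgroup[OF relators_closed] F.normal_iff_subgroup by blast

sublocale N: normal N "tensor_free M S" by (rule normal_relations)

lemma abelian_group_tensor: "abelian_group T"
proof -
  interpret Q: comm_group "tensor_free M S Mod N"
    by (rule F.abelian_FactGroup[OF N.is_subgroup])
  show ?thesis
    by (rule abelian_groupI; unfold tensor_module_simps;
        (rule Q.m_closed Q.one_closed Q.m_assoc Q.m_comm Q.l_one Q.l_inv_ex; assumption)?)
qed

sublocale T: abelian_group T by (rule abelian_group_tensor)

lemma cl_closed: "c \<in> carrier (tensor_free M S) \<Longrightarrow> cl c \<in> carrier T"
  by (simp only: tensor_module_simps carrier_FactGroup cl_def imageI)

lemma cl_cases: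
  assumes "z \<in> carrier T"
  obtains c where "c \<in> carrier (tensor_free M S)" "z = cl c"
  using assms by (auto simp only: tensor_module_simps carrier_FactGroup cl_def)

lemma cl_add:
  assumes "c \<in> carrier (tensor_free M S)" "d \<in> carrier (tensor_free M S)"
  shows "cl (c + d) = cl c \<oplus>\<^bsub>T\<^esub> cl d"
  using N.rcos_sum[OF assms] by (simp add: tensor_module_simps cl_def)

lemma cl_zero: "cl 0 = \<zero>\<^bsub>T\<^esub>"
  using F.coset_mult_one[of N] N.subset by (simp add: tensor_module_simps cl_def)

lemma cl_eq_zero: "c \<in> N \<Longrightarrow> cl c = \<zero>\<^bsub>T\<^esub>"
  using F.coset_join2[OF _ N.is_subgroup] N.subset by (auto simp: tensor_module_simps cl_def)

lemma cl_diff: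
  assumes "c \<in> carrier (tensor_free M S)" "d \<in> carrier (tensor_free M S)"
  shows "cl (c - d) = cl c \<ominus>\<^bsub>T\<^esub> cl d"
proof -
  note cd = diff_closed[OF assms]
  have "cl (c - d) \<oplus>\<^bsub>T\<^esub> cl d = cl c"
    using cl_add[OF cd assms(2)] by simp
  then show ?thesis
    using cl_closed[OF cd] cl_closed[OF assms(2)]
    by (simp add: T.minus_eq T.a_assoc T.r_neg flip: \<open>cl (c - d) \<oplus>\<^bsub>T\<^esub> cl d = cl c\<close>)
qed

abbreviation pure :: "'u \<Rightarrow> 'u \<Rightarrow> 'u tensor" where "pure \<equiv> pure_tensor R M S"

lemma pure_cl: "pure x s = cl (frag_of (x, s))"
  by (simp add: pure_tensor_def cl_def)

lemma pure_closed [simp]: "x \<in> carrier M \<Longrightarrow> s \<in> carrier S \<Longrightarrow> pure x s \<in> carrier T"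
  unfolding pure_cl by (rule cl_closed) simp

lemma relator_zero: "c \<in> relators R M S \<Longrightarrow> cl c = \<zero>\<^bsub>T\<^esub>"
  unfolding tensor_relations_relators[symmetric]
  by (rule cl_eq_zero) (auto simp: tensor_relations_relators intro: generate.incl)

lemma pure_add_left:
  assumes "x \<in> carrier M" "y \<in> carrier M" "s \<in> carrier S"
  shows "pure (x \<oplus>\<^bsub>M\<^esub> y) s = pure x s \<oplus>\<^bsub>T\<^esub> pure y s"
proof -
  let ?a = "frag_of (x \<oplus>\<^bsub>M\<^esub> y, s)" and ?b = "frag_of (x, s)" and ?c = "frag_of (y, s)"
  have in_F: "?a - ?b - ?c \<in> carrier (tensor_free M S)" "?b + ?c \<in> carrier (tensor_free M S)"
    by (intro diff_closed add_closed frag_closed; use assms in simp)+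
  have "cl (?a - ?b - ?c) = \<zero>\<^bsub>T\<^esub>"
    using assms unfolding relators_def by (intro relator_zero[unfolded relators_def]) blast
  then have "cl ((?a - ?b - ?c) + (?b + ?c)) = cl (?b + ?c)"
    using cl_add[OF in_F] cl_closed[OF in_F(2)] by simp
  then show ?thesis
    using cl_add[of ?b ?c] assms by (simp add: pure_cl)
qed

lemma pure_add_right:
  assumes "x \<in> carrier M" "s \<in> carrier S" "t \<in> carrier S"
  shows "pure x (s \<oplus>\<^bsub>S\<^esub> t) = pure x s \<oplus>\<^bsub>T\<^esub> pure x t"
proof -
  let ?a = "frag_of (x, s \<oplus>\<^bsub>S\<^esub> t)" and ?b = "frag_of (x, s)" and ?c = "frag_of (x, t)"
  have in_F: "?a - ?b - ?c \<in> carrier (tensor_free M S)" "?b + ?c \<in> carrier (tensor_free M S)"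
    by (intro diff_closed add_closed frag_closed; use assms in simp)+
  have "cl (?a - ?b - ?c) = \<zero>\<^bsub>T\<^esub>"
    using assms unfolding relators_def by (intro relator_zero[unfolded relators_def]) blast
  then have "cl ((?a - ?b - ?c) + (?b + ?c)) = cl (?b + ?c)"
    using cl_add[OF in_F] cl_closed[OF in_F(2)] by simp
  then show ?thesis
    using cl_add[of ?b ?c] assms by (simp add: pure_cl)
qed

lemma pure_smult:
  assumes "r \<in> carrier R" "x \<in> carrier M" "s \<in> carrier S"
  shows "pure (r \<odot>\<^bsub>M\<^esub> x) s = pure x (r \<odot>\<^bsub>S\<^esub> s)"
proof -
  let ?a = "frag_of (r \<odot>\<^bsub>M\<^esub> x, s)" and ?b = "frag_of (x, r \<odot>\<^bsub>S\<^esub> s)"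
  have in_F: "?a - ?b \<in> carrier (tensor_free M S)" "?b \<in> carrier (tensor_free M S)"
    by (intro diff_closed add_closed frag_closed; use assms in simp)+
  have "cl (?a - ?b) = \<zero>\<^bsub>T\<^esub>"
    using assms unfolding relators_def by (intro relator_zero[unfolded relators_def]) blast
  then have "cl ((?a - ?b) + ?b) = cl ?b"
    using cl_add[OF in_F] cl_closed[OF in_F(2)] by simp
  then show ?thesis by (simp add: pure_cl)
qed

lemma pure_hom_left: "s \<in> carrier S \<Longrightarrow> abelian_group_hom M T (\<lambda>x. pure x s)"
  by (intro abelian_group_homI') (auto simp: pure_add_left intro: M.abelian_group_axioms T.abelian_group_axioms)

text \<open>Integer combinations reduce to sums of pure tensors, because the negative of
  \<open>pure x s\<close> is the pure tensor of the negative of \<open>x\<close> with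
  \<open>s\<close>.\<close>

lemma tensor_induct [consumes 1, case_names pure add]:
  assumes z: "z \<in> carrier T"
    and pure: "\<And>x s. x \<in> carrier M \<Longrightarrow> s \<in> carrier S \<Longrightarrow> P (pure x s)"
    and add: "\<And>y z. y \<in> carrier T \<Longrightarrow> z \<in> carrier T \<Longrightarrow> P y \<Longrightarrow> P z \<Longrightarrow> P (y \<oplus>\<^bsub>T\<^esub> z)"
  shows "P z"
proof -
  have "P \<zero>\<^bsub>T\<^esub>"
  proof -
    interpret p: abelian_group_hom M T "\<lambda>x. pure x \<zero>\<^bsub>S\<^esub>" by (rule pure_hom_left) simp
    show ?thesis using pure[of "\<zero>\<^bsub>M\<^esub>" "\<zero>\<^bsub>S\<^esub>"] p.hom_zero by simp
  qed
  \<comment> \<open>Induction on formal sums proceeds by differences, while \<open>P\<close> is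
    preserved by sums; the claim therefore carries the negative of the class along.\<close>
  have "c \<in> carrier (tensor_free M S) \<and> P (cl c) \<and> P (\<ominus>\<^bsub>T\<^esub> cl c)"
    if "Poly_Mapping.keys c \<subseteq> carrier M \<times> carrier S" for c
    using that
  proof (induction c rule: frag_induction)
    case zero
    then show ?case using \<open>P \<zero>\<^bsub>T\<^esub>\<close> by (simp add: cl_zero T.add.inv_one[folded a_inv_def])
  next
    case (diff a b)
    then have ab: "cl a \<in> carrier T" "cl b \<in> carrier T" by (auto intro!: cl_closed)
    have "cl (a - b) = cl a \<oplus>\<^bsub>T\<^esub> \<ominus>\<^bsub>T\<^esub> cl b"
      using cl_diff[of a b] diff by (simp add: T.minus_eq)
    moreover from this have "\<ominus>\<^bsub>T\<^esub> cl (a - b) = \<ominus>\<^bsub>T\<^esub> cl a \<oplus>\<^bsub>T\<^esub> cl b"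
      using ab by (simp add: T.minus_add)
    ultimately show ?case using diff ab add diff_closed[of a b] by simp
  next
    case (one a)
    obtain x s where a: "a = (x, s)" "x \<in> carrier M" "s \<in> carrier S" using one by auto
    interpret p: abelian_group_hom M T "\<lambda>x. pure x s" by (rule pure_hom_left) (rule a)
    have "\<ominus>\<^bsub>T\<^esub> cl (frag_of a) = pure (\<ominus>\<^bsub>M\<^esub> x) s"
      using p.hom_a_inv[of x] a by (simp add: pure_cl)
    then show ?case using pure[OF a(2,3)] pure[of "\<ominus>\<^bsub>M\<^esub> x" s] a by (simp add: pure_cl[symmetric])
  qed
  then show ?thesis using z by (auto elim!: cl_cases)
qed

lemma hom_eqI:
  assumes f: "abelian_group_hom T B f" and g: "abelian_group_hom T B g"
    and eq: "\<And>x s. x \<in> carrier M \<Longrightarrow> s \<in> carrier S \<Longrightarrow> f (pure x s) = g (pure x s)"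
    and z: "z \<in> carrier T"
  shows "f z = g z"
proof -
  interpret f: abelian_group_hom T B f by (rule f)
  interpret g: abelian_group_hom T B g by (rule g)
  show ?thesis using z by (induction z rule: tensor_induct) (auto simp: eq)
qed

text \<open>A balanced map extends additively to formal sums and kills each generator of
  \<open>tensor_relations\<close>, hence the subgroup they generate.\<close>

lemma universal:
  assumes B: "abelian_group B" and \<beta>: "balanced R M S B \<beta>"
  obtains h where "abelian_group_hom T B h"
    "\<And>x s. x \<in> carrier M \<Longrightarrow> s \<in> carrier S \<Longrightarrow> h (pure x s) = \<beta> x s"
proof -
  interpret B: abelian_group B by (rule B)
  have "(\<lambda>(x, s). \<beta> x s) ` (carrier M \<times> carrier S) \<subseteq> carrier B"
    using \<beta> by (auto simp: balanced_def)
  then obtain h0 where h0: "h0 \<in> hom (tensor_free M S) (add_monoid B)"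
    and h0': "\<And>p. p \<in> carrier M \<times> carrier S \<Longrightarrow> h0 (frag_of p) = (\<lambda>(x, s). \<beta> x s) p"
    by (rule B.add.free_Abelian_group_universal) (rule that)
  interpret h0: group_hom "tensor_free M S" "add_monoid B" h0
    using h0 by (simp add: group_hom_def group_hom_axioms_def B.add.is_group)
  have diff: "h0 (a - b) = h0 a \<ominus>\<^bsub>B\<^esub> h0 b"
    if "a \<in> carrier (tensor_free M S)" "b \<in> carrier (tensor_free M S)" for a b
    using h0.hom_mult[of a "- b"] h0.hom_inv[of b] that
    by (simp add: B.minus_eq a_inv_def)
  have cancel: "x \<oplus>\<^bsub>B\<^esub> y \<ominus>\<^bsub>B\<^esub> x \<ominus>\<^bsub>B\<^esub> y = \<zero>\<^bsub>B\<^esub>" if "x \<in> carrier B" "y \<in> carrier B" for x y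
  proof -
    have "x \<oplus>\<^bsub>B\<^esub> y \<ominus>\<^bsub>B\<^esub> x = y"
      using that B.r_neg2[of x y] by (simp add: B.minus_eq B.a_comm[of "x \<oplus>\<^bsub>B\<^esub> y"] B.a_assoc[symmetric] B.l_neg)
    then show ?thesis using that by (simp add: B.minus_eq B.r_neg)
  qed
  have frag: "h0 (frag_of (x, s)) = \<beta> x s" if "x \<in> carrier M" "s \<in> carrier S" for x s
    using h0'[of "(x, s)"] that by simp
  have \<beta>': "x \<in> carrier M \<Longrightarrow> s \<in> carrier S \<Longrightarrow> \<beta> x s \<in> carrier B" for x s
    using \<beta> by (simp add: balanced_def)
  have diff2: "h0 (a - b - c) = h0 a \<ominus>\<^bsub>B\<^esub> h0 b \<ominus>\<^bsub>B\<^esub> h0 c"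
    if "a \<in> carrier (tensor_free M S)" "b \<in> carrier (tensor_free M S)" "c \<in> carrier (tensor_free M S)"
    for a b c
    by (simp only: diff[OF diff_closed[OF that(1,2)] that(3)] diff[OF that(1,2)])
  have "h0 c = \<zero>\<^bsub>B\<^esub>" if "c \<in> relators R M S" for c
  proof -
    from that consider
      x y s where "x \<in> carrier M" "y \<in> carrier M" "s \<in> carrier S"
        "c = frag_of (x \<oplus>\<^bsub>M\<^esub> y, s) - frag_of (x, s) - frag_of (y, s)"
    | x s t where "x \<in> carrier M" "s \<in> carrier S" "t \<in> carrier S"
        "c = frag_of (x, s \<oplus>\<^bsub>S\<^esub> t) - frag_of (x, s) - frag_of (x, t)"
    | r x s where "r \<in> carrier R" "x \<in> carrier M" "s \<in> carrier S"
        "c = frag_of (r \<odot>\<^bsub>M\<^esub> x, s) - frag_of (x, r \<odot>\<^bsub>S\<^esub> s)"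
      unfolding relators_def by (elim UnE CollectE exE conjE) (rule that; assumption)+
    then show ?thesis
    proof cases
      case 1
      then have "h0 c = \<beta> (x \<oplus>\<^bsub>M\<^esub> y) s \<ominus>\<^bsub>B\<^esub> \<beta> x s \<ominus>\<^bsub>B\<^esub> \<beta> y s"
        by (simp only: diff2 frag frag_closed M.M.add.m_closed)
      also have "\<beta> (x \<oplus>\<^bsub>M\<^esub> y) s = \<beta> x s \<oplus>\<^bsub>B\<^esub> \<beta> y s"
        using \<beta> 1 by (simp add: balanced_def)
      finally show ?thesis using cancel \<beta>' 1 by simp
    next
      case 2
      then have "h0 c = \<beta> x (s \<oplus>\<^bsub>S\<^esub> t) \<ominus>\<^bsub>B\<^esub> \<beta> x s \<ominus>\<^bsub>B\<^esub> \<beta> x t"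
        by (simp only: diff2 frag frag_closed S.M.add.m_closed)
      also have "\<beta> x (s \<oplus>\<^bsub>S\<^esub> t) = \<beta> x s \<oplus>\<^bsub>B\<^esub> \<beta> x t"
        using \<beta> 2 by (simp add: balanced_def)
      finally show ?thesis using cancel \<beta>' 2 by simp
    next
      case 3
      then have "h0 c = \<beta> (r \<odot>\<^bsub>M\<^esub> x) s \<ominus>\<^bsub>B\<^esub> \<beta> x (r \<odot>\<^bsub>S\<^esub> s)"
        by (simp only: diff frag frag_closed M.smult_closed S.smult_closed)
      also have "\<beta> (r \<odot>\<^bsub>M\<^esub> x) s = \<beta> x (r \<odot>\<^bsub>S\<^esub> s)"
        using \<beta> 3 by (simp add: balanced_def)
      finally show ?thesis using \<beta>' 3 by (simp add: B.minus_eq B.r_neg)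
    qed
  qed
  then have "relators R M S \<subseteq> kernel (tensor_free M S) (add_monoid B) h0"
    using subsetD[OF relators_closed] unfolding kernel_def by (intro subsetI) simp
  then have "N \<subseteq> kernel (tensor_free M S) (add_monoid B) h0"
    unfolding tensor_relations_relators
    by (intro F.generate_subgroup_incl h0.subgroup_kernel)
  then obtain g where g: "g \<in> hom (tensor_free M S Mod N) (add_monoid B)"
    and gcl: "\<And>c. c \<in> carrier (tensor_free M S) \<Longrightarrow> g (N #>\<^bsub>tensor_free M S\<^esub> c) = h0 c"
    using h0.FactGroup_universal_kernel[OF normal_relations] by blast
  show thesis
  proof (rule that)
    show "abelian_group_hom T B g"
      using g by (intro abelian_group_homI' abelian_group_tensor B)
        (auto simp: hom_def tensor_module_simps)
    fix x s assume "x \<in> carrier M" "s \<in> carrier S"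
    then show "g (pure x s) = \<beta> x s"
      using gcl[of "frag_of (x, s)"] h0'[of "(x, s)"] by (simp add: pure_tensor_def)
  qed
qed

text \<open>The constant \<open>tensor_map\<close> takes a union over all representatives of a
  coset. On each of them \<open>f\<close> lands in the coset prescribed by the homomorphism
  \<open>k\<close> of the universal property, so the union is that one coset.\<close>

lemma tensor_map:
  assumes T': "tensor R M' S'" and \<beta>: "balanced R M S (tensor_module R M' S') (\<lambda>x s. pure_tensor R M' S' (g x) (h s))"
    and g: "\<And>x. x \<in> carrier M \<Longrightarrow> g x \<in> carrier M'" and h: "\<And>s. s \<in> carrier S \<Longrightarrow> h s \<in> carrier S'"
    and f: "\<And>c. f c = frag_extend (\<lambda>(x, s). frag_of (g x, h s)) c"
  shows "abelian_group_hom T (tensor_module R M' S') (tensor_map R M' S' f)"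
    and "\<And>x s. x \<in> carrier M \<Longrightarrow> s \<in> carrier S \<Longrightarrow>
      tensor_map R M' S' f (pure x s) = pure_tensor R M' S' (g x) (h s)"
proof -
  interpret T': tensor R M' S' by (rule T')
  obtain k where k: "abelian_group_hom T (tensor_module R M' S') k"
    and kp: "\<And>x s. x \<in> carrier M \<Longrightarrow> s \<in> carrier S \<Longrightarrow> k (pure x s) = pure_tensor R M' S' (g x) (h s)"
    using universal[OF T'.abelian_group_tensor \<beta>] by blast
  interpret k: abelian_group_hom T "tensor_module R M' S'" k by (rule k)
  have fc: "c \<in> carrier (tensor_free M S) \<and> f c \<in> carrier (tensor_free M' S') \<and> k (cl c) = T'.cl (f c)"
    if "Poly_Mapping.keys c \<subseteq> carrier M \<times> carrier S" for c
    using that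
  proof (induction c rule: frag_induction)
    case zero
    then show ?case by (simp add: f cl_zero T'.cl_zero)
  next
    case (diff a b)
    have "f (a - b) = f a - f b" by (simp add: f frag_extend_diff)
    moreover have "cl a \<in> carrier T" "cl b \<in> carrier T" using diff by (auto intro!: cl_closed)
    ultimately show ?case
      using diff cl_diff[of a b] T'.cl_diff[of "f a" "f b"] k.hom_a_inv[of "cl b"]
        T'.diff_closed[of "f a" "f b"] diff_closed[of a b]
      by (simp add: T.minus_eq T'.T.minus_eq)
  next
    case (one a)
    then show ?case using g h kp by (auto simp: f pure_cl T'.pure_cl)
  qed
  have mapk: "tensor_map R M' S' f z = k z" if "z \<in> carrier T" for z
  proof -
    obtain c where c: "c \<in> carrier (tensor_free M S)" "z = cl c" using \<open>z \<in> carrier T\<close> by (rule cl_cases)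
    have "d \<in> carrier (tensor_free M S) \<and> cl d = z" if "d \<in> z" for d
      using that F.repr_independence[OF _ c(1) N.is_subgroup] c(2) N.subset F.r_coset_subset_G[OF N.subset c(1)]
      unfolding cl_def by blast
    then have "T'.cl (f d) = k z" if "d \<in> z" for d
      using that fc by fastforce
    moreover have "c \<in> z" using F.rcos_self[OF c(1) N.is_subgroup] c(2) by (simp add: cl_def)
    ultimately show ?thesis
      unfolding tensor_map_def T'.cl_def[symmetric] by blast
  qed
  show "abelian_group_hom T (tensor_module R M' S') (tensor_map R M' S' f)"
    by (intro abelian_group_homI' abelian_group_tensor T'.abelian_group_tensor) (auto simp: mapk)
  show "tensor_map R M' S' f (pure x s) = pure_tensor R M' S' (g x) (h s)"
    if "x \<in> carrier M" "s \<in> carrier S" for x s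
    using that by (simp add: mapk kp)
qed

lemma smult_tensor:
  assumes s: "s \<in> carrier S"
  shows "abelian_group_hom T T (\<lambda>z. s \<odot>\<^bsub>T\<^esub> z)"
    and "\<And>x t. x \<in> carrier M \<Longrightarrow> t \<in> carrier S \<Longrightarrow> s \<odot>\<^bsub>T\<^esub> pure x t = pure x (s \<otimes>\<^bsub>S\<^esub> t)"
proof -
  have "s \<otimes>\<^bsub>S\<^esub> (r \<odot>\<^bsub>S\<^esub> t) = r \<odot>\<^bsub>S\<^esub> (s \<otimes>\<^bsub>S\<^esub> t)" if "r \<in> carrier R" "t \<in> carrier S" for r t
    using S.smult_assoc2[OF that s] that s by (simp add: S.m_comm)
  then have "balanced R M S T (\<lambda>x t. pure x (s \<otimes>\<^bsub>S\<^esub> t))"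
    using s by (intro balancedI) (auto simp: pure_add_left pure_add_right pure_smult S.r_distr)
  note * = tensor_map[OF tensor_axioms this, of "frag_extend (\<lambda>(x, t). frag_of (x, s \<otimes>\<^bsub>S\<^esub> t))"]
  show "abelian_group_hom T T (\<lambda>z. s \<odot>\<^bsub>T\<^esub> z)"
    using *(1) s by (simp add: tensor_module_simps(4))
  show "s \<odot>\<^bsub>T\<^esub> pure x t = pure x (s \<otimes>\<^bsub>S\<^esub> t)" if "x \<in> carrier M" "t \<in> carrier S" for x t
    using *(2) s that by (simp add: tensor_module_simps(4))
qed

text \<open>Apart from additivity, each law compares two additive maps on the tensor product, so
  pure tensors decide it.\<close>

lemma module_tensor: "module S T"
proof (rule moduleI)
  show "cring S" by (rule S.M_cring)
  show "abelian_group T" by (rule abelian_group_tensor)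
  fix a assume a: "a \<in> carrier S"
  interpret a: abelian_group_hom T T "\<lambda>z. a \<odot>\<^bsub>T\<^esub> z" by (rule smult_tensor[OF a])
  show "a \<odot>\<^bsub>T\<^esub> z \<in> carrier T" if "z \<in> carrier T" for z by (rule a.hom_closed[OF that])
  show "a \<odot>\<^bsub>T\<^esub> (y \<oplus>\<^bsub>T\<^esub> z) = a \<odot>\<^bsub>T\<^esub> y \<oplus>\<^bsub>T\<^esub> a \<odot>\<^bsub>T\<^esub> z" if "y \<in> carrier T" "z \<in> carrier T" for y z
    by (rule a.hom_add[OF that])
  fix b assume b: "b \<in> carrier S"
  interpret b: abelian_group_hom T T "\<lambda>z. b \<odot>\<^bsub>T\<^esub> z" by (rule smult_tensor[OF b])
  have ab: "a \<oplus>\<^bsub>S\<^esub> b \<in> carrier S" "a \<otimes>\<^bsub>S\<^esub> b \<in> carrier S" using a b by auto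
  fix z assume z: "z \<in> carrier T"
  show "(a \<oplus>\<^bsub>S\<^esub> b) \<odot>\<^bsub>T\<^esub> z = a \<odot>\<^bsub>T\<^esub> z \<oplus>\<^bsub>T\<^esub> b \<odot>\<^bsub>T\<^esub> z"
  proof (rule hom_eqI[OF smult_tensor(1)[OF ab(1)] _ _ z])
    show "abelian_group_hom T T (\<lambda>z. a \<odot>\<^bsub>T\<^esub> z \<oplus>\<^bsub>T\<^esub> b \<odot>\<^bsub>T\<^esub> z)"
      by (intro abelian_group_homI' abelian_group_tensor) (auto simp: T.a_ac)
  qed (use a b ab in \<open>simp add: smult_tensor(2) S.l_distr pure_add_right\<close>)
  show "(a \<otimes>\<^bsub>S\<^esub> b) \<odot>\<^bsub>T\<^esub> z = a \<odot>\<^bsub>T\<^esub> (b \<odot>\<^bsub>T\<^esub> z)"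
    by (rule hom_eqI[OF smult_tensor(1)[OF ab(2)]
          abelian_group_hom_compose[OF smult_tensor(1)[OF b] smult_tensor(1)[OF a]] _ z])
      (use a b ab in \<open>simp add: smult_tensor(2) S.m_assoc\<close>)
next
  fix z assume z: "z \<in> carrier T"
  show "\<one>\<^bsub>S\<^esub> \<odot>\<^bsub>T\<^esub> z = z"
  proof (rule hom_eqI[OF smult_tensor(1)[OF S.one_closed] _ _ z])
    show "abelian_group_hom T T (\<lambda>z. z)"
      by (intro abelian_group_homI' abelian_group_tensor) auto
  qed (simp add: smult_tensor(2))
qed

end

lemma tensorI: "module R M \<Longrightarrow> algebra R S \<Longrightarrow> tensor R M S"
  by (rule tensor.intro)

section \<open>The functor of base changes of a module\<close>

lemma quasi_coherent_simps [simp]: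
  "obj (quasi_coherent R M) = tensor_module R M"
  by (simp_all add: quasi_coherent_def)

lemma quasi_coherent_arr:
  assumes M: "module R M" and S: "algebra R S" and T: "algebra R T" and h: "h \<in> alg_hom R S T"
  shows "abelian_group_hom (tensor_module R M S) (tensor_module R M T) (arr (quasi_coherent R M) S T h)"
    and "\<And>x s. x \<in> carrier M \<Longrightarrow> s \<in> carrier S \<Longrightarrow>
      arr (quasi_coherent R M) S T h (pure_tensor R M S x s) = pure_tensor R M T x (h s)"
proof -
  interpret S: tensor R M S by (rule tensorI[OF M S])
  interpret T: tensor R M T by (rule tensorI[OF M T])
  note h' = alg_homD[OF h]
  have "balanced R M S T.T (\<lambda>x s. pure_tensor R M T x (h s))"
    by (intro balancedI) (auto simp: T.pure_add_left T.pure_add_right T.pure_smult h')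
  note * = S.tensor_map[OF T.tensor_axioms this, of "frag_extend (\<lambda>(x, s). frag_of (x, h s))"]
  show "abelian_group_hom (tensor_module R M S) (tensor_module R M T) (arr (quasi_coherent R M) S T h)"
    using *(1) h' by (simp add: quasi_coherent_def)
  show "arr (quasi_coherent R M) S T h (pure_tensor R M S x s) = pure_tensor R M T x (h s)"
    if "x \<in> carrier M" "s \<in> carrier S" for x s
    using *(2) h' that by (simp add: quasi_coherent_def)
qed

lemma module_functor_quasi_coherent:
  assumes M: "module R M"
  shows "module_functor R (quasi_coherent R M)"
proof -
  let ?Q = "quasi_coherent R M"
  note hom = quasi_coherent_arr(1)[OF M] and pure = quasi_coherent_arr(2)[OF M]
  show ?thesis
    unfolding module_functor_def set_functor_def quasi_coherent_simps
  proof (intro conjI allI impI ballI)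
    fix S T :: "'a alg" and h assume S: "algebra R S" and T: "algebra R T" and h: "h \<in> alg_hom R S T"
    interpret S: tensor R M S by (rule tensorI[OF M S])
    interpret T: tensor R M T by (rule tensorI[OF M T])
    interpret h: abelian_group_hom S.T T.T "arr ?Q S T h" by (rule hom[OF S T h])
    show "arr ?Q S T h \<in> carrier S.T \<rightarrow> carrier T.T" by auto
    show "arr ?Q S T h (x \<oplus>\<^bsub>S.T\<^esub> y) = arr ?Q S T h x \<oplus>\<^bsub>T.T\<^esub> arr ?Q S T h y"
      if "x \<in> carrier S.T" "y \<in> carrier S.T" for x y
      by (rule h.hom_add[OF that])
    fix s z assume s: "s \<in> carrier S" and z: "z \<in> carrier S.T"
    have hs: "h s \<in> carrier T" by (rule alg_homD(4)[OF h s])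
    show "arr ?Q S T h (s \<odot>\<^bsub>S.T\<^esub> z) = h s \<odot>\<^bsub>T.T\<^esub> arr ?Q S T h z"
      by (rule S.hom_eqI[OF abelian_group_hom_compose[OF S.smult_tensor(1)[OF s] hom[OF S T h]]
            abelian_group_hom_compose[OF hom[OF S T h] T.smult_tensor(1)[OF hs]] _ z])
        (use s hs in \<open>simp add: S.smult_tensor(2) T.smult_tensor(2) pure[OF S T h] alg_homD[OF h]\<close>)
  next
    fix S :: "'a alg" assume S: "algebra R S"
    interpret S: tensor R M S by (rule tensorI[OF M S])
    show "module S S.T" by (rule S.module_tensor)
    fix z assume z: "z \<in> carrier S.T"
    show "arr ?Q S S (id_hom S) z = z"
    proof (rule S.hom_eqI[OF hom[OF S S id_hom_in[OF S]] _ _ z])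
      show "abelian_group_hom S.T S.T (\<lambda>z. z)"
        by (intro abelian_group_homI' S.abelian_group_tensor) auto
    qed (simp add: pure[OF S S id_hom_in[OF S]])
  next
    fix S T U :: "'a alg" and h k z
    assume S: "algebra R S" and T: "algebra R T" and U: "algebra R U" and h: "h \<in> alg_hom R S T"
      and k: "k \<in> alg_hom R T U" and z: "z \<in> carrier (tensor_module R M S)"
    interpret S: tensor R M S by (rule tensorI[OF M S])
    note kh = compose_alg_hom[OF S h k]
    show "arr ?Q S U (compose (carrier S) k h) z = arr ?Q T U k (arr ?Q S T h z)"
      by (rule S.hom_eqI[OF hom[OF S U kh] abelian_group_hom_compose[OF hom[OF S T h] hom[OF T U k]] _ z])
        (simp add: pure[OF S U kh] pure[OF S T h] pure[OF T U k] compose_eq alg_homD[OF h])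
  qed
qed

lemma determined_by_mono:
  assumes "determined_by R Q S K F z" "F \<subseteq> F'"
  shows "determined_by R Q S K F' z"
  unfolding determined_by_def
proof (intro allI impI)
  fix T g h
  assume T: "algebra R T" and g: "g \<in> alg_hom R (free_ext S K) T" and h: "h \<in> alg_hom R (free_ext S K) T"
    and eq: "\<forall>s\<in>carrier S. \<forall>c\<in>carrier (obj (free_functor K) S). (\<forall>i\<in>K - F'. c i = \<zero>\<^bsub>S\<^esub>) \<longrightarrow>
        g (sqz_enc S (obj (free_functor K) S) (s, c)) = h (sqz_enc S (obj (free_functor K) S) (s, c))"
  show "arr Q (free_ext S K) T g z = arr Q (free_ext S K) T h z"
    by (rule determined_byD[OF assms(1) T g h]) (use eq assms(2) in blast)
qed

text \<open>A pure tensor with second factor \<open>(t, c)\<close> involves the support of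
  \<open>c\<close>, and sums take unions. As for \<epsilon>, taking the \<epsilon>-coefficient is
  \<open>R\<close>-linear, and tensoring this map with \<open>M\<close> gives a left inverse to
  multiplication by \<epsilon>, whether or not \<open>M\<close> is flat.\<close>

lemma linear_target_quasi_coherent:
  fixes M :: "('u, 'u) module"
  assumes inf: "infinite (UNIV :: 'u set)" and M: "module R M"
  shows "linear_target R (quasi_coherent R M)"
proof -
  let ?Q = "quasi_coherent R M"
  note hom = quasi_coherent_arr(1)[OF M] and pure = quasi_coherent_arr(2)[OF M]
  have "finitary_target R ?Q"
    unfolding finitary_target_def
  proof (intro allI impI)
    fix S :: "'u alg" and K z
    assume S: "algebra R S" and z: "z \<in> carrier (obj ?Q (free_ext S K))"
    interpret sq: square_zero R S "obj (free_functor K) S"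
      by (rule square_zero_free[OF inf S])
    interpret S': tensor R M "free_ext S K" by (rule tensorI[OF M sq.algebra_sqz])
    from z have "z \<in> carrier S'.T" by simp
    then show "\<exists>F. finite F \<and> F \<subseteq> K \<and> determined_by R ?Q S K F z"
    proof (induction z rule: S'.tensor_induct)
      case (pure x s)
      obtain t c where t: "t \<in> carrier S" "c \<in> carrier (obj (free_functor K) S)"
        and s: "s = sqz_enc S (obj (free_functor K) S) (t, c)"
        using pure(2) by (rule sq.sqz_cases)
      let ?F = "{i \<in> K. c i \<noteq> \<zero>\<^bsub>S\<^esub>}"
      have "determined_by R ?Q S K ?F (pure_tensor R M (free_ext S K) x s)"
        unfolding determined_by_def
      proof (intro allI impI)
        fix T g h
        assume T: "algebra R T" and g: "g \<in> alg_hom R (free_ext S K) T" and h: "h \<in> alg_hom R (free_ext S K) T"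
          and eq: "\<forall>s\<in>carrier S. \<forall>c\<in>carrier (obj (free_functor K) S). (\<forall>i\<in>K - ?F. c i = \<zero>\<^bsub>S\<^esub>) \<longrightarrow>
              g (sqz_enc S (obj (free_functor K) S) (s, c)) = h (sqz_enc S (obj (free_functor K) S) (s, c))"
        have "g s = h s" unfolding s using eq t by blast
        then show "arr ?Q (free_ext S K) T g (pure_tensor R M (free_ext S K) x s) =
            arr ?Q (free_ext S K) T h (pure_tensor R M (free_ext S K) x s)"
          using \<open>x \<in> carrier M\<close> \<open>s \<in> carrier (free_ext S K)\<close>
            quasi_coherent_arr(2)[OF M sq.algebra_sqz T g] quasi_coherent_arr(2)[OF M sq.algebra_sqz T h] by simp
      qed
      then show ?case using t by (intro exI[of _ ?F]) auto
    next
      case (add y z)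
      then obtain F F' where F: "finite F" "F \<subseteq> K" "determined_by R ?Q S K F y"
        and F': "finite F'" "F' \<subseteq> K" "determined_by R ?Q S K F' z" by blast
      have y: "determined_by R ?Q S K (F \<union> F') y" and z: "determined_by R ?Q S K (F \<union> F') z"
        using determined_by_mono[OF F(3)] determined_by_mono[OF F'(3)] by blast+
      have "determined_by R ?Q S K (F \<union> F') (y \<oplus>\<^bsub>S'.T\<^esub> z)"
        unfolding determined_by_def
      proof (intro allI impI)
        fix T g h
        assume T: "algebra R T" and g: "g \<in> alg_hom R (free_ext S K) T" and h: "h \<in> alg_hom R (free_ext S K) T"
          and eq: "\<forall>s\<in>carrier S. \<forall>c\<in>carrier (obj (free_functor K) S). (\<forall>i\<in>K - (F \<union> F'). c i = \<zero>\<^bsub>S\<^esub>) \<longrightarrow>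
              g (sqz_enc S (obj (free_functor K) S) (s, c)) = h (sqz_enc S (obj (free_functor K) S) (s, c))"
        interpret g: abelian_group_hom S'.T "tensor_module R M T" "arr ?Q (free_ext S K) T g"
          by (rule hom[OF sq.algebra_sqz T g])
        interpret h: abelian_group_hom S'.T "tensor_module R M T" "arr ?Q (free_ext S K) T h"
          by (rule hom[OF sq.algebra_sqz T h])
        have "arr ?Q (free_ext S K) T g y = arr ?Q (free_ext S K) T h y"
          "arr ?Q (free_ext S K) T g z = arr ?Q (free_ext S K) T h z"
          by (rule determined_byD[OF y T g h], use eq in blast, rule determined_byD[OF z T g h], use eq in blast)
        then show "arr ?Q (free_ext S K) T g (y \<oplus>\<^bsub>S'.T\<^esub> z) = arr ?Q (free_ext S K) T h (y \<oplus>\<^bsub>S'.T\<^esub> z)"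
          using add(1,2) by simp
      qed
      then show ?case using F F' by (intro exI[of _ "F \<union> F'"]) auto
    qed
  qed
  moreover have "eps_faithful R ?Q"
    unfolding eps_faithful_def
  proof (intro allI impI)
    fix T :: "'u alg" and y z
    assume T: "algebra R T" and yz: "y \<in> carrier (obj ?Q T)" "z \<in> carrier (obj ?Q T)"
    interpret sq: square_zero R T "self_module T"
      by (rule square_zero_dual[OF inf T])
    let ?D = "dual_numbers T" and ?\<iota> = "sqz_incl T (self_module T)"
    interpret D: tensor R M ?D by (rule tensorI[OF M sq.algebra_sqz])
    interpret T: tensor R M T by (rule tensorI[OF M T])
    have "balanced R M ?D T.T (\<lambda>x d. pure_tensor R M T x (snd (sqz_dec T (self_module T) d)))"
    proof (rule balancedI)
      fix r x s assume "r \<in> carrier R" "x \<in> carrier M" "s \<in> carrier ?D"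
      then show "pure_tensor R M T (r \<odot>\<^bsub>M\<^esub> x) (snd (sqz_dec T (self_module T) s)) =
          pure_tensor R M T x (snd (sqz_dec T (self_module T) (r \<odot>\<^bsub>?D\<^esub> s)))"
        by (auto elim!: sq.sqz_cases simp: T.pure_smult sq.A.smult_assoc2)
    qed (auto elim!: sq.sqz_cases simp: T.pure_add_left T.pure_add_right)
    then obtain l where l: "abelian_group_hom D.T T.T l" and lp: "\<And>x d. x \<in> carrier M \<Longrightarrow> d \<in> carrier ?D \<Longrightarrow>
        l (pure_tensor R M ?D x d) = pure_tensor R M T x (snd (sqz_dec T (self_module T) d))"
      using D.universal[OF T.abelian_group_tensor] by blast
    have eps: "eps T \<in> carrier ?D" by simp
    have retract: "l (eps T \<odot>\<^bsub>D.T\<^esub> arr ?Q T ?D ?\<iota> w) = w" if "w \<in> carrier T.T" for w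
    proof (rule T.hom_eqI[OF abelian_group_hom_compose[OF abelian_group_hom_compose[OF
            hom[OF T sq.algebra_sqz sq.sqz_incl_in] D.smult_tensor(1)[OF eps]] l] _ _ that])
      show "abelian_group_hom T.T T.T (\<lambda>z. z)"
        by (intro abelian_group_homI' T.abelian_group_tensor) auto
      fix x t assume x: "x \<in> carrier M" and t: "t \<in> carrier T"
      then have "arr ?Q T ?D ?\<iota> (pure_tensor R M T x t) =
          pure_tensor R M ?D x (sqz_enc T (self_module T) (t, \<zero>\<^bsub>T\<^esub>))"
        using pure[OF T sq.algebra_sqz sq.sqz_incl_in x t] by (simp add: sqz_incl_def)
      then show "l (eps T \<odot>\<^bsub>D.T\<^esub> arr ?Q T ?D ?\<iota> (pure_tensor R M T x t)) = pure_tensor R M T x t"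
        using x t by (simp add: D.smult_tensor(2)[OF eps] lp)
    qed
    assume "eps T \<odot>\<^bsub>obj ?Q ?D\<^esub> arr ?Q T ?D ?\<iota> y = eps T \<odot>\<^bsub>obj ?Q ?D\<^esub> arr ?Q T ?D ?\<iota> z"
    then show "y = z" using retract yz by (metis quasi_coherent_simps)
  qed
  ultimately show ?thesis
    by (simp add: linear_target_def module_functor_quasi_coherent[OF M])
qed

section \<open>Quasi-coherent submodules\<close>

text \<open>The inverse comes from the balanced map sending \<open>x\<close> and \<open>r\<close> to
  \<open>r \<odot> x\<close>; every sum of pure tensors over \<open>R\<close> collapses to a single
  one.\<close>

lemma base_points:
  assumes M: "module R M"
  shows "bij_betw (\<lambda>x. pure_tensor R M (self_module R) x \<one>\<^bsub>R\<^esub>) (carrier M)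
    (carrier (tensor_module R M (self_module R)))"
proof -
  interpret M: module R M by (rule M)
  interpret T: tensor R M "self_module R"
    by (rule tensorI[OF M algebra_self_module[OF M.R.is_cring]])
  have "balanced R M (self_module R) M (\<lambda>x r. r \<odot>\<^bsub>M\<^esub> x)"
    by (rule balancedI) (auto simp: M.smult_l_distr M.smult_r_distr M.R.m_comm simp flip: M.smult_assoc1)
  then obtain l where l: "\<And>x r. x \<in> carrier M \<Longrightarrow> r \<in> carrier (self_module R) \<Longrightarrow> l (T.pure x r) = r \<odot>\<^bsub>M\<^esub> x"
    using T.universal[OF M.M.abelian_group_axioms] by blast
  show ?thesis
  proof (rule bij_betw_imageI)
    show "inj_on (\<lambda>x. T.pure x \<one>\<^bsub>R\<^esub>) (carrier M)"
      by (rule inj_on_inverseI[of _ l]) (simp add: l)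
    show "(\<lambda>x. T.pure x \<one>\<^bsub>R\<^esub>) ` carrier M = carrier T.T"
    proof (intro equalityI subsetI)
      fix z assume "z \<in> carrier T.T"
      then show "z \<in> (\<lambda>x. T.pure x \<one>\<^bsub>R\<^esub>) ` carrier M"
      proof (induction z rule: T.tensor_induct)
        case (pure x r)
        then show ?case
          using T.pure_smult[of r x "\<one>\<^bsub>R\<^esub>"] by (intro image_eqI[of _ _ "r \<odot>\<^bsub>M\<^esub> x"]) auto
      next
        case (add y z)
        then obtain a b where "a \<in> carrier M" "b \<in> carrier M" "y = T.pure a \<one>\<^bsub>R\<^esub>" "z = T.pure b \<one>\<^bsub>R\<^esub>"
          by blast
        then show ?case
          using T.pure_add_left[of a b "\<one>\<^bsub>R\<^esub>"] by (intro image_eqI[of _ _ "a \<oplus>\<^bsub>M\<^esub> b"]) auto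
      qed
    qed (use T.pure_closed in auto)
  qed
qed

lemma action_on_module:
  assumes M: "module R M" and \<sigma>: "set_morphism R F (End_functor R (quasi_coherent R M)) \<sigma>"
    and a: "a \<in> carrier (obj F (self_module R))" and x: "x \<in> carrier M"
  shows "action_on_module R M \<sigma> a x \<in> carrier M"
    and "pure_tensor R M (self_module R) (action_on_module R M \<sigma> a x) \<one>\<^bsub>R\<^esub> =
      act \<sigma> (self_module R) a (pure_tensor R M (self_module R) x \<one>\<^bsub>R\<^esub>)"
proof -
  interpret M: module R M by (rule M)
  let ?R = "self_module R"
  note R0 = algebra_self_module[OF M.R.is_cring]
  interpret T: tensor R M ?R by (rule tensorI[OF M R0])
  note bij = base_points[OF M]
  have in_T: "act \<sigma> ?R a (T.pure x \<one>\<^bsub>R\<^esub>) \<in> carrier T.T"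
    using act_set_morphism(2)[OF module_functor_quasi_coherent[OF M] \<sigma> R0 a] x by simp
  show "action_on_module R M \<sigma> a x \<in> carrier M"
    unfolding action_on_module_def
    using in_T the_inv_into_into[OF bij_betw_imp_inj_on[OF bij] _ subset_refl] bij_betw_imp_surj_on[OF bij]
    by blast
  show "T.pure (action_on_module R M \<sigma> a x) \<one>\<^bsub>R\<^esub> = act \<sigma> ?R a (T.pure x \<one>\<^bsub>R\<^esub>)"
    unfolding action_on_module_def using f_the_inv_into_f_bij_betw[OF bij] in_T by blast
qed

lemma quasi_coherent_incl:
  assumes M: "module R M" and N: "submodule N R M" and S: "algebra R S"
  shows "abelian_group_hom (tensor_module R (M\<lparr>carrier := N\<rparr>) S) (tensor_module R M S) (quasi_coherent_incl R M S)"
    and "\<And>x s. x \<in> N \<Longrightarrow> s \<in> carrier S \<Longrightarrow>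
      quasi_coherent_incl R M S (pure_tensor R (M\<lparr>carrier := N\<rparr>) S x s) = pure_tensor R M S x s"
proof -
  interpret M: module R M by (rule M)
  interpret N: submodule N R M by (rule N)
  have NM: "N \<subseteq> carrier M" using M.submoduleE(1)[OF N] .
  interpret T: tensor R M S by (rule tensorI[OF M S])
  interpret T': tensor R "M\<lparr>carrier := N\<rparr>" S by (rule tensorI[OF N.submodule_is_module[OF M] S])
  have "balanced R (M\<lparr>carrier := N\<rparr>) S T.T (\<lambda>x s. T.pure x s)"
    using NM by (intro balancedI) (auto simp: T.pure_add_left T.pure_add_right T.pure_smult subset_iff)
  note * = T'.tensor_map[OF T.tensor_axioms this, of "\<lambda>c. c"]
  \<comment> \<open>The inclusion is the identity on formal sums. Written as an extension from basis
    elements it has the form treated by the lemma \<open>tensor_map\<close>.\<close>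
  have eq: "c = frag_extend (\<lambda>(x, s). frag_of (x, s)) c" for c :: "'a \<times> 'a \<Rightarrow>\<^sub>0 int"
  proof -
    have "(\<lambda>(x, s). frag_of (x, s)) = (frag_of :: 'a \<times> 'a \<Rightarrow> _)" by auto
    then show ?thesis by (metis frag_expansion)
  qed
  show "abelian_group_hom T'.T T.T (quasi_coherent_incl R M S)"
    unfolding quasi_coherent_incl_def by (rule *(1)[OF _ _ eq]) (use NM in auto)
  show "quasi_coherent_incl R M S (T'.pure x s) = T.pure x s" if "x \<in> N" "s \<in> carrier S" for x s
    unfolding quasi_coherent_incl_def by (rule *(2)[OF _ _ eq]) (use NM that in auto)
qed

lemma quasi_coherent_incl_morphism:
  assumes M: "module R M" and N: "submodule N R M"
  shows "module_morphism R (quasi_coherent R (M\<lparr>carrier := N\<rparr>)) (quasi_coherent R M) (quasi_coherent_incl R M)"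
proof -
  interpret M: module R M by (rule M)
  interpret N: submodule N R M by (rule N)
  have NM: "\<And>x. x \<in> N \<Longrightarrow> x \<in> carrier M" using M.submoduleE(1)[OF N] by auto
  note M' = N.submodule_is_module[OF M]
  let ?M' = "M\<lparr>carrier := N\<rparr>"
  note incl = quasi_coherent_incl[OF M N]
  show ?thesis
    unfolding module_morphism_def set_morphism_def quasi_coherent_simps
  proof (intro conjI allI impI ballI)
    fix S :: "'a alg" assume S: "algebra R S"
    interpret S: tensor R M S by (rule tensorI[OF M S])
    interpret S': tensor R ?M' S by (rule tensorI[OF M' S])
    interpret i: abelian_group_hom S'.T S.T "quasi_coherent_incl R M S" by (rule incl(1)[OF S])
    show "quasi_coherent_incl R M S \<in> carrier S'.T \<rightarrow> carrier S.T" by auto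
    show "quasi_coherent_incl R M S (x \<oplus>\<^bsub>S'.T\<^esub> y) = quasi_coherent_incl R M S x \<oplus>\<^bsub>S.T\<^esub> quasi_coherent_incl R M S y"
      if "x \<in> carrier S'.T" "y \<in> carrier S'.T" for x y
      by (rule i.hom_add[OF that])
    fix s z assume s: "s \<in> carrier S" and z: "z \<in> carrier S'.T"
    show "quasi_coherent_incl R M S (s \<odot>\<^bsub>S'.T\<^esub> z) = s \<odot>\<^bsub>S.T\<^esub> quasi_coherent_incl R M S z"
      by (rule S'.hom_eqI[OF abelian_group_hom_compose[OF S'.smult_tensor(1)[OF s] incl(1)[OF S]]
            abelian_group_hom_compose[OF incl(1)[OF S] S.smult_tensor(1)[OF s]] _ z])
        (use s NM in \<open>simp add: S.smult_tensor(2) S'.smult_tensor(2) incl(2)[OF S]\<close>)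
  next
    fix S T :: "'a alg" and h z
    assume S: "algebra R S" and T: "algebra R T" and h: "h \<in> alg_hom R S T"
      and z: "z \<in> carrier (tensor_module R ?M' S)"
    interpret S': tensor R ?M' S by (rule tensorI[OF M' S])
    show "quasi_coherent_incl R M T (arr (quasi_coherent R ?M') S T h z) =
        arr (quasi_coherent R M) S T h (quasi_coherent_incl R M S z)"
      by (rule S'.hom_eqI[OF abelian_group_hom_compose[OF quasi_coherent_arr(1)[OF M' S T h] incl(1)[OF T]]
            abelian_group_hom_compose[OF incl(1)[OF S] quasi_coherent_arr(1)[OF M S T h]] _ z])
        (use NM alg_homD(4)[OF h] in \<open>simp add: incl(2)[OF S] incl(2)[OF T]
          quasi_coherent_arr(2)[OF M' S T h] quasi_coherent_arr(2)[OF M S T h]\<close>)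
  qed
qed

text \<open>Under the identification of \<open>base_points\<close> this is the inclusion of
  \<open>N\<close> in \<open>M\<close>. Over other algebras there may be a kernel, which is why
  identities in the submodule are verified over \<open>R\<close> first.\<close>

lemma quasi_coherent_incl_inj:
  assumes M: "module R M" and N: "submodule N R M"
  shows "inj_on (quasi_coherent_incl R M (self_module R)) (carrier (tensor_module R (M\<lparr>carrier := N\<rparr>) (self_module R)))"
proof (rule inj_onI)
  interpret M: module R M by (rule M)
  interpret N: submodule N R M by (rule N)
  have NM: "\<And>x. x \<in> N \<Longrightarrow> x \<in> carrier M" using M.submoduleE(1)[OF N] by auto
  let ?R = "self_module R" and ?M' = "M\<lparr>carrier := N\<rparr>"
  note R0 = algebra_self_module[OF M.R.is_cring]
  note incl = quasi_coherent_incl(2)[OF M N R0]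
  fix y z assume y: "y \<in> carrier (tensor_module R ?M' ?R)" and z: "z \<in> carrier (tensor_module R ?M' ?R)"
    and eq: "quasi_coherent_incl R M ?R y = quasi_coherent_incl R M ?R z"
  have surj: "\<exists>a\<in>N. u = pure_tensor R ?M' ?R a \<one>\<^bsub>R\<^esub>" if "u \<in> carrier (tensor_module R ?M' ?R)" for u
    using bij_betw_imp_surj_on[OF base_points[OF N.submodule_is_module[OF M]]] that by auto
  obtain a b where ab: "a \<in> N" "b \<in> N" "y = pure_tensor R ?M' ?R a \<one>\<^bsub>R\<^esub>" "z = pure_tensor R ?M' ?R b \<one>\<^bsub>R\<^esub>"
    using surj[OF y] surj[OF z] by blast
  then have "pure_tensor R M ?R a \<one>\<^bsub>R\<^esub> = pure_tensor R M ?R b \<one>\<^bsub>R\<^esub>"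
    using eq incl by simp
  then have "a = b"
    using bij_betw_imp_inj_on[OF base_points[OF M]] ab NM by (auto dest: inj_onD)
  then show "y = z" using ab by simp
qed

text \<open>A linear map \<open>d\<close> into an algebra \<open>D\<close> becomes a family of
  scalar forms on the base changes of \<open>M\<close>, indexed by \<open>D\<close>-algebras. A
  question about vectors turns into one about linear forms, to which density of evaluations
  applies.\<close>

lemma quasi_coherent_form:
  assumes M: "module R M" and D: "algebra R D" and d: "abelian_group_hom M D d"
    and lin: "\<And>r x. r \<in> carrier R \<Longrightarrow> x \<in> carrier M \<Longrightarrow> d (r \<odot>\<^bsub>M\<^esub> x) = r \<odot>\<^bsub>D\<^esub> d x"
  obtains l where "natural_linear R D (quasi_coherent R M) base_functor l"
    "\<And>T \<phi> x t. alg_over R D T \<phi> \<Longrightarrow> x \<in> carrier M \<Longrightarrow> t \<in> carrier T \<Longrightarrow>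
      l T \<phi> (pure_tensor R M T x t) = \<phi> (d x) \<otimes>\<^bsub>T\<^esub> t"
proof -
  interpret d: abelian_group_hom M D d by (rule d)
  define P :: "'a alg \<Rightarrow> ('a \<Rightarrow> 'a) \<Rightarrow> ('a tensor \<Rightarrow> 'a) \<Rightarrow> bool" where
    "P = (\<lambda>T \<phi> h. abelian_group_hom (tensor_module R M T) (self_module T) h \<and>
      (\<forall>x\<in>carrier M. \<forall>t\<in>carrier T. h (pure_tensor R M T x t) = \<phi> (d x) \<otimes>\<^bsub>T\<^esub> t))"
  \<comment> \<open>The universal property yields a form for each index separately. Since pure
    tensors determine it, the independent choices are compatible with base change.\<close>
  define l where "l = (\<lambda>T \<phi>. SOME h. P T \<phi> h)"
  have in_T: "\<phi> (d x) \<in> carrier T" if "alg_over R D T \<phi>" "x \<in> carrier M" for T \<phi> x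
    using alg_homD(4)[OF alg_overD(2)[OF that(1)]] that(2) by simp
  have "P T \<phi> (l T \<phi>)" if T: "alg_over R D T \<phi>" for T \<phi>
  proof -
    note T' = alg_overD[OF T]
    interpret T: tensor R M T by (rule tensorI[OF M T'(1)])
    have "balanced R M T (self_module T) (\<lambda>x t. \<phi> (d x) \<otimes>\<^bsub>T\<^esub> t)"
    proof (rule balancedI)
      fix r x t assume rxt: "r \<in> carrier R" "x \<in> carrier M" "t \<in> carrier T"
      note x = in_T[OF T rxt(2)]
      have "\<phi> (d (r \<odot>\<^bsub>M\<^esub> x)) \<otimes>\<^bsub>T\<^esub> t = r \<odot>\<^bsub>T\<^esub> (\<phi> (d x) \<otimes>\<^bsub>T\<^esub> t)"
        using rxt x by (simp add: lin alg_homD(8)[OF T'(2)] T.S.smult_assoc2)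
      also have "\<dots> = r \<odot>\<^bsub>T\<^esub> (t \<otimes>\<^bsub>T\<^esub> \<phi> (d x))" using rxt x by (simp add: T.S.m_comm)
      also have "\<dots> = \<phi> (d x) \<otimes>\<^bsub>T\<^esub> (r \<odot>\<^bsub>T\<^esub> t)"
        using rxt x by (simp add: T.S.m_comm flip: T.S.smult_assoc2)
      finally show "\<phi> (d (r \<odot>\<^bsub>M\<^esub> x)) \<otimes>\<^bsub>T\<^esub> t = \<phi> (d x) \<otimes>\<^bsub>T\<^esub> (r \<odot>\<^bsub>T\<^esub> t)" .
    qed (use in_T[OF T] in \<open>simp_all add: alg_homD(5)[OF T'(2)] T.S.l_distr T.S.r_distr\<close>)
    then obtain h where "abelian_group_hom T.T (self_module T) h"
      "\<And>x t. x \<in> carrier M \<Longrightarrow> t \<in> carrier T \<Longrightarrow> h (T.pure x t) = \<phi> (d x) \<otimes>\<^bsub>T\<^esub> t"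
      using T.universal[OF module_abelian_group[OF module_self_module[OF T.S.M_cring]]] by blast
    then have "P T \<phi> h" unfolding P_def by simp
    then have "\<exists>h. P T \<phi> h" by (rule exI[of "P T \<phi>" h])
    then show ?thesis unfolding l_def by (rule someI_ex)
  qed
  then have hom: "abelian_group_hom (tensor_module R M T) (self_module T) (l T \<phi>)"
    and pure: "\<And>x t. x \<in> carrier M \<Longrightarrow> t \<in> carrier T \<Longrightarrow> l T \<phi> (pure_tensor R M T x t) = \<phi> (d x) \<otimes>\<^bsub>T\<^esub> t"
    if "alg_over R D T \<phi>" for T \<phi>
    using that unfolding P_def by blast+
  have "natural_linear R D (quasi_coherent R M) base_functor l"
    unfolding natural_linear_def quasi_coherent_simps base_functor_simps
  proof (intro conjI allI impI ballI)
    fix T \<phi> assume T: "alg_over R D T \<phi>"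
    note T' = alg_overD[OF T]
    interpret T: tensor R M T by (rule tensorI[OF M T'(1)])
    interpret l: abelian_group_hom T.T "self_module T" "l T \<phi>" by (rule hom[OF T])
    show "l T \<phi> z \<in> carrier (self_module T)" if "z \<in> carrier T.T" for z using that by (rule l.hom_closed)
    show "l T \<phi> (y \<oplus>\<^bsub>T.T\<^esub> z) = l T \<phi> y \<oplus>\<^bsub>self_module T\<^esub> l T \<phi> z"
      if "y \<in> carrier T.T" "z \<in> carrier T.T" for y z using that by (rule l.hom_add)
    fix t z assume t: "t \<in> carrier T" and z: "z \<in> carrier T.T"
    show "l T \<phi> (t \<odot>\<^bsub>T.T\<^esub> z) = t \<odot>\<^bsub>self_module T\<^esub> l T \<phi> z"
      by (rule T.hom_eqI[OF abelian_group_hom_compose[OF T.smult_tensor(1)[OF t] hom[OF T]]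
            abelian_group_hom_compose[OF hom[OF T] module_smult_hom[OF module_self_module[OF T.S.M_cring] t]] _ z])
        (use t in_T[OF T] in \<open>simp add: T.smult_tensor(2) pure[OF T] T.S.m_lcomm\<close>)
  next
    fix T \<phi> U h z assume T: "alg_over R D T \<phi>" and U: "alg_over R T U h" and z: "z \<in> carrier (tensor_module R M T)"
    note T' = alg_overD[OF T] and U' = alg_overD[OF U] and DU = alg_over_compose[OF D T U]
    interpret T: tensor R M T by (rule tensorI[OF M T'(1)])
    have h: "abelian_group_hom (self_module T) (self_module U) h"
    proof -
      interpret h: abelian_group_hom T U h by (rule alg_hom_abelian_group_hom[OF T'(1) U'])
      show ?thesis
        using module_abelian_group[OF module_self_module[OF algebra_cring[OF T'(1)]]]
          module_abelian_group[OF module_self_module[OF algebra_cring[OF U'(1)]]]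
        by (intro abelian_group_homI') auto
    qed
    show "l U (compose (carrier D) h \<phi>) (arr (quasi_coherent R M) T U h z) = h (l T \<phi> z)"
      by (rule T.hom_eqI[OF abelian_group_hom_compose[OF quasi_coherent_arr(1)[OF M T'(1) U'] hom[OF DU]]
            abelian_group_hom_compose[OF hom[OF T] h] _ z])
        (use in_T[OF T] in \<open>simp add: quasi_coherent_arr(2)[OF M T'(1) U'] pure[OF T] pure[OF DU]
          compose_eq alg_homD(4,6)[OF U'(2)]\<close>)
  qed
  then show thesis using pure by (rule that)
qed

text \<open>
  The quotient of a module by a submodule, carried by a set of representatives so that it stays
  in the universe.
\<close>

definition coset_rep :: "('u, 'u) module \<Rightarrow> 'u set \<Rightarrow> 'u \<Rightarrow> 'u" where
  "coset_rep M N x = (SOME y. y \<in> carrier M \<and> x \<ominus>\<^bsub>M\<^esub> y \<in> N)"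

definition quotient_module :: "('u, 'u) module \<Rightarrow> 'u set \<Rightarrow> ('u, 'u) module" where
  "quotient_module M N = \<lparr>carrier = coset_rep M N ` carrier M, monoid.mult = undefined, one = undefined,
     ring.zero = coset_rep M N \<zero>\<^bsub>M\<^esub>,
     add = (\<lambda>x y. coset_rep M N (x \<oplus>\<^bsub>M\<^esub> y)),
     smult = (\<lambda>r x. coset_rep M N (r \<odot>\<^bsub>M\<^esub> x))\<rparr>"

locale quotient =
  fixes R :: "'u ring" and M :: "('u, 'u) module" and N :: "'u set"
  assumes M_module: "module R M" and N_submodule: "submodule N R M"
begin

sublocale M: module R M by (rule M_module)

abbreviation "p \<equiv> coset_rep M N"
abbreviation "Q \<equiv> quotient_module M N"

lemma N: "x \<in> N \<Longrightarrow> x \<in> carrier M" "x \<in> N \<Longrightarrow> \<ominus>\<^bsub>M\<^esub> x \<in> N" "x \<in> N \<Longrightarrow> y \<in> N \<Longrightarrow> x \<oplus>\<^bsub>M\<^esub> y \<in> N"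
    "r \<in> carrier R \<Longrightarrow> x \<in> N \<Longrightarrow> r \<odot>\<^bsub>M\<^esub> x \<in> N" "\<zero>\<^bsub>M\<^esub> \<in> N"
proof -
  show "x \<in> N \<Longrightarrow> x \<in> carrier M" using M.submoduleE(1)[OF N_submodule] by auto
  show "x \<in> N \<Longrightarrow> \<ominus>\<^bsub>M\<^esub> x \<in> N" "x \<in> N \<Longrightarrow> y \<in> N \<Longrightarrow> x \<oplus>\<^bsub>M\<^esub> y \<in> N"
    "r \<in> carrier R \<Longrightarrow> x \<in> N \<Longrightarrow> r \<odot>\<^bsub>M\<^esub> x \<in> N"
    using M.submoduleE[OF N_submodule] by auto
  interpret N: submodule N R M by (rule N_submodule)
  show "\<zero>\<^bsub>M\<^esub> \<in> N" using N.one_closed by simp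
qed

lemma p:
  assumes "x \<in> carrier M"
  shows "p x \<in> carrier M" "x \<ominus>\<^bsub>M\<^esub> p x \<in> N"
proof -
  have "\<exists>y. y \<in> carrier M \<and> x \<ominus>\<^bsub>M\<^esub> y \<in> N"
    using assms N(5) by (intro exI[of _ x]) (simp add: M.minus_eq M.r_neg)
  from someI_ex[OF this] show "p x \<in> carrier M" "x \<ominus>\<^bsub>M\<^esub> p x \<in> N" by (simp_all add: coset_rep_def)
qed

text \<open>Congruent elements satisfy the same predicate under \<open>SOME\<close>, hence receive
  literally the same representative; \<open>shift\<close> is the transitivity behind this.\<close>

lemma p_eqI:
  assumes "x \<in> carrier M" "y \<in> carrier M" "x \<ominus>\<^bsub>M\<^esub> y \<in> N"
  shows "p x = p y"
proof -
  have shift: "u \<ominus>\<^bsub>M\<^esub> z \<in> N" if "u \<in> carrier M" "v \<in> carrier M" "z \<in> carrier M" "u \<ominus>\<^bsub>M\<^esub> v \<in> N" "v \<ominus>\<^bsub>M\<^esub> z \<in> N" for u v z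
  proof -
    have "u \<ominus>\<^bsub>M\<^esub> z = (u \<ominus>\<^bsub>M\<^esub> v) \<oplus>\<^bsub>M\<^esub> (v \<ominus>\<^bsub>M\<^esub> z)"
      using that(1-3) by (simp add: M.minus_eq M.a_assoc M.r_neg1)
    then show ?thesis using N(3)[OF that(4,5)] by simp
  qed
  have "y \<ominus>\<^bsub>M\<^esub> x = \<ominus>\<^bsub>M\<^esub> (x \<ominus>\<^bsub>M\<^esub> y)"
    using assms(1,2) by (simp add: M.minus_eq M.minus_add M.a_comm)
  then have "y \<ominus>\<^bsub>M\<^esub> x \<in> N" using N(2)[OF assms(3)] by simp
  then have "z \<in> carrier M \<and> x \<ominus>\<^bsub>M\<^esub> z \<in> N \<longleftrightarrow> z \<in> carrier M \<and> y \<ominus>\<^bsub>M\<^esub> z \<in> N" for z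
    using shift assms by blast
  then show ?thesis by (simp add: coset_rep_def)
qed

lemma p_eq_zero_iff:
  assumes "x \<in> carrier M"
  shows "p x = p \<zero>\<^bsub>M\<^esub> \<longleftrightarrow> x \<in> N"
proof
  assume "x \<in> N"
  then show "p x = p \<zero>\<^bsub>M\<^esub>" using assms by (intro p_eqI) (simp_all add: M.minus_eq M.add.inv_one[folded a_inv_def])
next
  assume eq: "p x = p \<zero>\<^bsub>M\<^esub>"
  have "\<zero>\<^bsub>M\<^esub> \<ominus>\<^bsub>M\<^esub> p x \<in> N" using p(2)[of "\<zero>\<^bsub>M\<^esub>"] eq by simp
  then have "\<ominus>\<^bsub>M\<^esub> p x \<in> N" using p(1)[OF assms] by (simp add: M.minus_eq)
  from N(2)[OF this] have "p x \<in> N" using p(1)[OF assms] by simp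
  then have "(x \<ominus>\<^bsub>M\<^esub> p x) \<oplus>\<^bsub>M\<^esub> p x \<in> N" using p[OF assms] N(3) by simp
  then show "x \<in> N" using p(1)[OF assms] assms by (simp add: M.minus_eq M.a_assoc M.l_neg)
qed

lemma p_add:
  assumes "x \<in> carrier M" "y \<in> carrier M"
  shows "p x \<oplus>\<^bsub>Q\<^esub> p y = p (x \<oplus>\<^bsub>M\<^esub> y)"
proof -
  have "(x \<oplus>\<^bsub>M\<^esub> y) \<ominus>\<^bsub>M\<^esub> (p x \<oplus>\<^bsub>M\<^esub> p y) = (x \<ominus>\<^bsub>M\<^esub> p x) \<oplus>\<^bsub>M\<^esub> (y \<ominus>\<^bsub>M\<^esub> p y)"
    using assms p by (simp add: M.minus_eq M.minus_add M.a_ac)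
  then have "(x \<oplus>\<^bsub>M\<^esub> y) \<ominus>\<^bsub>M\<^esub> (p x \<oplus>\<^bsub>M\<^esub> p y) \<in> N" using N(3) p(2) assms by simp
  then show ?thesis using p_eqI[of "x \<oplus>\<^bsub>M\<^esub> y" "p x \<oplus>\<^bsub>M\<^esub> p y"] assms p by (simp add: quotient_module_def)
qed

lemma p_smult:
  assumes "r \<in> carrier R" "x \<in> carrier M"
  shows "r \<odot>\<^bsub>Q\<^esub> p x = p (r \<odot>\<^bsub>M\<^esub> x)"
proof -
  have "(r \<odot>\<^bsub>M\<^esub> x) \<ominus>\<^bsub>M\<^esub> (r \<odot>\<^bsub>M\<^esub> p x) = r \<odot>\<^bsub>M\<^esub> (x \<ominus>\<^bsub>M\<^esub> p x)"
    using assms p by (simp add: M.minus_eq M.smult_r_distr M.smult_r_minus)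
  then have "(r \<odot>\<^bsub>M\<^esub> x) \<ominus>\<^bsub>M\<^esub> (r \<odot>\<^bsub>M\<^esub> p x) \<in> N" using N(4) p(2) assms by simp
  then show ?thesis using p_eqI[of "r \<odot>\<^bsub>M\<^esub> x" "r \<odot>\<^bsub>M\<^esub> p x"] assms p by (simp add: quotient_module_def)
qed

lemma carrier_Q: "carrier Q = p ` carrier M" and zero_Q: "\<zero>\<^bsub>Q\<^esub> = p \<zero>\<^bsub>M\<^esub>"
  by (simp_all add: quotient_module_def)

text \<open>The base is written \<open>self_module R\<close> because the square-zero construction
  takes its base ring in the form of an \<open>R\<close>-algebra.\<close>

lemma module_quotient: "module (self_module R) Q"
proof (rule moduleI)
  show "cring (self_module R)" by (rule cring_self_module[OF M.R.is_cring])
  show "abelian_group Q"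
  proof (rule abelian_groupI)
    fix x assume "x \<in> carrier Q"
    then obtain a where "a \<in> carrier M" "x = p a" by (auto simp: carrier_Q)
    then show "\<exists>y\<in>carrier Q. y \<oplus>\<^bsub>Q\<^esub> x = \<zero>\<^bsub>Q\<^esub>"
      by (intro bexI[of _ "p (\<ominus>\<^bsub>M\<^esub> a)"]) (auto simp: carrier_Q zero_Q p_add M.l_neg)
  qed (auto simp: carrier_Q zero_Q p_add M.a_ac)
qed (auto simp: carrier_Q p_add p_smult M.smult_l_distr M.smult_r_distr M.smult_assoc1)

end

text \<open>
  The class of \<open>a x\<close> in \<open>M / N\<close> is detected by the universal linear form on \<open>M / N\<close>, with values
  in its square-zero extension; that form vanishes at evaluations, hence everywhere.
\<close>

lemma G_submodule_stable:
  fixes M :: "('u, 'u) module"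
  assumes inf: "infinite (UNIV :: 'u set)" and R: "cring (R :: 'u ring)"
    and G: "monoid_functor R G" and AG: "essentially_free R (function_functor R G)"
    and A: "dual_algebra R G A" and M: "module R M"
    and \<theta>: "extends_action R G A (quasi_coherent R M) \<tau> \<theta>"
    and N: "quasi_coherent_G_submodule R G M \<tau> N"
    and a: "a \<in> carrier (obj A (self_module R))" and x: "x \<in> N"
  shows "action_on_module R M \<theta> a x \<in> N"
proof -
  let ?R = "self_module R" and ?Q = "quasi_coherent R M" and ?M' = "M\<lparr>carrier := N\<rparr>"
  have sub: "submodule N R M" using N by (simp add: quasi_coherent_G_submodule_def)
  obtain \<rho>' where \<rho>': "G_module R G (quasi_coherent R ?M') \<rho>'"
    and incl_G: "G_module_morphism R G (quasi_coherent R ?M') \<rho>' ?Q \<tau> (quasi_coherent_incl R M)"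
    using N unfolding quasi_coherent_G_submodule_def by blast
  interpret q: quotient R M N by (rule quotient.intro[OF M sub])
  have M': "module R ?M'" using submodule.submodule_is_module[OF sub M] .
  have R0: "algebra R ?R" by (rule algebra_self_module[OF R])
  interpret D: square_zero R ?R q.Q
    by (rule square_zero.intro[OF R0 q.module_quotient inj_pair_universe[OF inf]])
  define D where "D = sqz ?R q.Q"
  \<comment> \<open>The class of \<open>y\<close>, placed in the square-zero ideal: an
    \<open>R\<close>-linear map into an algebra, with kernel exactly \<open>N\<close>.\<close>
  define d where "d = (\<lambda>y. sqz_enc ?R q.Q (\<zero>\<^bsub>R\<^esub>, q.p y))"
  have D: "algebra R D" unfolding D_def by (rule D.algebra_sqz)
  have pQ: "q.p y \<in> carrier q.Q" if "y \<in> carrier M" for y using that by (simp add: q.carrier_Q)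
  have d_hom: "abelian_group_hom M D d"
    using D.abelian_group_sqz pQ
    by (intro abelian_group_homI') (auto simp: d_def D_def q.p_add q.M.abelian_group_axioms)
  have d_lin: "d (r \<odot>\<^bsub>M\<^esub> y) = r \<odot>\<^bsub>D\<^esub> d y" if "r \<in> carrier R" "y \<in> carrier M" for r y
    using that pQ by (simp add: d_def D_def q.p_smult)
  have d_zero: "d y = \<zero>\<^bsub>D\<^esub> \<longleftrightarrow> y \<in> N" if "y \<in> carrier M" for y
    using that pQ q.p_eq_zero_iff[OF that] D.E.M.zero_closed by (simp add: d_def D_def q.zero_Q)
  obtain l where l: "natural_linear R D ?Q base_functor l"
    and l_pure: "\<And>T \<phi> y t. alg_over R D T \<phi> \<Longrightarrow> y \<in> carrier M \<Longrightarrow> t \<in> carrier T \<Longrightarrow>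
      l T \<phi> (pure_tensor R M T y t) = \<phi> (d y) \<otimes>\<^bsub>T\<^esub> t"
    using quasi_coherent_form[OF M D d_hom d_lin] by blast
  obtain J \<K> c where c: "coordinates R (function_functor R G) J \<K> c"
    using essentially_free_coordinates[OF inf R AG] .
  obtain m e where AF: "module_functor R A" using dual_algebraD[OF A] by blast
  have GS: "set_functor R G" using G by (simp add: monoid_functor_def)
  have QF: "module_functor R ?Q" by (rule module_functor_quasi_coherent[OF M])
  have xM: "x \<in> carrier M" using q.N(1)[OF x] .
  interpret TD: tensor R M D by (rule tensorI[OF M D])
  have xD: "pure_tensor R M D x \<one>\<^bsub>D\<^esub> \<in> carrier (obj ?Q D)" using xM by simp
  note w = natural_linear_compose[OF natural_pairing_left[OF act_pairing[OF QF \<theta>] QF D xD] l]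
  have zero: "natural_linear R D A base_functor (\<lambda>T \<phi> a. \<zero>\<^bsub>T\<^esub>)"
  proof (rule natural_linearI)
    fix T \<phi> assume T: "alg_over R D T \<phi>"
    interpret T: cring T by (rule algebra_cring[OF alg_overD(1)[OF T]])
    show "\<zero>\<^bsub>T\<^esub> \<in> carrier (obj base_functor T)" "\<zero>\<^bsub>T\<^esub> = \<zero>\<^bsub>T\<^esub> \<oplus>\<^bsub>obj base_functor T\<^esub> \<zero>\<^bsub>T\<^esub>" by simp_all
    show "\<zero>\<^bsub>T\<^esub> = t \<odot>\<^bsub>obj base_functor T\<^esub> \<zero>\<^bsub>T\<^esub>" if "t \<in> carrier T" for t
      using that by simp
    show "\<zero>\<^bsub>U\<^esub> = arr base_functor T U h \<zero>\<^bsub>T\<^esub>" if "alg_over R T U h" for U h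
      using alg_hom_zero[OF alg_overD(1)[OF T] alg_overD[OF that]] by simp
  qed
  have vanish: "l T \<phi> (act \<theta> T b (arr ?Q D T \<phi> (pure_tensor R M D x \<one>\<^bsub>D\<^esub>))) = \<zero>\<^bsub>T\<^esub>"
    if T: "alg_over R D T \<phi>" and b: "b \<in> carrier (obj A T)" for T \<phi> b
  proof (rule evaluation_dense[OF GS c A D w zero _ T b])
    fix T \<phi> g assume T: "alg_over R D T \<phi>" and g: "g \<in> carrier (obj G T)"
    note T' = alg_overD[OF T]
    interpret T: tensor R M T by (rule tensorI[OF M T'(1)])
    interpret T'': tensor R ?M' T by (rule tensorI[OF M' T'(1)])
    \<comment> \<open>Since \<open>x\<close> lies in \<open>N\<close>, its base change comes from
      the submodule, on which \<open>g\<close> acts through \<open>\<rho>'\<close>; the result stays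
      in the image of the inclusion.\<close>
    have one: "arr ?Q D T \<phi> (pure_tensor R M D x \<one>\<^bsub>D\<^esub>) =
        quasi_coherent_incl R M T (T''.pure x \<one>\<^bsub>T\<^esub>)"
      using quasi_coherent_arr(2)[OF M D T' xM TD.S.one_closed] alg_homD(7)[OF T'(2)]
        quasi_coherent_incl(2)[OF M sub T'(1) x] by simp
    have x1: "T''.pure x \<one>\<^bsub>T\<^esub> \<in> carrier T''.T" using x by simp
    have set: "set_morphism R G (End_functor R (quasi_coherent R ?M')) \<rho>'"
      using \<rho>' unfolding G_module_def monoid_morphism_def by blast
    have in_T: "act \<rho>' T g (T''.pure x \<one>\<^bsub>T\<^esub>) \<in> carrier T''.T"
      using act_set_morphism(2)[OF module_functor_quasi_coherent[OF M'] set T'(1) g] x1 by simp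
    have "act \<theta> T (evaluation R G T g) (quasi_coherent_incl R M T (T''.pure x \<one>\<^bsub>T\<^esub>)) =
        quasi_coherent_incl R M T (act \<rho>' T g (T''.pure x \<one>\<^bsub>T\<^esub>))"
      using incl_G T'(1) g x1 extends_actionD(2)[OF \<theta> T'(1) g] unfolding G_module_morphism_def by simp
    \<comment> \<open>On a pure tensor of \<open>y\<close> in \<open>N\<close> the form has the
      factor \<open>\<phi> (d y)\<close>, which is zero.\<close>
    moreover have "l T \<phi> (quasi_coherent_incl R M T z) = \<zero>\<^bsub>T\<^esub>" if z: "z \<in> carrier T''.T" for z
    proof -
      have l_hom: "abelian_group_hom T.T (self_module T) (l T \<phi>)"
        using natural_linear_hom[OF QF module_functor_base[OF R] l T] by simp
      have "abelian_group (self_module T)"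
        using module_abelian_group[OF module_self_module[OF T.S.M_cring]] .
      then have zero_hom: "abelian_group_hom T''.T (self_module T) (\<lambda>z. \<zero>\<^bsub>T\<^esub>)"
        by (intro abelian_group_homI' T''.abelian_group_tensor) auto
      show ?thesis
      proof (rule T''.hom_eqI[OF abelian_group_hom_compose[OF quasi_coherent_incl(1)[OF M sub T'(1)] l_hom] zero_hom _ z])
        fix y t assume "y \<in> carrier ?M'" and t: "t \<in> carrier T"
        then have y: "y \<in> N" by simp
        then have "d y = \<zero>\<^bsub>D\<^esub>" using d_zero q.N(1) by blast
        then show "l T \<phi> (quasi_coherent_incl R M T (T''.pure y t)) = \<zero>\<^bsub>T\<^esub>"
          using quasi_coherent_incl(2)[OF M sub T'(1) y t] l_pure[OF T q.N(1)[OF y] t]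
            alg_hom_zero[OF D T'] t by simp
      qed
    qed
    ultimately show "l T \<phi> (act \<theta> T (evaluation R G T g) (arr ?Q D T \<phi> (pure_tensor R M D x \<one>\<^bsub>D\<^esub>))) = \<zero>\<^bsub>T\<^esub>"
      using one in_T by simp
  qed
  let ?ax = "action_on_module R M \<theta> a x"
  note ax = action_on_module[OF M extends_actionD(1)[OF \<theta>] a xM]
  note u = unit_hom_in[OF D]
  have one_u: "unit_hom R D \<one>\<^bsub>R\<^esub> = \<one>\<^bsub>D\<^esub>" using alg_homD(7)[OF u] by simp
  have R1: "\<one>\<^bsub>R\<^esub> \<in> carrier (self_module R)" using R by (simp add: cring.cring_simprules)
  have point: "pure_tensor R M D y \<one>\<^bsub>D\<^esub> = arr ?Q ?R D (unit_hom R D) (pure_tensor R M ?R y \<one>\<^bsub>R\<^esub>)"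
    if "y \<in> carrier M" for y
    using quasi_coherent_arr(2)[OF M R0 D u that R1] one_u by simp
  interpret TR: tensor R M ?R by (rule tensorI[OF M R0])
  have x1: "pure_tensor R M ?R x \<one>\<^bsub>R\<^esub> \<in> carrier (obj ?Q ?R)" using xM R1 by simp
  \<comment> \<open>With \<open>a\<close> base changed to \<open>D\<close>, the vanishing is read at
    the identity of \<open>D\<close>, where the form returns \<open>d\<close> of \<open>a x\<close>
    itself.\<close>
  let ?b = "arr A ?R D (unit_hom R D) a"
  have "act \<theta> D ?b (pure_tensor R M D x \<one>\<^bsub>D\<^esub>) = pure_tensor R M D ?ax \<one>\<^bsub>D\<^esub>"
    using act_set_morphism(6)[OF QF extends_actionD(1)[OF \<theta>] R0 D u a x1] point[OF xM] point[OF ax(1)] ax(2) by simp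
  moreover have "arr ?Q D D (id_hom D) (pure_tensor R M D x \<one>\<^bsub>D\<^esub>) = pure_tensor R M D x \<one>\<^bsub>D\<^esub>"
    using module_functorD(5)[OF QF D xD] .
  moreover have "?b \<in> carrier (obj A D)" using module_functorD(3)[OF AF R0 D u a] .
  ultimately have "l D (id_hom D) (pure_tensor R M D ?ax \<one>\<^bsub>D\<^esub>) = \<zero>\<^bsub>D\<^esub>"
    using vanish[OF alg_over_id[OF D], of ?b] by simp
  moreover have "d ?ax \<in> carrier D" using abelian_group_hom.hom_closed[OF d_hom ax(1)] .
  ultimately have "d ?ax = \<zero>\<^bsub>D\<^esub>"
    using l_pure[OF alg_over_id[OF D] ax(1) TD.S.one_closed] by simp
  then show ?thesis using d_zero[OF ax(1)] by simp
qed

section \<open>Sums and multiples of natural linear maps, products in an algebra functor\<close>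

lemma natural_linear_add:
  assumes Q: "module_functor R Q" and w: "natural_linear R S L Q w" and v: "natural_linear R S L Q v"
  shows "natural_linear R S L Q (\<lambda>T \<phi> x. w T \<phi> x \<oplus>\<^bsub>obj Q T\<^esub> v T \<phi> x)"
proof (rule natural_linearI)
  fix T \<phi> assume T: "alg_over R S T \<phi>"
  note T' = alg_overD[OF T] and w' = natural_linearD(1-3)[OF w T] and v' = natural_linearD(1-3)[OF v T]
  interpret Q: module T "obj Q T" by (rule module_functorD(1)[OF Q T'(1)])
  show "w T \<phi> x \<oplus>\<^bsub>obj Q T\<^esub> v T \<phi> x \<in> carrier (obj Q T)" if "x \<in> carrier (obj L T)" for x
    using w'(1) v'(1) that by simp
  show "w T \<phi> (x \<oplus>\<^bsub>obj L T\<^esub> y) \<oplus>\<^bsub>obj Q T\<^esub> v T \<phi> (x \<oplus>\<^bsub>obj L T\<^esub> y) =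
      w T \<phi> x \<oplus>\<^bsub>obj Q T\<^esub> v T \<phi> x \<oplus>\<^bsub>obj Q T\<^esub> (w T \<phi> y \<oplus>\<^bsub>obj Q T\<^esub> v T \<phi> y)"
    if "x \<in> carrier (obj L T)" "y \<in> carrier (obj L T)" for x y
    using w' v' that by (simp add: Q.M.a_ac)
  show "w T \<phi> (t \<odot>\<^bsub>obj L T\<^esub> x) \<oplus>\<^bsub>obj Q T\<^esub> v T \<phi> (t \<odot>\<^bsub>obj L T\<^esub> x) =
      t \<odot>\<^bsub>obj Q T\<^esub> (w T \<phi> x \<oplus>\<^bsub>obj Q T\<^esub> v T \<phi> x)"
    if "t \<in> carrier T" "x \<in> carrier (obj L T)" for t x
    using w' v' that by (simp add: Q.smult_r_distr)
  fix U h x assume U: "alg_over R T U h" and x: "x \<in> carrier (obj L T)"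
  note U' = alg_overD[OF U]
  interpret h: abelian_group_hom "obj Q T" "obj Q U" "arr Q T U h" by (rule module_functorD(2)[OF Q T'(1) U'])
  show "w U (compose (carrier S) h \<phi>) (arr L T U h x) \<oplus>\<^bsub>obj Q U\<^esub> v U (compose (carrier S) h \<phi>) (arr L T U h x) =
      arr Q T U h (w T \<phi> x \<oplus>\<^bsub>obj Q T\<^esub> v T \<phi> x)"
    using natural_linearD(4)[OF w T U x] natural_linearD(4)[OF v T U x] w'(1)[OF x] v'(1)[OF x] by simp
qed

lemma natural_linear_smult:
  assumes Q: "module_functor R Q" and S: "algebra R S" and w: "natural_linear R S L Q w" and s: "s \<in> carrier S"
  shows "natural_linear R S L Q (\<lambda>T \<phi> x. \<phi> s \<odot>\<^bsub>obj Q T\<^esub> w T \<phi> x)"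
proof (rule natural_linearI)
  fix T \<phi> assume T: "alg_over R S T \<phi>"
  note T' = alg_overD[OF T] and w' = natural_linearD(1-3)[OF w T]
  interpret Q: module T "obj Q T" by (rule module_functorD(1)[OF Q T'(1)])
  have \<phi>s: "\<phi> s \<in> carrier T" by (rule alg_homD(4)[OF T'(2) s])
  show "\<phi> s \<odot>\<^bsub>obj Q T\<^esub> w T \<phi> x \<in> carrier (obj Q T)" if "x \<in> carrier (obj L T)" for x
    using w'(1) that \<phi>s by simp
  show "\<phi> s \<odot>\<^bsub>obj Q T\<^esub> w T \<phi> (x \<oplus>\<^bsub>obj L T\<^esub> y) =
      \<phi> s \<odot>\<^bsub>obj Q T\<^esub> w T \<phi> x \<oplus>\<^bsub>obj Q T\<^esub> \<phi> s \<odot>\<^bsub>obj Q T\<^esub> w T \<phi> y"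
    if "x \<in> carrier (obj L T)" "y \<in> carrier (obj L T)" for x y
    using w' that \<phi>s by (simp add: Q.smult_r_distr)
  show "\<phi> s \<odot>\<^bsub>obj Q T\<^esub> w T \<phi> (t \<odot>\<^bsub>obj L T\<^esub> x) = t \<odot>\<^bsub>obj Q T\<^esub> (\<phi> s \<odot>\<^bsub>obj Q T\<^esub> w T \<phi> x)"
    if "t \<in> carrier T" "x \<in> carrier (obj L T)" for t x
    using w' that \<phi>s by (simp add: Q.R.m_comm flip: Q.smult_assoc1)
  fix U h x assume U: "alg_over R T U h" and x: "x \<in> carrier (obj L T)"
  note U' = alg_overD[OF U]
  show "compose (carrier S) h \<phi> s \<odot>\<^bsub>obj Q U\<^esub> w U (compose (carrier S) h \<phi>) (arr L T U h x) =
      arr Q T U h (\<phi> s \<odot>\<^bsub>obj Q T\<^esub> w T \<phi> x)"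
    using natural_linearD(4)[OF w T U x] module_functorD(4)[OF Q T'(1) U' \<phi>s w'(1)[OF x]] s
    by (simp add: compose_eq)
qed

text \<open>Scalars enter the product through the elements \<open>s \<odot> \<one>\<close>; their
  centrality lets them pass to either factor, which makes the product bilinear.\<close>

lemma algebra_functorD:
  assumes A: "algebra_functor R A"
  shows "module_functor R A" "algebra R S \<Longrightarrow> ring (obj A S)"
    and "algebra R S \<Longrightarrow> algebra R T \<Longrightarrow> h \<in> alg_hom R S T \<Longrightarrow> arr A S T h \<in> ring_hom (obj A S) (obj A T)"
    and "algebra R S \<Longrightarrow> s \<in> carrier S \<Longrightarrow> a \<in> carrier (obj A S) \<Longrightarrow> b \<in> carrier (obj A S) \<Longrightarrow>
      (s \<odot>\<^bsub>obj A S\<^esub> a) \<otimes>\<^bsub>obj A S\<^esub> b = s \<odot>\<^bsub>obj A S\<^esub> (a \<otimes>\<^bsub>obj A S\<^esub> b)"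
    and "algebra R S \<Longrightarrow> s \<in> carrier S \<Longrightarrow> a \<in> carrier (obj A S) \<Longrightarrow> b \<in> carrier (obj A S) \<Longrightarrow>
      a \<otimes>\<^bsub>obj A S\<^esub> (s \<odot>\<^bsub>obj A S\<^esub> b) = s \<odot>\<^bsub>obj A S\<^esub> (a \<otimes>\<^bsub>obj A S\<^esub> b)"
proof -
  show AF: "module_functor R A" using A by (simp add: algebra_functor_def)
  show ring: "ring (obj A S)" if "algebra R S" for S using A that by (simp add: algebra_functor_def)
  show "algebra R S \<Longrightarrow> algebra R T \<Longrightarrow> h \<in> alg_hom R S T \<Longrightarrow> arr A S T h \<in> ring_hom (obj A S) (obj A T)"
    using A by (simp add: algebra_functor_def)
  assume S: "algebra R S" and s: "s \<in> carrier S" and a: "a \<in> carrier (obj A S)" and b: "b \<in> carrier (obj A S)"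
  interpret A: ring "obj A S" by (rule ring[OF S])
  interpret AM: module S "obj A S" by (rule module_functorD(1)[OF AF S])
  define z where "z = s \<odot>\<^bsub>obj A S\<^esub> \<one>\<^bsub>obj A S\<^esub>"
  have z: "z \<in> carrier (obj A S)" using s by (simp add: z_def)
  have central: "z \<otimes>\<^bsub>obj A S\<^esub> y = y \<otimes>\<^bsub>obj A S\<^esub> z" and smult: "s \<odot>\<^bsub>obj A S\<^esub> y = z \<otimes>\<^bsub>obj A S\<^esub> y"
    if "y \<in> carrier (obj A S)" for y
    using A S s that unfolding algebra_functor_def z_def by blast+
  show "(s \<odot>\<^bsub>obj A S\<^esub> a) \<otimes>\<^bsub>obj A S\<^esub> b = s \<odot>\<^bsub>obj A S\<^esub> (a \<otimes>\<^bsub>obj A S\<^esub> b)"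
    using a b z by (simp add: smult A.m_assoc)
  have "a \<otimes>\<^bsub>obj A S\<^esub> (s \<odot>\<^bsub>obj A S\<^esub> b) = (a \<otimes>\<^bsub>obj A S\<^esub> z) \<otimes>\<^bsub>obj A S\<^esub> b"
    using a b z by (simp add: smult A.m_assoc)
  also have "\<dots> = s \<odot>\<^bsub>obj A S\<^esub> (a \<otimes>\<^bsub>obj A S\<^esub> b)"
    using a b z by (simp add: smult A.m_assoc flip: central)
  finally show "a \<otimes>\<^bsub>obj A S\<^esub> (s \<odot>\<^bsub>obj A S\<^esub> b) = s \<odot>\<^bsub>obj A S\<^esub> (a \<otimes>\<^bsub>obj A S\<^esub> b)" .
qed

lemma mult_pairing:
  assumes A: "algebra_functor R A"
  shows "natural_pairing R A A A (\<lambda>T a b. a \<otimes>\<^bsub>obj A T\<^esub> b)"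
proof -
  note ring = algebra_functorD(2)[OF A]
  show ?thesis
    by (simp add: natural_pairing_def alg_over_def ring.ring_simprules(5,13,23)[OF ring]
        algebra_functorD(4,5)[OF A] ring_hom_mult[OF algebra_functorD(3)[OF A]])
qed

text \<open>A scalar \<open>r\<close> acts as the element \<open>r \<odot> \<one>\<close> of the
  dual algebra, so stability under that algebra contains stability under \<open>R\<close>.\<close>

lemma stable_submodule:
  assumes R: "cring R" and M: "module R M" and A: "algebra_functor R A"
    and \<theta>: "extends_action R G A (quasi_coherent R M) \<tau> \<theta>"
    and N: "left_submodule (obj A (self_module R)) M (action_on_module R M \<theta>) N"
  shows "submodule N R M"
proof -
  interpret M: module R M by (rule M)
  let ?R = "self_module R"
  have R0: "algebra R ?R" by (rule algebra_self_module[OF R])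
  interpret N: additive_subgroup N M using N by (simp add: left_submodule_def)
  interpret T: tensor R M ?R by (rule tensorI[OF M R0])
  interpret A: ring "obj A ?R" by (rule algebra_functorD(2)[OF A R0])
  interpret AM: module ?R "obj A ?R" by (rule module_functorD(1)[OF algebra_functorD(1)[OF A] R0])
  have smult: "r \<odot>\<^bsub>M\<^esub> x \<in> N" if r: "r \<in> carrier R" and x: "x \<in> N" for r x
  proof -
    have xM: "x \<in> carrier M" using x by simp
    let ?a = "r \<odot>\<^bsub>obj A ?R\<^esub> \<one>\<^bsub>obj A ?R\<^esub>"
    have a: "?a \<in> carrier (obj A ?R)" using r by simp
    have x1: "T.pure x \<one>\<^bsub>R\<^esub> \<in> carrier (obj (quasi_coherent R M) ?R)" using xM by simp
    note ax = action_on_module[OF M extends_actionD(1)[OF \<theta>] a xM]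
    have "T.pure (action_on_module R M \<theta> ?a x) \<one>\<^bsub>R\<^esub> = r \<odot>\<^bsub>T.T\<^esub> T.pure x \<one>\<^bsub>R\<^esub>"
      using ax(2) extends_actionD(4)[OF \<theta> R0 _ A.one_closed x1, of r] extends_actionD(6)[OF \<theta> R0 x1] r by simp
    also have "\<dots> = T.pure (r \<odot>\<^bsub>M\<^esub> x) \<one>\<^bsub>R\<^esub>"
      using T.smult_tensor(2)[of r x "\<one>\<^bsub>R\<^esub>"] T.pure_smult[of r x "\<one>\<^bsub>R\<^esub>"] r xM by simp
    finally have "action_on_module R M \<theta> ?a x = r \<odot>\<^bsub>M\<^esub> x"
      using inj_onD[OF bij_betw_imp_inj_on[OF base_points[OF M]]] ax(1) r xM by simp
    moreover have "action_on_module R M \<theta> ?a x \<in> N"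
      using N a x unfolding left_submodule_def by blast
    ultimately show ?thesis by simp
  qed
  show ?thesis
    by (rule M.submoduleI) (use smult in auto)
qed

section \<open>Stable submodules carry an action\<close>

text \<open>
  For \<open>x\<close> in a stable submodule, \<open>a \<mapsto> a x\<close> is a natural linear map on the dual algebra whose values
  at the coordinate functions lie in the submodule, so it lifts; uniqueness of natural linear maps
  yields the axioms of an action.
\<close>

locale stable =
  fixes R :: "'u ring" and G :: "('u, 'g) monoid_ftor" and A :: "('u, ('u, 'g) dist) module_ftor"
    and M :: "('u, 'u) module" and \<tau> :: "('u, 'g, 'u tensor) action"
    and \<theta> :: "('u, ('u, 'g) dist, 'u tensor) action" and N :: "'u set"
    and J :: "'u set" and \<K> :: "'u set set" and c :: "'u alg \<Rightarrow> ('u, 'g) dist \<Rightarrow> 'u \<Rightarrow> 'u"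
  assumes G: "monoid_functor R G" and A: "dual_algebra R G A" and coordinates: "coordinates R A J \<K> c"
    and M: "module R M" and \<theta>: "extends_action R G A (quasi_coherent R M) \<tau> \<theta>"
    and stable: "left_submodule (obj A (self_module R)) M (action_on_module R M \<theta>) N"
begin

sublocale A: coordinates R A J \<K> c by (rule coordinates)
sublocale M: module R M by (rule M)

abbreviation "R0 \<equiv> self_module R"
abbreviation "M' \<equiv> M\<lparr>carrier := N\<rparr>"
abbreviation "Q \<equiv> quasi_coherent R M"
abbreviation "Q' \<equiv> quasi_coherent R M'"
abbreviation "incl \<equiv> quasi_coherent_incl R M"
abbreviation "pure' \<equiv> pure_tensor R M'"

lemma algebra_functor: "algebra_functor R A"
  using A by (simp add: dual_algebra_def)

lemma sub: "submodule N R M"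
  by (rule stable_submodule[OF A.base M algebra_functor \<theta> stable])

lemma N_M: "x \<in> N \<Longrightarrow> x \<in> carrier M"
  using M.submoduleE(1)[OF sub] by auto

lemma M'_module: "module R M'"
  by (rule submodule.submodule_is_module[OF sub M])

sublocale M': module R M' by (rule M'_module)

lemma R0: "algebra R R0" by (rule algebra_self_module[OF A.base])

lemma Q: "module_functor R Q" and Q': "module_functor R Q'"
  by (rule module_functor_quasi_coherent[OF M], rule module_functor_quasi_coherent[OF M'_module])

lemma target: "linear_target R Q" and target': "linear_target R Q'"
  by (rule linear_target_quasi_coherent[OF A.universe M],
      rule linear_target_quasi_coherent[OF A.universe M'_module])

lemma tensor: "algebra R T \<Longrightarrow> tensor R M T" and tensor': "algebra R T \<Longrightarrow> tensor R M' T"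
  by (rule tensorI[OF M], assumption, rule tensorI[OF M'_module], assumption)

lemma one_closed: "algebra R T \<Longrightarrow> \<one>\<^bsub>T\<^esub> \<in> carrier T"
  using algebra_cring cring.cring_simprules(6) by blast

lemma pure'_closed: "algebra R T \<Longrightarrow> x \<in> N \<Longrightarrow> t \<in> carrier T \<Longrightarrow> pure' T x t \<in> carrier (obj Q' T)"
  using tensor.pure_closed[OF tensor', of T x t] by simp

lemma pure_closed: "algebra R T \<Longrightarrow> x \<in> carrier M \<Longrightarrow> t \<in> carrier T \<Longrightarrow> pure_tensor R M T x t \<in> carrier (obj Q T)"
  using tensor.pure_closed[OF tensor, of T x t] by simp

lemma incl_hom: "algebra R T \<Longrightarrow> abelian_group_hom (obj Q' T) (obj Q T) (incl T)"
  using quasi_coherent_incl(1)[OF M sub] by simp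

lemma incl_pure: "algebra R T \<Longrightarrow> x \<in> N \<Longrightarrow> t \<in> carrier T \<Longrightarrow> incl T (pure' T x t) = pure_tensor R M T x t"
  by (rule quasi_coherent_incl(2)[OF M sub])

lemma incl_smult: "algebra R T \<Longrightarrow> t \<in> carrier T \<Longrightarrow> z \<in> carrier (obj Q' T) \<Longrightarrow>
    incl T (t \<odot>\<^bsub>obj Q' T\<^esub> z) = t \<odot>\<^bsub>obj Q T\<^esub> incl T z"
  using quasi_coherent_incl_morphism[OF M sub] unfolding module_morphism_def by blast

lemma incl_natural_linear: "algebra R S \<Longrightarrow> natural_linear R S Q' Q (\<lambda>T \<phi>. incl T)"
  by (rule module_morphism_natural_linear[OF quasi_coherent_incl_morphism[OF M sub]])

lemma arr_pure': "algebra R S \<Longrightarrow> algebra R T \<Longrightarrow> h \<in> alg_hom R S T \<Longrightarrow> x \<in> N \<Longrightarrow> s \<in> carrier S \<Longrightarrow>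
    arr Q' S T h (pure' S x s) = pure' T x (h s)"
  using quasi_coherent_arr(2)[OF M'_module] by simp

lemma pure'_smult_one:
  assumes "algebra R T" "x \<in> N" "t \<in> carrier T"
  shows "pure' T x t = t \<odot>\<^bsub>obj Q' T\<^esub> pure' T x \<one>\<^bsub>T\<^esub>"
proof -
  interpret T: tensor R M' T by (rule tensor'[OF assms(1)])
  show ?thesis using assms(2,3) by (simp add: T.smult_tensor(2))
qed

lemma pure_smult_one:
  assumes "algebra R T" "x \<in> carrier M" "t \<in> carrier T"
  shows "pure_tensor R M T x t = t \<odot>\<^bsub>obj Q T\<^esub> pure_tensor R M T x \<one>\<^bsub>T\<^esub>"
proof -
  interpret T: tensor R M T by (rule tensor[OF assms(1)])
  show ?thesis using assms(2,3) by (simp add: T.smult_tensor(2))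
qed

text \<open>The coordinate vector of index \<open>j\<close> applied to \<open>x\<close>. These
  elements are the coefficients when \<open>a x\<close> is expanded in the coordinates of
  \<open>a\<close>.\<close>

definition b :: "'u \<Rightarrow> 'u \<Rightarrow> 'u" where
  "b j x = action_on_module R M \<theta> (A.unit R0 j) x"

lemma b:
  assumes "x \<in> N"
  shows "b j x \<in> N"
    and "pure_tensor R M R0 (b j x) \<one>\<^bsub>R\<^esub> = act \<theta> R0 (A.unit R0 j) (pure_tensor R M R0 x \<one>\<^bsub>R\<^esub>)"
  using stable A.unit(1)[OF R0] assms action_on_module(2)[OF M extends_actionD(1)[OF \<theta>] A.unit(1)[OF R0] N_M[OF assms]]
  unfolding b_def left_submodule_def by blast+

definition orbit :: "'u \<Rightarrow> ('u, ('u, 'g) dist, 'u tensor) family" where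
  "orbit x = (\<lambda>T \<phi> a. act \<theta> T a (arr Q R0 T \<phi> (pure_tensor R M R0 x \<one>\<^bsub>R\<^esub>)))"

lemma point_closed: "x \<in> carrier M \<Longrightarrow> pure_tensor R M R0 x \<one>\<^bsub>R\<^esub> \<in> carrier (obj Q R0)"
  using pure_closed[OF R0, of x "\<one>\<^bsub>R\<^esub>"] by simp

lemma point'_closed: "x \<in> N \<Longrightarrow> pure' R0 x \<one>\<^bsub>R\<^esub> \<in> carrier (obj Q' R0)"
  using pure'_closed[OF R0, of x "\<one>\<^bsub>R\<^esub>"] by simp

lemma orbit_natural_linear: "x \<in> carrier M \<Longrightarrow> natural_linear R R0 A Q (orbit x)"
  unfolding orbit_def by (rule natural_pairing_left[OF act_pairing[OF Q \<theta>] Q R0 point_closed])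

lemma orbit_unit:
  assumes "x \<in> N"
  shows "orbit x R0 (id_hom R0) (A.unit R0 j) = incl R0 (pure' R0 (b j x) \<one>\<^bsub>R\<^esub>)"
  using module_functorD(5)[OF Q R0 point_closed[OF N_M[OF assms]]] b[OF assms, of j]
    incl_pure[OF R0 b(1)[OF assms], of "\<one>\<^bsub>R\<^esub>" j] by (simp add: orbit_def)

lemma incl_inj:
  assumes "y \<in> carrier (obj Q' R0)" "z \<in> carrier (obj Q' R0)" "incl R0 y = incl R0 z"
  shows "y = z"
  using inj_onD[OF quasi_coherent_incl_inj[OF M sub] assms(3)] assms(1,2) by simp

text \<open>The expansion of \<open>orbit x\<close> has finitely many nonzero coefficients on each
  member of \<open>A.perp\<close>. By injectivity of the inclusion over \<open>R\<close> the
  corresponding elements of the submodule vanish at the same indices, so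
  \<open>linear_combination\<close> applies inside the submodule.\<close>

lemma lift_exists:
  assumes x: "x \<in> N"
  shows "\<exists>w. natural_linear R R0 A Q' w \<and> (\<forall>j\<in>J. w R0 (id_hom R0) (A.unit R0 j) = pure' R0 (b j x) \<one>\<^bsub>R\<^esub>)"
proof (rule A.linear_combination[OF Q' R0])
  show "(\<lambda>j. pure' R0 (b j x) \<one>\<^bsub>R\<^esub>) \<in> J \<rightarrow> carrier (obj Q' R0)"
    using point'_closed[OF b(1)[OF x]] by simp
  fix K assume K: "K \<in> A.perp"
  interpret i: abelian_group_hom "obj Q' R0" "obj Q R0" "incl R0" by (rule incl_hom[OF R0])
  have fin: "finite {j \<in> K. orbit x R0 (id_hom R0) (A.unit R0 j) \<noteq> \<zero>\<^bsub>obj Q R0\<^esub>}"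
    by (rule A.expansion(1)[OF target orbit_natural_linear[OF N_M[OF x]] R0 K])
  have zero: "pure' R0 (b j x) \<one>\<^bsub>R\<^esub> = \<zero>\<^bsub>obj Q' R0\<^esub>"
    if "orbit x R0 (id_hom R0) (A.unit R0 j) = \<zero>\<^bsub>obj Q R0\<^esub>" for j
  proof (rule incl_inj)
    show "incl R0 (pure' R0 (b j x) \<one>\<^bsub>R\<^esub>) = incl R0 \<zero>\<^bsub>obj Q' R0\<^esub>"
      unfolding orbit_unit[OF x, symmetric] that i.hom_zero ..
  qed (rule point'_closed[OF b(1)[OF x]], rule i.G.zero_closed)
  show "finite {j \<in> J \<inter> K. pure' R0 (b j x) \<one>\<^bsub>R\<^esub> \<noteq> \<zero>\<^bsub>obj Q' R0\<^esub>}"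
    by (rule finite_subset[OF _ fin]) (use zero in blast)
qed

text \<open>On carriers it is determined by its values at coordinate vectors; its additivity and
  linearity in \<open>x\<close> are proved by comparing those values.\<close>

definition lift :: "'u \<Rightarrow> ('u, ('u, 'g) dist, 'u tensor) family" where
  "lift x = (SOME w. natural_linear R R0 A Q' w \<and>
     (\<forall>j\<in>J. w R0 (id_hom R0) (A.unit R0 j) = pure' R0 (b j x) \<one>\<^bsub>R\<^esub>))"

lemma lift:
  assumes "x \<in> N"
  shows "natural_linear R R0 A Q' (lift x)"
    and "j \<in> J \<Longrightarrow> lift x R0 (id_hom R0) (A.unit R0 j) = pure' R0 (b j x) \<one>\<^bsub>R\<^esub>"
  using someI_ex[OF lift_exists[OF assms]] unfolding lift_def by blast+

lemma incl_lift:
  assumes x: "x \<in> N" and T: "alg_over R R0 T \<phi>" and a: "a \<in> carrier (obj A T)"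
  shows "incl T (lift x T \<phi> a) = act \<theta> T a (pure_tensor R M T x \<one>\<^bsub>T\<^esub>)"
proof -
  note T' = alg_overD[OF T]
  have "incl T (lift x T \<phi> a) = orbit x T \<phi> a"
    by (rule A.natural_linear_unique[OF target natural_linear_compose[OF lift(1)[OF x] incl_natural_linear[OF R0]]
          orbit_natural_linear[OF N_M[OF x]] R0 _ T a])
      (simp only: lift(2)[OF x] orbit_unit[OF x])
  also have "arr Q R0 T \<phi> (pure_tensor R M R0 x \<one>\<^bsub>R\<^esub>) = pure_tensor R M T x \<one>\<^bsub>T\<^esub>"
    using quasi_coherent_arr(2)[OF M R0 T' N_M[OF x], of "\<one>\<^bsub>R\<^esub>"] alg_homD(7)[OF T'(2)] by simp
  then have "orbit x T \<phi> a = act \<theta> T a (pure_tensor R M T x \<one>\<^bsub>T\<^esub>)" by (simp add: orbit_def)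
  finally show ?thesis .
qed

text \<open>Uniqueness leaves only coordinate vectors over \<open>R\<close> to compare. There the
  inclusion into \<open>M\<close> is injective, and the action on \<open>M\<close> is
  additive.\<close>

lemma lift_add:
  assumes x: "x \<in> N" and y: "y \<in> N" and T: "alg_over R R0 T \<phi>" and a: "a \<in> carrier (obj A T)"
  shows "lift (x \<oplus>\<^bsub>M\<^esub> y) T \<phi> a = lift x T \<phi> a \<oplus>\<^bsub>obj Q' T\<^esub> lift y T \<phi> a"
proof -
  have xy: "x \<oplus>\<^bsub>M\<^esub> y \<in> N" using M'.a_closed[of x y] x y by simp
  show ?thesis
  proof (rule A.natural_linear_unique[OF target' lift(1)[OF xy] natural_linear_add[OF Q' lift(1)[OF x] lift(1)[OF y]]
        R0 _ T a])
    fix j assume j: "j \<in> J"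
    interpret i: abelian_group_hom "obj Q' R0" "obj Q R0" "incl R0" by (rule incl_hom[OF R0])
    interpret t: tensor R M R0 by (rule tensor[OF R0])
    have u: "A.unit R0 j \<in> carrier (obj A R0)" by (rule A.unit(1)[OF R0])
    note px = point'_closed[OF b(1)[OF x, of j]] and py = point'_closed[OF b(1)[OF y, of j]]
      and pxy = point'_closed[OF b(1)[OF xy, of j]]
    have R1: "\<one>\<^bsub>R\<^esub> \<in> carrier R0" by simp
    have incl_b: "incl R0 (pure' R0 (b j z) \<one>\<^bsub>R\<^esub>) = act \<theta> R0 (A.unit R0 j) (pure_tensor R M R0 z \<one>\<^bsub>R\<^esub>)"
      if "z \<in> N" for z
      unfolding incl_pure[OF R0 b(1)[OF that] R1] by (rule b(2)[OF that])
    have split: "pure_tensor R M R0 (x \<oplus>\<^bsub>M\<^esub> y) \<one>\<^bsub>R\<^esub> =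
        pure_tensor R M R0 x \<one>\<^bsub>R\<^esub> \<oplus>\<^bsub>obj Q R0\<^esub> pure_tensor R M R0 y \<one>\<^bsub>R\<^esub>"
      using t.pure_add_left[OF N_M[OF x] N_M[OF y] R1] by simp
    have "incl R0 (pure' R0 (b j (x \<oplus>\<^bsub>M\<^esub> y)) \<one>\<^bsub>R\<^esub>) =
        incl R0 (pure' R0 (b j x) \<one>\<^bsub>R\<^esub> \<oplus>\<^bsub>obj Q' R0\<^esub> pure' R0 (b j y) \<one>\<^bsub>R\<^esub>)"
      unfolding incl_b[OF xy] i.hom_add[OF px py] incl_b[OF x] incl_b[OF y] split
      by (rule act_set_morphism(3)[OF Q extends_actionD(1)[OF \<theta>] R0 u point_closed[OF N_M[OF x]] point_closed[OF N_M[OF y]]])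
    from incl_inj[OF pxy i.G.add.m_closed[OF px py] this]
    have "pure' R0 (b j (x \<oplus>\<^bsub>M\<^esub> y)) \<one>\<^bsub>R\<^esub> =
        pure' R0 (b j x) \<one>\<^bsub>R\<^esub> \<oplus>\<^bsub>obj Q' R0\<^esub> pure' R0 (b j y) \<one>\<^bsub>R\<^esub>" .
    then show "lift (x \<oplus>\<^bsub>M\<^esub> y) R0 (id_hom R0) (A.unit R0 j) =
        lift x R0 (id_hom R0) (A.unit R0 j) \<oplus>\<^bsub>obj Q' R0\<^esub> lift y R0 (id_hom R0) (A.unit R0 j)"
      by (simp only: lift(2)[OF _ j] xy x y)
  qed
qed

lemma lift_smult:
  assumes r: "r \<in> carrier R" and x: "x \<in> N" and T: "alg_over R R0 T \<phi>" and a: "a \<in> carrier (obj A T)"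
  shows "lift (r \<odot>\<^bsub>M\<^esub> x) T \<phi> a = \<phi> r \<odot>\<^bsub>obj Q' T\<^esub> lift x T \<phi> a"
proof -
  have rx: "r \<odot>\<^bsub>M\<^esub> x \<in> N" using M'.smult_closed[of r x] r x by simp
  have r0: "r \<in> carrier R0" using r by simp
  show ?thesis
  proof (rule A.natural_linear_unique[OF target' lift(1)[OF rx] natural_linear_smult[OF Q' R0 lift(1)[OF x] r0]
        R0 _ T a])
    fix j assume j: "j \<in> J"
    interpret i: abelian_group_hom "obj Q' R0" "obj Q R0" "incl R0" by (rule incl_hom[OF R0])
    interpret t: tensor R M R0 by (rule tensor[OF R0])
    interpret q: module R0 "obj Q' R0" by (rule module_functorD(1)[OF Q' R0])
    have u: "A.unit R0 j \<in> carrier (obj A R0)" by (rule A.unit(1)[OF R0])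
    have rpure: "pure_tensor R M R0 (r \<odot>\<^bsub>M\<^esub> x) \<one>\<^bsub>R\<^esub> = r \<odot>\<^bsub>obj Q R0\<^esub> pure_tensor R M R0 x \<one>\<^bsub>R\<^esub>"
      using t.smult_tensor(2)[OF r0 N_M[OF x], of "\<one>\<^bsub>R\<^esub>"] t.pure_smult[OF r N_M[OF x], of "\<one>\<^bsub>R\<^esub>"] r by simp
    have "incl R0 (pure' R0 (b j (r \<odot>\<^bsub>M\<^esub> x)) \<one>\<^bsub>R\<^esub>) = act \<theta> R0 (A.unit R0 j) (r \<odot>\<^bsub>obj Q R0\<^esub> pure_tensor R M R0 x \<one>\<^bsub>R\<^esub>)"
      using incl_pure[OF R0 b(1)[OF rx], of "\<one>\<^bsub>R\<^esub>" j] b(2)[OF rx, of j] rpure by simp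
    also have "\<dots> = r \<odot>\<^bsub>obj Q R0\<^esub> act \<theta> R0 (A.unit R0 j) (pure_tensor R M R0 x \<one>\<^bsub>R\<^esub>)"
      by (rule act_set_morphism(4)[OF Q extends_actionD(1)[OF \<theta>] R0 u r0 point_closed[OF N_M[OF x]]])
    also have "\<dots> = incl R0 (r \<odot>\<^bsub>obj Q' R0\<^esub> pure' R0 (b j x) \<one>\<^bsub>R\<^esub>)"
      using incl_pure[OF R0 b(1)[OF x], of "\<one>\<^bsub>R\<^esub>" j] b(2)[OF x, of j]
        incl_smult[OF R0 r0 point'_closed[OF b(1)[OF x, of j]]] by simp
    finally have "incl R0 (pure' R0 (b j (r \<odot>\<^bsub>M\<^esub> x)) \<one>\<^bsub>R\<^esub>) =
        incl R0 (r \<odot>\<^bsub>obj Q' R0\<^esub> pure' R0 (b j x) \<one>\<^bsub>R\<^esub>)" .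
    from incl_inj[OF point'_closed[OF b(1)[OF rx]] q.smult_closed[OF r0 point'_closed[OF b(1)[OF x]]] this]
    show "lift (r \<odot>\<^bsub>M\<^esub> x) R0 (id_hom R0) (A.unit R0 j) =
        id_hom R0 r \<odot>\<^bsub>obj Q' R0\<^esub> lift x R0 (id_hom R0) (A.unit R0 j)"
      using r0 by (simp only: lift(2)[OF rx j] lift(2)[OF x j] restrict_apply')
  qed
qed

text \<open>The prospective action on \<open>N \<otimes> T\<close>, sending
  \<open>x \<otimes> t\<close> to \<open>t\<close> times the lift of \<open>a x\<close>. The lift is
  indexed by the structural map, the only index over \<open>R\<close> that \<open>T\<close>
  has.\<close>

definition star :: "'u alg \<Rightarrow> ('u, 'g) dist \<Rightarrow> 'u tensor \<Rightarrow> 'u tensor" where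
  "star T a = (SOME h. abelian_group_hom (obj Q' T) (obj Q' T) h \<and>
     (\<forall>x\<in>N. \<forall>t\<in>carrier T. h (pure' T x t) = t \<odot>\<^bsub>obj Q' T\<^esub> lift x T (unit_hom R T) a))"

lemma star:
  assumes T: "algebra R T" and a: "a \<in> carrier (obj A T)"
  shows "abelian_group_hom (obj Q' T) (obj Q' T) (star T a)"
    and "\<And>x t. x \<in> N \<Longrightarrow> t \<in> carrier T \<Longrightarrow> star T a (pure' T x t) = t \<odot>\<^bsub>obj Q' T\<^esub> lift x T (unit_hom R T) a"
proof -
  interpret T: tensor R M' T by (rule tensor'[OF T])
  interpret q: module T "obj Q' T" by (rule module_functorD(1)[OF Q' T])
  note u = unit_hom_over[OF T]
  have lift_in: "lift x T (unit_hom R T) a \<in> carrier (obj Q' T)" if "x \<in> N" for x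
    by (rule natural_linearD(1)[OF lift(1)[OF that] u a])
  have "balanced R M' T (obj Q' T) (\<lambda>x t. t \<odot>\<^bsub>obj Q' T\<^esub> lift x T (unit_hom R T) a)"
  proof (rule balancedI)
    fix r x t assume r: "r \<in> carrier R" and "x \<in> carrier M'" and t: "t \<in> carrier T"
    then have x: "x \<in> N" by simp
    \<comment> \<open>\<open>lift_smult\<close> produces the scalar \<open>unit_hom R T r\<close>;
      being \<open>r \<odot> \<one>\<close>, it can be absorbed into \<open>t\<close>, as balance
      demands.\<close>
    have "unit_hom R T r = r \<odot>\<^bsub>T\<^esub> \<one>\<^bsub>T\<^esub>" using r by (simp add: unit_hom_def)
    moreover have "t \<otimes>\<^bsub>T\<^esub> (r \<odot>\<^bsub>T\<^esub> \<one>\<^bsub>T\<^esub>) = r \<odot>\<^bsub>T\<^esub> t"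
      using r t T.S.smult_assoc2[OF r T.S.one_closed t] by (simp add: T.S.m_comm)
    moreover have "r \<odot>\<^bsub>T\<^esub> \<one>\<^bsub>T\<^esub> \<in> carrier T" using r by simp
    ultimately show "t \<odot>\<^bsub>obj Q' T\<^esub> lift (r \<odot>\<^bsub>M'\<^esub> x) T (unit_hom R T) a =
        (r \<odot>\<^bsub>T\<^esub> t) \<odot>\<^bsub>obj Q' T\<^esub> lift x T (unit_hom R T) a"
      using lift_smult[OF r x u a] q.smult_assoc1[OF t _ lift_in[OF x], of "r \<odot>\<^bsub>T\<^esub> \<one>\<^bsub>T\<^esub>"] by simp
  qed (use lift_in lift_add[OF _ _ u a] q.smult_closed q.smult_l_distr q.smult_r_distr in simp_all)
  then obtain h where "abelian_group_hom (obj Q' T) (obj Q' T) h"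
    "\<And>x t. x \<in> N \<Longrightarrow> t \<in> carrier T \<Longrightarrow> h (pure' T x t) = t \<odot>\<^bsub>obj Q' T\<^esub> lift x T (unit_hom R T) a"
    using T.universal[OF q.M.abelian_group_axioms] by auto
  then have "\<exists>h. abelian_group_hom (obj Q' T) (obj Q' T) h \<and>
     (\<forall>x\<in>N. \<forall>t\<in>carrier T. h (pure' T x t) = t \<odot>\<^bsub>obj Q' T\<^esub> lift x T (unit_hom R T) a)" by blast
  from someI_ex[OF this]
  show "abelian_group_hom (obj Q' T) (obj Q' T) (star T a)"
    "\<And>x t. x \<in> N \<Longrightarrow> t \<in> carrier T \<Longrightarrow> star T a (pure' T x t) = t \<odot>\<^bsub>obj Q' T\<^esub> lift x T (unit_hom R T) a"
    unfolding star_def by blast+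
qed

lemma star_closed: "algebra R T \<Longrightarrow> a \<in> carrier (obj A T) \<Longrightarrow> z \<in> carrier (obj Q' T) \<Longrightarrow> star T a z \<in> carrier (obj Q' T)"
  by (rule abelian_group_hom.hom_closed[OF star(1)])

lemma lift_closed: "algebra R T \<Longrightarrow> x \<in> N \<Longrightarrow> a \<in> carrier (obj A T) \<Longrightarrow> lift x T (unit_hom R T) a \<in> carrier (obj Q' T)"
  by (rule natural_linearD(1)[OF lift(1) unit_hom_over])

lemma Q'_eqI:
  assumes T: "algebra R T" and f: "abelian_group_hom (obj Q' T) B f" and g: "abelian_group_hom (obj Q' T) B g"
    and eq: "\<And>x t. x \<in> N \<Longrightarrow> t \<in> carrier T \<Longrightarrow> f (pure' T x t) = g (pure' T x t)"
    and z: "z \<in> carrier (obj Q' T)"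
  shows "f z = g z"
  using tensor.hom_eqI[OF tensor'[OF T], of B f g z] f g eq z by simp

lemma star_smult:
  assumes T: "algebra R T" and a: "a \<in> carrier (obj A T)" and s: "s \<in> carrier T" and z: "z \<in> carrier (obj Q' T)"
  shows "star T a (s \<odot>\<^bsub>obj Q' T\<^esub> z) = s \<odot>\<^bsub>obj Q' T\<^esub> star T a z"
proof (rule Q'_eqI[OF T _ _ _ z])
  interpret T: tensor R M' T by (rule tensor'[OF T])
  interpret q: module T "obj Q' T" by (rule module_functorD(1)[OF Q' T])
  show "abelian_group_hom (obj Q' T) (obj Q' T) (\<lambda>z. star T a (s \<odot>\<^bsub>obj Q' T\<^esub> z))"
    "abelian_group_hom (obj Q' T) (obj Q' T) (\<lambda>z. s \<odot>\<^bsub>obj Q' T\<^esub> star T a z)"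
    using abelian_group_hom_compose[OF module_smult_hom[OF q.module_axioms s] star(1)[OF T a]]
      abelian_group_hom_compose[OF star(1)[OF T a] module_smult_hom[OF q.module_axioms s]] .
  fix x t assume x: "x \<in> N" and t: "t \<in> carrier T"
  have "s \<odot>\<^bsub>obj Q' T\<^esub> pure' T x t = pure' T x (s \<otimes>\<^bsub>T\<^esub> t)"
    using T.smult_tensor(2)[OF s _ t, of x] x by simp
  then show "star T a (s \<odot>\<^bsub>obj Q' T\<^esub> pure' T x t) = s \<odot>\<^bsub>obj Q' T\<^esub> star T a (pure' T x t)"
    using s t q.smult_assoc1[OF s t lift_closed[OF T x a]] by (simp only: star(2)[OF T a x] T.S.m_closed)
qed

lemma star_add_left:
  assumes T: "algebra R T" and a: "a \<in> carrier (obj A T)" and a': "a' \<in> carrier (obj A T)" and z: "z \<in> carrier (obj Q' T)"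
  shows "star T (a \<oplus>\<^bsub>obj A T\<^esub> a') z = star T a z \<oplus>\<^bsub>obj Q' T\<^esub> star T a' z"
proof (rule Q'_eqI[where f = "star T (a \<oplus>\<^bsub>obj A T\<^esub> a')"
      and g = "\<lambda>z. star T a z \<oplus>\<^bsub>obj Q' T\<^esub> star T a' z", OF T _ _ _ z])
  interpret q: module T "obj Q' T" by (rule module_functorD(1)[OF Q' T])
  interpret AT: module T "obj A T" by (rule module_functorD(1)[OF A.is_functor T])
  interpret s: abelian_group_hom "obj Q' T" "obj Q' T" "star T a" by (rule star(1)[OF T a])
  interpret s': abelian_group_hom "obj Q' T" "obj Q' T" "star T a'" by (rule star(1)[OF T a'])
  have aa: "a \<oplus>\<^bsub>obj A T\<^esub> a' \<in> carrier (obj A T)" using a a' by (rule AT.M.add.m_closed)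
  show "abelian_group_hom (obj Q' T) (obj Q' T) (star T (a \<oplus>\<^bsub>obj A T\<^esub> a'))" by (rule star(1)[OF T aa])
  show "abelian_group_hom (obj Q' T) (obj Q' T) (\<lambda>z. star T a z \<oplus>\<^bsub>obj Q' T\<^esub> star T a' z)"
  proof (rule abelian_group_homI'[OF q.M.abelian_group_axioms q.M.abelian_group_axioms])
    show "(\<lambda>z. star T a z \<oplus>\<^bsub>obj Q' T\<^esub> star T a' z) \<in> carrier (obj Q' T) \<rightarrow> carrier (obj Q' T)"
      by (intro Pi_I q.M.add.m_closed s.hom_closed s'.hom_closed)
    fix x y assume x: "x \<in> carrier (obj Q' T)" and y: "y \<in> carrier (obj Q' T)"
    show "star T a (x \<oplus>\<^bsub>obj Q' T\<^esub> y) \<oplus>\<^bsub>obj Q' T\<^esub> star T a' (x \<oplus>\<^bsub>obj Q' T\<^esub> y) =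
        star T a x \<oplus>\<^bsub>obj Q' T\<^esub> star T a' x \<oplus>\<^bsub>obj Q' T\<^esub> (star T a y \<oplus>\<^bsub>obj Q' T\<^esub> star T a' y)"
      unfolding s.hom_add[OF x y] s'.hom_add[OF x y]
      using s.hom_closed[OF x] s.hom_closed[OF y] s'.hom_closed[OF x] s'.hom_closed[OF y]
      by (simp only: q.M.a_ac q.M.add.m_closed)
  qed
  fix x t assume x: "x \<in> N" and t: "t \<in> carrier T"
  show "star T (a \<oplus>\<^bsub>obj A T\<^esub> a') (pure' T x t) = star T a (pure' T x t) \<oplus>\<^bsub>obj Q' T\<^esub> star T a' (pure' T x t)"
    unfolding star(2)[OF T aa x t] star(2)[OF T a x t] star(2)[OF T a' x t]
      natural_linearD(2)[OF lift(1)[OF x] unit_hom_over[OF T] a a']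
    by (rule q.smult_r_distr[OF t lift_closed[OF T x a] lift_closed[OF T x a']])
qed

lemma star_smult_left:
  assumes T: "algebra R T" and s: "s \<in> carrier T" and a: "a \<in> carrier (obj A T)" and z: "z \<in> carrier (obj Q' T)"
  shows "star T (s \<odot>\<^bsub>obj A T\<^esub> a) z = s \<odot>\<^bsub>obj Q' T\<^esub> star T a z"
proof (rule Q'_eqI[OF T _ _ _ z])
  interpret q: module T "obj Q' T" by (rule module_functorD(1)[OF Q' T])
  interpret AT: module T "obj A T" by (rule module_functorD(1)[OF A.is_functor T])
  have sa: "s \<odot>\<^bsub>obj A T\<^esub> a \<in> carrier (obj A T)" using s a by (rule AT.smult_closed)
  show "abelian_group_hom (obj Q' T) (obj Q' T) (star T (s \<odot>\<^bsub>obj A T\<^esub> a))" by (rule star(1)[OF T sa])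
  show "abelian_group_hom (obj Q' T) (obj Q' T) (\<lambda>z. s \<odot>\<^bsub>obj Q' T\<^esub> star T a z)"
    by (rule abelian_group_hom_compose[OF star(1)[OF T a] module_smult_hom[OF q.module_axioms s]])
  fix x t assume x: "x \<in> N" and t: "t \<in> carrier T"
  note l = lift_closed[OF T x a]
  show "star T (s \<odot>\<^bsub>obj A T\<^esub> a) (pure' T x t) = s \<odot>\<^bsub>obj Q' T\<^esub> star T a (pure' T x t)"
    unfolding star(2)[OF T sa x t] star(2)[OF T a x t]
      natural_linearD(3)[OF lift(1)[OF x] unit_hom_over[OF T] s a]
    unfolding q.smult_assoc1[OF t s l, symmetric] q.smult_assoc1[OF s t l, symmetric] q.R.m_comm[OF s t] ..
qed

text \<open>Comes from naturality of the lift, together with the fact that an algebra homomorphism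
  carries one structural map to the other.\<close>

lemma star_arr:
  assumes T: "algebra R T" and U: "algebra R U" and h: "h \<in> alg_hom R T U"
    and a: "a \<in> carrier (obj A T)" and z: "z \<in> carrier (obj Q' T)"
  shows "star U (arr A T U h a) (arr Q' T U h z) = arr Q' T U h (star T a z)"
proof (rule Q'_eqI[OF T _ _ _ z])
  have ha: "arr A T U h a \<in> carrier (obj A U)" by (rule module_functorD(3)[OF A.is_functor T U h a])
  note arr = module_functorD(2)[OF Q' T U h]
  show "abelian_group_hom (obj Q' T) (obj Q' U) (\<lambda>z. star U (arr A T U h a) (arr Q' T U h z))"
    "abelian_group_hom (obj Q' T) (obj Q' U) (\<lambda>z. arr Q' T U h (star T a z))"
    using abelian_group_hom_compose[OF arr star(1)[OF U ha]] abelian_group_hom_compose[OF star(1)[OF T a] arr] .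
  fix x t assume x: "x \<in> N" and t: "t \<in> carrier T"
  have over: "alg_over R T U h" using U h by (simp add: alg_over_def)
  have "lift x U (unit_hom R U) (arr A T U h a) = arr Q' T U h (lift x T (unit_hom R T) a)"
    using natural_linearD(4)[OF lift(1)[OF x] unit_hom_over[OF T] over a] compose_unit_hom[OF T U h] by simp
  then show "star U (arr A T U h a) (arr Q' T U h (pure' T x t)) = arr Q' T U h (star T a (pure' T x t))"
    unfolding arr_pure'[OF T U h x t] star(2)[OF U ha x alg_homD(4)[OF h t]] star(2)[OF T a x t]
      module_functorD(4)[OF Q' T U h t lift_closed[OF T x a]] by simp
qed

text \<open>The link with the given action. Over \<open>R\<close>, where the inclusion is injective,
  it lets the laws of that action descend to the submodule.\<close>

lemma incl_star:
  assumes T: "algebra R T" and a: "a \<in> carrier (obj A T)" and z: "z \<in> carrier (obj Q' T)"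
  shows "incl T (star T a z) = act \<theta> T a (incl T z)"
proof (rule Q'_eqI[OF T _ _ _ z])
  note act = act_set_morphism[OF Q extends_actionD(1)[OF \<theta>]]
  interpret q: module T "obj Q T" by (rule module_functorD(1)[OF Q T])
  have act_hom: "abelian_group_hom (obj Q T) (obj Q T) (act \<theta> T a)"
    using act(2)[OF T a] act(3)[OF T a]
    by (intro abelian_group_homI' q.M.abelian_group_axioms) auto
  show "abelian_group_hom (obj Q' T) (obj Q T) (\<lambda>z. incl T (star T a z))"
    "abelian_group_hom (obj Q' T) (obj Q T) (\<lambda>z. act \<theta> T a (incl T z))"
    using abelian_group_hom_compose[OF star(1)[OF T a] incl_hom[OF T]] abelian_group_hom_compose[OF incl_hom[OF T] act_hom] .
  fix x t assume x: "x \<in> N" and t: "t \<in> carrier T"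
  show "incl T (star T a (pure' T x t)) = act \<theta> T a (incl T (pure' T x t))"
    unfolding star(2)[OF T a x t] incl_pure[OF T x t] incl_smult[OF T t lift_closed[OF T x a]]
      incl_lift[OF x unit_hom_over[OF T] a] pure_smult_one[OF T N_M[OF x] t]
    by (rule act(4)[OF T a t pure_closed[OF T N_M[OF x] one_closed[OF T]], symmetric])
qed

lemma star_pairing: "natural_pairing R A Q' Q' star"
  unfolding natural_pairing_def alg_over_def
  using star_closed star_add_left star_smult_left abelian_group_hom.hom_add[OF star(1)] star_smult star_arr
  by (simp del: quasi_coherent_simps)

lemmas star_natural_linear_left = natural_pairing_left[OF star_pairing Q']
  and star_natural_linear_right = natural_pairing_right[OF star_pairing A.is_functor]
  and mult_natural_linear_left = natural_pairing_left[OF mult_pairing[OF algebra_functor] A.is_functor]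
  and mult_natural_linear_right = natural_pairing_right[OF mult_pairing[OF algebra_functor] A.is_functor]

lemma ring_A: "algebra R T \<Longrightarrow> ring (obj A T)"
  by (rule algebra_functorD(2)[OF algebra_functor])

lemma mult_closed:
  "algebra R T \<Longrightarrow> a \<in> carrier (obj A T) \<Longrightarrow> a' \<in> carrier (obj A T) \<Longrightarrow> a \<otimes>\<^bsub>obj A T\<^esub> a' \<in> carrier (obj A T)"
  by (rule ring.ring_simprules(5)[OF ring_A])

text \<open>All arguments live over \<open>R\<close>, so the law can be checked after the injective
  inclusion into \<open>M\<close>.\<close>

lemma star_mult_base:
  assumes a: "a \<in> carrier (obj A R0)" and a': "a' \<in> carrier (obj A R0)" and z: "z \<in> carrier (obj Q' R0)"
  shows "star R0 (a \<otimes>\<^bsub>obj A R0\<^esub> a') z = star R0 a (star R0 a' z)"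
proof (rule incl_inj)
  note a'z = star_closed[OF R0 a' z] and aa' = mult_closed[OF R0 a a']
  have "incl R0 z \<in> carrier (obj Q R0)" by (rule abelian_group_hom.hom_closed[OF incl_hom[OF R0] z])
  then show "incl R0 (star R0 (a \<otimes>\<^bsub>obj A R0\<^esub> a') z) = incl R0 (star R0 a (star R0 a' z))"
    using extends_actionD(5)[OF \<theta> R0 a a', of "incl R0 z"]
    by (simp only: incl_star[OF R0 aa' z] incl_star[OF R0 a a'z] incl_star[OF R0 a' z])
  show "star R0 (a \<otimes>\<^bsub>obj A R0\<^esub> a') z \<in> carrier (obj Q' R0)" "star R0 a (star R0 a' z) \<in> carrier (obj Q' R0)"
    by (rule star_closed[OF R0 aa' z], rule star_closed[OF R0 a a'z])
qed

text \<open>With \<open>a'\<close> and \<open>z\<close> defined over \<open>R\<close>, both sides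
  are natural linear in \<open>a\<close>; their agreement at coordinate vectors over
  \<open>R\<close> is \<open>star_mult_base\<close>.\<close>

lemma star_mult_half:
  assumes T: "alg_over R R0 T \<phi>" and a: "a \<in> carrier (obj A T)"
    and a': "a' \<in> carrier (obj A R0)" and z: "z \<in> carrier (obj Q' R0)"
  shows "star T (a \<otimes>\<^bsub>obj A T\<^esub> arr A R0 T \<phi> a') (arr Q' R0 T \<phi> z) =
    star T a (star T (arr A R0 T \<phi> a') (arr Q' R0 T \<phi> z))"
proof -
  note T' = alg_overD[OF T] and a'z = star_closed[OF R0 a' z]
  have "star T (a \<otimes>\<^bsub>obj A T\<^esub> arr A R0 T \<phi> a') (arr Q' R0 T \<phi> z) =
      star T a (arr Q' R0 T \<phi> (star R0 a' z))"
  proof (rule A.natural_linear_unique[OF target'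
        natural_linear_compose[OF mult_natural_linear_left[OF R0 a'] star_natural_linear_left[OF R0 z]]
        star_natural_linear_left[OF R0 a'z] R0 _ T a])
    fix j
    show "star R0 (A.unit R0 j \<otimes>\<^bsub>obj A R0\<^esub> arr A R0 R0 (id_hom R0) a') (arr Q' R0 R0 (id_hom R0) z) =
        star R0 (A.unit R0 j) (arr Q' R0 R0 (id_hom R0) (star R0 a' z))"
      unfolding module_functorD(5)[OF A.is_functor R0 a'] module_functorD(5)[OF Q' R0 z] module_functorD(5)[OF Q' R0 a'z]
      by (rule star_mult_base[OF A.unit(1)[OF R0] a' z])
  qed
  then show ?thesis by (simp only: star_arr[OF R0 T' a' z])
qed

lemma arr_point:
  assumes "algebra R S" "x \<in> N"
  shows "pure' S x \<one>\<^bsub>S\<^esub> = arr Q' R0 S (unit_hom R S) (pure' R0 x \<one>\<^bsub>R\<^esub>)"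
  using arr_pure'[OF R0 assms(1) unit_hom_in[OF assms(1)] assms(2), of "\<one>\<^bsub>R\<^esub>"]
    alg_homD(7)[OF unit_hom_in[OF assms(1)]] one_closed[OF R0] by simp

text \<open>The variable \<open>a'\<close> is freed in the same way, now over \<open>S\<close>. Its
  coordinate vectors and the point \<open>pure' S x \<one>\<close> come from \<open>R\<close>, so
  \<open>star_mult_half\<close> gives the values to compare.\<close>

lemma star_mult_point:
  assumes S: "algebra R S" and a: "a \<in> carrier (obj A S)" and a': "a' \<in> carrier (obj A S)" and x: "x \<in> N"
  shows "star S (a \<otimes>\<^bsub>obj A S\<^esub> a') (pure' S x \<one>\<^bsub>S\<^esub>) = star S a (star S a' (pure' S x \<one>\<^bsub>S\<^esub>))"
proof -
  have z: "pure' S x \<one>\<^bsub>S\<^esub> \<in> carrier (obj Q' S)" by (rule pure'_closed[OF S x one_closed[OF S]])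
  note ids = module_functorD(5)[OF A.is_functor S a] module_functorD(5)[OF Q' S z]
  have "star S (arr A S S (id_hom S) a \<otimes>\<^bsub>obj A S\<^esub> a') (arr Q' S S (id_hom S) (pure' S x \<one>\<^bsub>S\<^esub>)) =
      star S (arr A S S (id_hom S) a) (star S a' (arr Q' S S (id_hom S) (pure' S x \<one>\<^bsub>S\<^esub>)))"
  proof (rule A.natural_linear_unique[OF target'
        natural_linear_compose[OF mult_natural_linear_right[OF S a] star_natural_linear_left[OF S z]]
        natural_linear_compose[OF star_natural_linear_left[OF S z] star_natural_linear_right[OF S a]]
        S _ alg_over_id[OF S] a'])
    fix j assume j: "j \<in> J"
    have u: "A.unit S j = arr A R0 S (unit_hom R S) (A.unit R0 j)"
      using A.arr_unit[OF R0 S unit_hom_in[OF S] j] by simp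
    show "star S (arr A S S (id_hom S) a \<otimes>\<^bsub>obj A S\<^esub> A.unit S j) (arr Q' S S (id_hom S) (pure' S x \<one>\<^bsub>S\<^esub>)) =
        star S (arr A S S (id_hom S) a) (star S (A.unit S j) (arr Q' S S (id_hom S) (pure' S x \<one>\<^bsub>S\<^esub>)))"
      unfolding ids unfolding u arr_point[OF S x]
      by (rule star_mult_half[OF unit_hom_over[OF S] a A.unit(1)[OF R0] point'_closed[OF x]])
  qed
  then show ?thesis unfolding ids .
qed

text \<open>Additivity and linearity reduce an arbitrary tensor to the points treated in
  \<open>star_mult_point\<close>.\<close>

lemma star_mult:
  assumes S: "algebra R S" and a: "a \<in> carrier (obj A S)" and a': "a' \<in> carrier (obj A S)" and z: "z \<in> carrier (obj Q' S)"
  shows "star S (a \<otimes>\<^bsub>obj A S\<^esub> a') z = star S a (star S a' z)"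
proof (rule Q'_eqI[where f = "star S (a \<otimes>\<^bsub>obj A S\<^esub> a')" and g = "\<lambda>z. star S a (star S a' z)",
      OF S _ _ _ z])
  note aa' = mult_closed[OF S a a']
  show "abelian_group_hom (obj Q' S) (obj Q' S) (star S (a \<otimes>\<^bsub>obj A S\<^esub> a'))"
    "abelian_group_hom (obj Q' S) (obj Q' S) (\<lambda>z. star S a (star S a' z))"
    using star(1)[OF S aa'] abelian_group_hom_compose[OF star(1)[OF S a'] star(1)[OF S a]] .
  fix x t assume x: "x \<in> N" and t: "t \<in> carrier S"
  have p: "pure' S x \<one>\<^bsub>S\<^esub> \<in> carrier (obj Q' S)" by (rule pure'_closed[OF S x one_closed[OF S]])
  show "star S (a \<otimes>\<^bsub>obj A S\<^esub> a') (pure' S x t) = star S a (star S a' (pure' S x t))"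
    unfolding pure'_smult_one[OF S x t] star_smult[OF S aa' t p] star_smult[OF S a' t p]
      star_smult[OF S a t star_closed[OF S a' p]] star_mult_point[OF S a a' x] ..
qed

lemma one_A: "algebra R S \<Longrightarrow> \<one>\<^bsub>obj A S\<^esub> \<in> carrier (obj A S)"
  by (rule ring.ring_simprules(6)[OF ring_A])

text \<open>The unit of the algebra and the points with second factor one are base changes from
  \<open>R\<close>. There the law holds by injectivity, and \<open>star_arr\<close> transports
  it.\<close>

lemma star_one:
  assumes S: "algebra R S" and z: "z \<in> carrier (obj Q' S)"
  shows "star S \<one>\<^bsub>obj A S\<^esub> z = z"
proof (rule Q'_eqI[OF S star(1)[OF S one_A[OF S]] _ _ z])
  interpret q: module S "obj Q' S" by (rule module_functorD(1)[OF Q' S])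
  show "abelian_group_hom (obj Q' S) (obj Q' S) (\<lambda>z. z)"
    by (intro abelian_group_homI' q.M.abelian_group_axioms) auto
  fix x t assume x: "x \<in> N" and t: "t \<in> carrier S"
  have p: "pure' S x \<one>\<^bsub>S\<^esub> \<in> carrier (obj Q' S)" by (rule pure'_closed[OF S x one_closed[OF S]])
  note p0 = point'_closed[OF x] and u = unit_hom_in[OF S]
  have "star R0 \<one>\<^bsub>obj A R0\<^esub> (pure' R0 x \<one>\<^bsub>R\<^esub>) = pure' R0 x \<one>\<^bsub>R\<^esub>"
  proof (rule incl_inj)
    have "incl R0 (pure' R0 x \<one>\<^bsub>R\<^esub>) \<in> carrier (obj Q R0)"
      by (rule abelian_group_hom.hom_closed[OF incl_hom[OF R0] p0])
    then show "incl R0 (star R0 \<one>\<^bsub>obj A R0\<^esub> (pure' R0 x \<one>\<^bsub>R\<^esub>)) = incl R0 (pure' R0 x \<one>\<^bsub>R\<^esub>)"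
      unfolding incl_star[OF R0 one_A[OF R0] p0] by (rule extends_actionD(6)[OF \<theta> R0])
  qed (rule star_closed[OF R0 one_A[OF R0] p0], rule p0)
  moreover have "arr A R0 S (unit_hom R S) \<one>\<^bsub>obj A R0\<^esub> = \<one>\<^bsub>obj A S\<^esub>"
    using ring_hom_one[OF algebra_functorD(3)[OF algebra_functor R0 S u]] .
  ultimately have "star S \<one>\<^bsub>obj A S\<^esub> (pure' S x \<one>\<^bsub>S\<^esub>) = pure' S x \<one>\<^bsub>S\<^esub>"
    using star_arr[OF R0 S u one_A[OF R0] p0] arr_point[OF S x] by simp
  then show "star S \<one>\<^bsub>obj A S\<^esub> (pure' S x t) = pure' S x t"
    unfolding pure'_smult_one[OF S x t] star_smult[OF S one_A[OF S] t p] by simp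
qed

text \<open>\<open>G\<close> acts through its evaluations in the dual algebra; the component at
  \<open>\<phi>\<close> uses the evaluation base changed to \<open>T\<close>.\<close>

definition \<rho>' :: "('u, 'g, 'u tensor) action" where
  "\<rho>' S g = family_over R S (\<lambda>T \<phi>. \<lambda>z\<in>carrier (obj Q' T). star T (arr A S T \<phi> (evaluation R G S g)) z)"

lemma act_\<rho>':
  assumes S: "algebra R S" and g: "g \<in> carrier (obj G S)" and z: "z \<in> carrier (obj Q' S)"
  shows "act \<rho>' S g z = star S (evaluation R G S g) z"
  using alg_over_id[OF S] z module_functorD(5)[OF A.is_functor S evaluation_closed[OF A S g]]
  by (simp add: act_def \<rho>'_def)

text \<open>The monoid laws are \<open>star_mult\<close> and \<open>star_one\<close>, since
  evaluation is a morphism of monoids and base change on the dual algebra respects products and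
  units.\<close>

lemma G_module_\<rho>': "G_module R G Q' \<rho>'"
  unfolding G_module_def monoid_morphism_def set_morphism_def
proof (intro conjI allI impI Q')
  have GS: "set_functor R G" using G by (simp add: monoid_functor_def)
  have ev_mon: "evaluation R G S \<in> hom (obj G S) (obj A S)" "evaluation R G S \<one>\<^bsub>obj G S\<^esub> = \<one>\<^bsub>obj A S\<^esub>"
    if "algebra R S" for S
    using A that unfolding dual_algebra_def monoid_morphism_def by blast+
  have G_mon: "Group.monoid (obj G S)" if "algebra R S" for S
    using G that by (simp add: monoid_functor_def)
  note ev = evaluation_closed[OF A]
  fix S :: "'u alg" assume S: "algebra R S"
  show in_End: "\<rho>' S \<in> carrier (obj G S) \<rightarrow> carrier (obj (End_functor R Q') S)"
    using lin_Hom_overI[OF Q' S star_natural_linear_right[OF S ev[OF S]]] by (simp add: \<rho>'_def)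
  show "\<rho>' T (arr G S T h g) = arr (End_functor R Q') S T h (\<rho>' S g)"
    if T: "algebra R T" and h: "h \<in> alg_hom R S T" and g: "g \<in> carrier (obj G S)" for T h g
  proof (rule family_eqI)
    show "\<rho>' T (arr G S T h g) = family_over R T (\<rho>' T (arr G S T h g))" by (simp add: \<rho>'_def)
    show "arr (End_functor R Q') S T h (\<rho>' S g) = family_over R T (arr (End_functor R Q') S T h (\<rho>' S g))"
      by (simp add: restrict_family_def)
    fix U \<phi> assume U: "alg_over R T U \<phi>"
    note U' = alg_overD[OF U]
    have SU: "alg_over R S U (compose (carrier S) \<phi> h)"
      using alg_over_compose[OF S _ U] T h by (simp add: alg_over_def)
    have "\<rho>' T (arr G S T h g) U \<phi> =
        restrict (star U (arr A T U \<phi> (evaluation R G T (arr G S T h g)))) (carrier (obj Q' U))"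
      unfolding \<rho>'_def family_over_apply[OF U] ..
    also have "\<dots> = restrict (star U (arr A S U (compose (carrier S) \<phi> h) (evaluation R G S g))) (carrier (obj Q' U))"
      unfolding evaluation_natural[OF A S T h g] module_functorD(6)[OF A.is_functor S T U'(1) h U'(2) ev[OF S g]] ..
    also have "\<dots> = arr (End_functor R Q') S T h (\<rho>' S g) U \<phi>"
      unfolding End_functor_simps(6) restrict_family_apply[OF U] \<rho>'_def family_over_apply[OF SU] ..
    finally show "\<rho>' T (arr G S T h g) U \<phi> = arr (End_functor R Q') S T h (\<rho>' S g) U \<phi>" .
  qed
  show "\<rho>' S \<in> hom (obj G S) (obj (End_functor R Q') S)"
  proof (rule homI)
    show "\<rho>' S g \<in> carrier (obj (End_functor R Q') S)" if "g \<in> carrier (obj G S)" for g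
      using in_End that by blast
    fix g g' assume g: "g \<in> carrier (obj G S)" and g': "g' \<in> carrier (obj G S)"
    show "\<rho>' S (g \<otimes>\<^bsub>obj G S\<^esub> g') = \<rho>' S g \<otimes>\<^bsub>obj (End_functor R Q') S\<^esub> \<rho>' S g'"
    proof (rule family_eqI)
      show "\<rho>' S (g \<otimes>\<^bsub>obj G S\<^esub> g') = family_over R S (\<rho>' S (g \<otimes>\<^bsub>obj G S\<^esub> g'))" by (simp add: \<rho>'_def)
      show "\<rho>' S g \<otimes>\<^bsub>obj (End_functor R Q') S\<^esub> \<rho>' S g' =
          family_over R S (\<rho>' S g \<otimes>\<^bsub>obj (End_functor R Q') S\<^esub> \<rho>' S g')" by simp
      fix T \<phi> assume T: "alg_over R S T \<phi>"
      note T' = alg_overD[OF T]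
      have evT: "arr A S T \<phi> (evaluation R G S k) \<in> carrier (obj A T)" if "k \<in> carrier (obj G S)" for k
        using module_functorD(3)[OF A.is_functor S T' ev[OF S that]] .
      have mult: "arr A S T \<phi> (evaluation R G S (g \<otimes>\<^bsub>obj G S\<^esub> g')) =
          arr A S T \<phi> (evaluation R G S g) \<otimes>\<^bsub>obj A T\<^esub> arr A S T \<phi> (evaluation R G S g')"
        using hom_mult[OF ev_mon(1)[OF S] g g']
          ring_hom_mult[OF algebra_functorD(3)[OF algebra_functor S T'] ev[OF S g] ev[OF S g']] by simp
      show "\<rho>' S (g \<otimes>\<^bsub>obj G S\<^esub> g') T \<phi> = (\<rho>' S g \<otimes>\<^bsub>obj (End_functor R Q') S\<^esub> \<rho>' S g') T \<phi>"
        using T star_mult[OF T'(1) evT[OF g] evT[OF g']] star_closed[OF T'(1) evT[OF g']]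
        by (auto simp: \<rho>'_def mult compose_def simp del: quasi_coherent_simps intro!: restrict_ext)
    qed
  qed
  show "\<rho>' S \<one>\<^bsub>obj G S\<^esub> = \<one>\<^bsub>obj (End_functor R Q') S\<^esub>"
  proof (rule family_eqI)
    show "\<rho>' S \<one>\<^bsub>obj G S\<^esub> = family_over R S (\<rho>' S \<one>\<^bsub>obj G S\<^esub>)"
      "\<one>\<^bsub>obj (End_functor R Q') S\<^esub> = family_over R S \<one>\<^bsub>obj (End_functor R Q') S\<^esub>" by (simp_all add: \<rho>'_def)
    fix T \<phi> assume T: "alg_over R S T \<phi>"
    note T' = alg_overD[OF T]
    have "arr A S T \<phi> \<one>\<^bsub>obj A S\<^esub> = \<one>\<^bsub>obj A T\<^esub>"
      using ring_hom_one[OF algebra_functorD(3)[OF algebra_functor S T']] .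
    then show "\<rho>' S \<one>\<^bsub>obj G S\<^esub> T \<phi> = \<one>\<^bsub>obj (End_functor R Q') S\<^esub> T \<phi>"
      using T star_one[OF T'(1)] ev_mon(2)[OF S]
      by (auto simp: \<rho>'_def simp del: quasi_coherent_simps intro!: restrict_ext)
  qed
qed

lemma stable_G_submodule: "quasi_coherent_G_submodule R G M \<tau> N"
  unfolding quasi_coherent_G_submodule_def
proof (intro conjI exI[of _ \<rho>'] sub G_module_\<rho>')
  show "G_module_morphism R G Q' \<rho>' Q \<tau> incl"
    unfolding G_module_morphism_def
  proof (intro conjI allI impI ballI quasi_coherent_incl_morphism[OF M sub])
    fix S :: "'u alg" and g z assume S: "algebra R S" and g: "g \<in> carrier (obj G S)" and z: "z \<in> carrier (obj Q' S)"
    show "incl S (act \<rho>' S g z) = act \<tau> S g (incl S z)"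
      unfolding act_\<rho>'[OF S g z] incl_star[OF S evaluation_closed[OF A S g] z] extends_actionD(2)[OF \<theta> S g] ..
  qed
qed

end

section \<open>Equivariance and stability tested on the dual algebra over \<open>R\<close>\<close>

theorem theorem4p6:
  fixes R :: "'u ring"
    and G :: "('u, 'g) monoid_ftor"
    and A :: "('u, ('u, 'g) dist) module_ftor"
    and M :: "('u, 'x) module_ftor" and \<rho> :: "('u, 'g, 'x) action"
    and M' :: "('u, 'y) module_ftor" and \<rho>' :: "('u, 'g, 'y) action"
    and \<sigma> :: "('u, ('u, 'g) dist, 'x) action" and \<sigma>' :: "('u, ('u, 'g) dist, 'y) action"
    and f :: "'u alg \<Rightarrow> 'x \<Rightarrow> 'y"
    and N :: "('u, 'u) module" and \<tau> :: "('u, 'g, 'u tensor) action"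
    and \<theta> :: "('u, ('u, 'g) dist, 'u tensor) action"
  assumes "infinite (UNIV :: 'u set)"
    and "cring R"
    and "monoid_functor R G"
    and "essentially_free R (function_functor R G)"
    and "dual_algebra R G A"
  shows "(G_module R G M \<rho> \<and> G_module R G M' \<rho>' \<and>
          essentially_free R M \<and> essentially_free R M' \<and>
          extends_action R G A M \<rho> \<sigma> \<and> extends_action R G A M' \<rho>' \<sigma>' \<and>
          module_morphism R M M' f \<longrightarrow>
            (G_module_morphism R G M \<rho> M' \<rho>' f \<longleftrightarrow>
             left_module_hom (obj A (self_module R))
               (obj M (self_module R)) (act \<sigma> (self_module R))
               (obj M' (self_module R)) (act \<sigma>' (self_module R)) (f (self_module R)))) \<and>
         (module R N \<and> G_module R G (quasi_coherent R N) \<tau> \<and>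
          extends_action R G A (quasi_coherent R N) \<tau> \<theta> \<longrightarrow>
            {N'. quasi_coherent_G_submodule R G N \<tau> N'} =
            {N'. left_submodule (obj A (self_module R)) N (action_on_module R N \<theta>) N'})"
proof (intro conjI impI)
  assume "G_module R G M \<rho> \<and> G_module R G M' \<rho>' \<and>
      essentially_free R M \<and> essentially_free R M' \<and>
      extends_action R G A M \<rho> \<sigma> \<and> extends_action R G A M' \<rho>' \<sigma>' \<and>
      module_morphism R M M' f"
  then show "G_module_morphism R G M \<rho> M' \<rho>' f \<longleftrightarrow>
      left_module_hom (obj A (self_module R))
        (obj M (self_module R)) (act \<sigma> (self_module R))
        (obj M' (self_module R)) (act \<sigma>' (self_module R)) (f (self_module R))"
    using G_module_morphism_iff[OF assms] by blast
next
  assume N: "module R N \<and> G_module R G (quasi_coherent R N) \<tau> \<and>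
      extends_action R G A (quasi_coherent R N) \<tau> \<theta>"
  obtain J \<K> c where "coordinates R (function_functor R G) J \<K> c"
    using essentially_free_coordinates[OF assms(1,2,4)] .
  then interpret F: coordinates R "function_functor R G" J \<K> c .
  obtain m e where Adef: "A = with_mult_one (dual_functor R (function_functor R G)) m e"
    and AF: "module_functor R A" using dual_algebraD[OF assms(5)] by blast
  \<comment> \<open>The lifting argument works with coordinates on the dual algebra, which are
    inherited from those on the functions on \<open>G\<close>.\<close>
  note coords = F.dual_coordinates[OF Adef AF]
  have "quasi_coherent_G_submodule R G N \<tau> N' \<longleftrightarrow>
      left_submodule (obj A (self_module R)) N (action_on_module R N \<theta>) N'" for N'
  proof
    assume sub: "quasi_coherent_G_submodule R G N \<tau> N'"
    have "submodule N' R N" using sub by (simp add: quasi_coherent_G_submodule_def)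
    then have "additive_subgroup N' N" by (simp add: submodule_def additive_subgroup_def)
    moreover have "action_on_module R N \<theta> a x \<in> N'" if "a \<in> carrier (obj A (self_module R))" "x \<in> N'" for a x
      using G_submodule_stable[OF assms _ _ sub that] N by blast
    ultimately show "left_submodule (obj A (self_module R)) N (action_on_module R N \<theta>) N'"
      by (simp add: left_submodule_def)
  next
    assume "left_submodule (obj A (self_module R)) N (action_on_module R N \<theta>) N'"
    then interpret stable R G A N \<tau> \<theta> N' J F.perp F.dual_coord
      using assms N coords by (intro stable.intro) auto
    show "quasi_coherent_G_submodule R G N \<tau> N'" by (rule stable_G_submodule)
  qed
  then show "{N'. quasi_coherent_G_submodule R G N \<tau> N'} =
      {N'. left_submodule (obj A (self_module R)) N (action_on_module R N \<theta>) N'}" by simp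
qed

end
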